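(* Let $K\ge 1$ be an integer. For a probability distribution $F$ on $\mathbb{R}$, let $(S_k)_{k\ge 0}$ be a random walk with $S_0=0$, $S_k=\sum_{t=1}^k X_t$, with i.i.d. increments $X_t\sim F$ satisfying $\mathbb{E}[X_1]=\mu<0$, and let $(S_{t,i})_{t\ge 0}$, $i=1,\dots,K$, be independent copies of it (independent of each other and of $(S_k)_{k\ge0}$). The decision-maker does not know $F$, has access to the auxiliary data $D=(S_{t,i}^+)_{t\ge 0,\,1\le i\le K}$, and sequentially observes the rewards $S_1^+,S_2^+,\dots$. (a) (Prophet inequality) Let $\tau$ be the stopping time induced by the Poissonised stopping rule (defined in the context). Then $$\mathbb{E}[S_\tau^+]\ \ge\ \left(\frac{K}{K+1}\right)^{K+1}\mathbb{E}\Big[\max_{k\ge 0}S_k\Big].$$ (b) (Sharpness) Among all stopping rules that have access to the auxiliary data $D$, the constant $\left(\frac{K}{K+1}\right)^{K+1}$ is optimal: for every $c>\left(\frac{K}{K+1}\right)^{K+1}$ there is no (possibly randomised) stopping rule $\boldsymbol r$ with access to $D$, chosen without knowledge of $F$, whose induced stopping time $\tau(\boldsymbol r)$ satisfies $\mathbb{E}[S_{\tau(\boldsymbol r)}^+]\ge c\,\mathbb{E}[\max_{k\ge 0}S_k]$ for all increment distributions $F$ with negative mean.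
   Context: Notation: $x^+=\max\{0,x\}$. Stopping rules. A (possibly randomised) stopping rule with access to data $D$ is a family $\boldsymbol r=(r_k)_{k\ge1}$ of measurable functions, where $r_k(d,z_1,\dots,z_k)\in[0,1]$ is the probability of stopping at time $k$ given $D=d$ and the observed rewards $S_1^+=z_1,\dots,S_k^+=z_k$, conditional on not having stopped earlier. It induces a stopping time $\tau(\boldsymbol r)\in\mathbb{N}\cup\{\infty\}$ with $$\mathbb{P}(\tau(\boldsymbol r)=k\mid D=d,S_1^+=z_1,\dots,S_k^+=z_k)=r_k(d,z_1,\dots,z_k)\prod_{j=1}^{k-1}(1-r_j(d,z_1,\dots,z_j)),$$ where the randomisation is independent of the future of the process (e.g. $\tau(\boldsymbol r)=\inf\{k: U_k\le r_k(D,S_1^+,\dots,S_k^+)\}$ with $U_1,U_2,\dots$ i.i.d. uniform on $(0,1)$ and independent of everything else). If $\tau=\infty$ (never stopping) the reward $S_\tau^+$ is $0$. Ladder epochs. For a path $(s_k)_{k\ge 0}$ with $s_0=0$, the strictly ascending ladder times are $T_0=0$, $T_{i+1}=\inf\{k>T_i: s_k>s_{T_i}\}$ (with $\inf\emptyset=\infty$); the $i$-th ladder epoch ($i\ge1$) exists if $T_i<\infty$, and the number of ladder epochs is $\max\{i:T_i<\infty\}$. These are determined by the path of positive parts $(s_k^+)_{k\ge0}$. Poissonised stopping rule. Let $G_i$ be the number of ladder epochs of the $i$-th sample path and $\bar G=\frac1K\sum_{i=1}^K G_i$. Conditional on $\bar G$, draw $Y$ (independently of $(S_k)_{k\ge0}$)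 with $Y-1\sim\mathrm{Pois}(\bar G)$, the Poisson distribution with mean $\bar G$ (the point mass at $0$ if $\bar G=0$). The rule stops at the $Y$-th ladder epoch of $(S_k)_{k\ge0}$ if it exists; otherwise it never stops and receives reward $0$. *)

theory Defs
  imports "HOL-Probability.Probability"
begin

definition negative_mean_dist :: "real measure \<Rightarrow> bool" where
  "negative_mean_dist F \<longleftrightarrow>
     prob_space F \<and> sets F = sets borel \<and> integrable F (\<lambda>x. x) \<and> (\<integral>x. x \<partial>F) < 0"

(* X i t is the t-th increment (t >= 1) of the i-th walk. Index i = 0 is the walk that the
   decision-maker faces; i = 1, ..., K are the auxiliary copies. Values of X outside
   {0..K} x {1..} are irrelevant. *)

definition walk_increments ::
    "nat \<Rightarrow> real measure \<Rightarrow> 'w measure \<Rightarrow> (nat \<Rightarrow> nat \<Rightarrow> 'w \<Rightarrow> real) \<Rightarrow> bool" where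
  "walk_increments K F M X \<longleftrightarrow>
     prob_space M \<and>
     prob_space.indep_vars M (\<lambda>_. borel) (\<lambda>(i, t). X i t) ({0..K} \<times> {1..}) \<and>
     (\<forall>i\<in>{0..K}. \<forall>t\<in>{1..}. distr M borel (X i t) = F)"

definition walk :: "(nat \<Rightarrow> nat \<Rightarrow> 'w \<Rightarrow> real) \<Rightarrow> nat \<Rightarrow> 'w \<Rightarrow> nat \<Rightarrow> real" where
  "walk X i \<omega> k = (\<Sum>t = 1..k. X i t \<omega>)"

definition aux_data :: "nat \<Rightarrow> (nat \<Rightarrow> nat \<Rightarrow> 'w \<Rightarrow> real) \<Rightarrow> 'w \<Rightarrow> nat \<times> nat \<Rightarrow> real" where
  "aux_data K X \<omega> = (\<lambda>(i, t) \<in> {1..K} \<times> UNIV. max 0 (walk X i \<omega> t))"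

definition aux_space :: "nat \<Rightarrow> (nat \<times> nat \<Rightarrow> real) measure" where
  "aux_space K = (\<Pi>\<^sub>M p\<in>{1..K} \<times> UNIV. borel)"

(* The truncation of ennreal at 0 changes nothing, because walk X 0 w 0 = 0. The supremum is
   almost surely a maximum, since a walk with negative drift tends to minus infinity. *)

definition expected_max :: "'w measure \<Rightarrow> (nat \<Rightarrow> nat \<Rightarrow> 'w \<Rightarrow> real) \<Rightarrow> ennreal" where
  "expected_max M X = (\<integral>\<^sup>+\<omega>. (SUP k. ennreal (walk X 0 \<omega> k)) \<partial>M)"

fun stopped_reward :: "(nat \<Rightarrow> real) \<Rightarrow> enat \<Rightarrow> real" where
  "stopped_reward s (enat k) = max 0 (s k)"
| "stopped_reward s \<infinity> = 0"

definition expected_reward ::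
    "'w measure \<Rightarrow> (nat \<Rightarrow> nat \<Rightarrow> 'w \<Rightarrow> real) \<Rightarrow> ('w \<Rightarrow> enat) \<Rightarrow> ennreal" where
  "expected_reward M X \<tau> = (\<integral>\<^sup>+\<omega>. ennreal (stopped_reward (walk X 0 \<omega>) (\<tau> \<omega>)) \<partial>M)"


subsection \<open>Randomised stopping rules\<close>

definition stopping_rule ::
    "nat \<Rightarrow> (nat \<Rightarrow> (nat \<times> nat \<Rightarrow> real) \<Rightarrow> (nat \<Rightarrow> real) \<Rightarrow> real) \<Rightarrow> bool" where
  "stopping_rule K r \<longleftrightarrow>
     (\<forall>k\<ge>1. (\<lambda>(d, z). r k d z) \<in> borel_measurable (aux_space K \<Otimes>\<^sub>M (\<Pi>\<^sub>M j\<in>{1..k}. borel)) \<and>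
        (\<forall>d\<in>space (aux_space K). \<forall>z\<in>space (\<Pi>\<^sub>M j\<in>{1..k}. borel).
           r k d z \<in> {0..1}))"

(* The randomisation U consists of independent uniform variables, independent of all walks. *)

definition randomised_walk_increments ::
    "nat \<Rightarrow> real measure \<Rightarrow> 'w measure \<Rightarrow> (nat \<Rightarrow> nat \<Rightarrow> 'w \<Rightarrow> real) \<Rightarrow> (nat \<Rightarrow> 'w \<Rightarrow> real) \<Rightarrow> bool"
  where
  "randomised_walk_increments K F M X U \<longleftrightarrow>
     walk_increments K F M X \<and>
     prob_space.indep_vars M (\<lambda>_. borel) (case_sum (\<lambda>(i, t). X i t) U)
       (({0..K} \<times> {1..}) <+> {1..}) \<and>
     (\<forall>k\<ge>1. distr M borel (U k) = uniform_measure lborel {0<..<1})"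

(* The infimum of the empty set in enat is infinity: the rule never stops. *)

definition induced_time ::
    "nat \<Rightarrow> (nat \<Rightarrow> (nat \<times> nat \<Rightarrow> real) \<Rightarrow> (nat \<Rightarrow> real) \<Rightarrow> real) \<Rightarrow>
     (nat \<Rightarrow> nat \<Rightarrow> 'w \<Rightarrow> real) \<Rightarrow> (nat \<Rightarrow> 'w \<Rightarrow> real) \<Rightarrow> 'w \<Rightarrow> enat" where
  "induced_time K r X U \<omega> =
     Inf (enat ` {k. k \<ge> 1 \<and> U k \<omega> \<le> r k (aux_data K X \<omega>) (\<lambda>j\<in>{1..k}. max 0 (walk X 0 \<omega> j))})"


subsection \<open>Ladder epochs and the Poissonised rule\<close>

primrec ladder_time :: "(nat \<Rightarrow> real) \<Rightarrow> nat \<Rightarrow> enat" where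
  "ladder_time s 0 = 0"
| "ladder_time s (Suc i) =
     (case ladder_time s i of enat m \<Rightarrow> Inf (enat ` {k. k > m \<and> s k > s m}) | \<infinity> \<Rightarrow> \<infinity>)"

(* For a walk with negative drift the set below is almost surely finite; Max has an unspecified
   value on the remaining null event. *)

definition num_ladder_epochs :: "(nat \<Rightarrow> real) \<Rightarrow> nat" where
  "num_ladder_epochs s = Max {i. ladder_time s i < \<infinity>}"

definition mean_ladder_epochs :: "nat \<Rightarrow> (nat \<Rightarrow> nat \<Rightarrow> 'w \<Rightarrow> real) \<Rightarrow> 'w \<Rightarrow> real" where
  "mean_ladder_epochs K X \<omega> = (\<Sum>i = 1..K. real (num_ladder_epochs (walk X i \<omega>))) / real K"

(* poisson_pmf requires a positive rate. *)

definition poisson0_pmf :: "real \<Rightarrow> nat pmf" where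
  "poisson0_pmf a = (if a = 0 then return_pmf 0 else poisson_pmf a)"

(* Y is drawn for the Poissonised rule: the main walk is independent of the auxiliary data and Y
   together, and the conditional law of Y - 1 given the mean number G of ladder epochs is Pois(G).
   Independence is stated with generated sigma-algebras, because indep_var wants both variables
   to have the same type; it includes the measurability of Y. The values Suc n exhaust the law of Y, so Y >= 1 almost surely. *)

definition poissonised_index ::
    "nat \<Rightarrow> 'w measure \<Rightarrow> (nat \<Rightarrow> nat \<Rightarrow> 'w \<Rightarrow> real) \<Rightarrow> ('w \<Rightarrow> nat) \<Rightarrow> bool" where
  "poissonised_index K M X Y \<longleftrightarrow>
     prob_space.indep_set M
       (sets (vimage_algebra (space M) (walk X 0) (\<Pi>\<^sub>M t\<in>UNIV. borel)))
       (sets (vimage_algebra (space M) (\<lambda>\<omega>. (aux_data K X \<omega>, Y \<omega>))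
          (aux_space K \<Otimes>\<^sub>M count_space UNIV))) \<and>
     (\<forall>n. AE \<omega> in M.
        real_cond_exp M (vimage_algebra (space M) (mean_ladder_epochs K X) borel)
          (indicator {\<omega> \<in> space M. Y \<omega> = Suc n}) \<omega>
        = pmf (poisson0_pmf (mean_ladder_epochs K X \<omega>)) n)"

definition poissonised_time :: "(nat \<Rightarrow> nat \<Rightarrow> 'w \<Rightarrow> real) \<Rightarrow> ('w \<Rightarrow> nat) \<Rightarrow> 'w \<Rightarrow> enat" where
  "poissonised_time X Y \<omega> = ladder_time (walk X 0 \<omega>) (Y \<omega>)"

end

theory Submission
  imports Defs
begin

text \<open>
  \<^bold>\<open>The inequality.\<close> Let \<open>q\<close> be the probability that the walk ever becomes positive, \<open>p = 1 - q\<close>, and let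
  \<open>h\<close> be the mean of the first positive value, counted as 0 if there is none. By the strong Markov property
  at the first ladder time, the walk has at least \<open>n\<close> ladder epochs with probability \<open>q ^ n\<close>, its mean value at
  the \<open>n\<close>-th one (again 0 if there is none) is \<open>n * q ^ (n - 1) * h\<close>, and the expected maximum is at
  most \<open>h / p\<close>. Negative drift gives \<open>q < 1\<close> (\<open>ladder_prob_less_1\<close>). Given the mean \<open>G\<close> of the
  \<open>K\<close> auxiliary ladder counts, the Poissonised rule therefore earns \<open>h * exp (- p * G) * (1 + q * G)\<close>. The counts
  are independent and geometric, so the expectation of this is an explicit function of \<open>p\<close>
  (\<open>nn_integral_mean_ladder_epochs\<close>), and \<open>poissonised_constant_le\<close> shows that it is at least
  \<open>(K / (K + 1)) ^ (K + 1) * h / p\<close>.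

  \<^bold>\<open>Sharpness.\<close> Let each step be \<open>1\<close> with probability \<open>q = 1 - p\<close> and \<open>- B\<close> otherwise. All these walks,
  for all \<open>p\<close> and \<open>B\<close>, are driven by the same uniform seeds. As \<open>B\<close> grows, almost surely the positive parts of
  the finitely many walks eventually coincide with those of walks that climb for a geometric time and then are
  dead. By dominated convergence, a guarantee \<open>c\<close> passes to this limit (\<open>guarantee_le_limit\<close>). There a rule
  sees only the \<open>K\<close> auxiliary survival times and the fact that the main walk is still alive, so it amounts to
  a random stopping time whose law depends on these \<open>K\<close> numbers but not on \<open>p\<close>.

  This limit problem is solved by averaging over a prior for \<open>p\<close> that is close to \<open>dp / p\<close>, the prior
  which is invariant under rescaling of time. If the auxiliary survival times add up to \<open>n\<close>, the posterior value
  of stopping at time \<open>y\<close> is a ratio of Beta integrals, which for large \<open>n\<close> is essentially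
  \<open>K * y * n ^ K / (n + y) ^ (K + 1)\<close>. By the inequality of arithmetic and geometric means this never exceeds
  \<open>(K / (K + 1)) ^ (K + 1)\<close>. The prior has harmonic mass, which diverges, while small \<open>n\<close> and the truncation
  of the prior contribute bounded amounts (\<open>bayes_bound\<close>).
\<close>

section \<open>Ladder times of a deterministic path\<close>

lemma Inf_enat_image_eq_iff: "Inf (enat ` A) = enat m \<longleftrightarrow> m \<in> A \<and> (\<forall>k<m. k \<notin> A)"
proof (cases "A = {}")
  case True
  then show ?thesis by (simp add: Inf_enat_def)
next
  case False
  then obtain a where a: "a \<in> A" by auto
  define l where "l = (LEAST k. k \<in> A)"
  have l: "l \<in> A" "\<And>k. k \<in> A \<Longrightarrow> l \<le> k"
    using a by (auto simp: l_def intro: LeastI Least_le)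
  have "Inf (enat ` A) = enat l"
    using l by (intro antisym Inf_greatest) (auto intro: Inf_lower)
  then show ?thesis
    using l by (metis enat.inject le_neq_implies_less not_less)
qed

lemma ladder_time_Suc_eq_iff:
  "ladder_time s (Suc i) = enat m \<longleftrightarrow>
    (\<exists>j<m. ladder_time s i = enat j \<and> s j < s m \<and> (\<forall>k. j < k \<and> k < m \<longrightarrow> s k \<le> s j))"
proof (cases "ladder_time s i")
  case (enat j)
  then show ?thesis
    by (simp add: Inf_enat_image_eq_iff) (meson not_less)
qed simp

lemma ladder_time_Suc_infinity: "ladder_time s i = \<infinity> \<Longrightarrow> ladder_time s (Suc i) = \<infinity>"
  by simp

lemma ladder_time_finite_antimono: "i \<le> j \<Longrightarrow> ladder_time s j < \<infinity> \<Longrightarrow> ladder_time s i < \<infinity>"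
proof (induction j)
  case (Suc j)
  then show ?case
    by (metis enat_ord_simps(4) ladder_time_Suc_infinity le_SucE)
qed simp

lemma ladder_time_first_infinity: "ladder_time s 1 = \<infinity> \<Longrightarrow> ladder_time s (Suc i) = \<infinity>"
  by (induction i) auto

declare ladder_time.simps(2) [simp del]

lemma ladder_value_ge_start: "ladder_time s i = enat m \<Longrightarrow> s 0 \<le> s m"
proof (induction i arbitrary: m)
  case 0
  then show ?case by (simp add: zero_enat_def)
next
  case (Suc i)
  then obtain j where "ladder_time s i = enat j" "s j < s m"
    by (auto simp only: ladder_time_Suc_eq_iff)
  with Suc.IH[of j] show ?case by simp
qed

text \<open>Ladder times are defined by appending one more ladder epoch at the end. For the Markov
  property at the first ladder time they have to be unrolled from the front instead.\<close>

lemma ladder_time_Suc_shift: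
  assumes "ladder_time s 1 = enat m"
  shows "ladder_time s (Suc i) = enat n \<longleftrightarrow>
    (\<exists>j. n = m + j \<and> ladder_time (\<lambda>k. s (m + k) - s m) i = enat j)"
proof (induction i arbitrary: n)
  case 0
  show ?case using assms by (auto simp: zero_enat_def)
next
  case (Suc i)
  let ?s = "\<lambda>k. s (m + k) - s m"
  have "ladder_time s (Suc (Suc i)) = enat n \<longleftrightarrow>
    (\<exists>j<n. ladder_time s (Suc i) = enat j \<and> s j < s n \<and> (\<forall>k. j < k \<and> k < n \<longrightarrow> s k \<le> s j))"
    by (rule ladder_time_Suc_eq_iff)
  also have "\<dots> \<longleftrightarrow> (\<exists>j l. n = m + l \<and> j < l \<and> ladder_time ?s i = enat j \<and> ?s j < ?s l \<and>
      (\<forall>k. j < k \<and> k < l \<longrightarrow> ?s k \<le> ?s j))" (is "?L = ?R")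
  proof
    assume ?L
    then obtain j where j: "m + j < n" "ladder_time ?s i = enat j" "s (m + j) < s n"
      "\<forall>k. m + j < k \<and> k < n \<longrightarrow> s k \<le> s (m + j)"
      by (auto simp only: Suc.IH)
    from j(1) obtain l where "n = m + l" "j < l"
      by (metis add_diff_inverse_nat add_less_cancel_left not_less
          add_leD1 less_imp_le_nat)
    with j show ?R by (intro exI[of _ j] exI[of _ l]) auto
  next
    assume ?R
    then obtain j l where *: "n = m + l" "j < l" "ladder_time ?s i = enat j" "?s j < ?s l"
      "\<forall>k. j < k \<and> k < l \<longrightarrow> ?s k \<le> ?s j" by blast
    have "s k \<le> s (m + j)" if "m + j < k \<and> k < n" for k
      using *(5)[rule_format, of "k - m"] that *(1) by (auto simp: less_diff_conv)
    moreover have "ladder_time s (Suc i) = enat (m + j)"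
      using * by (auto simp only: Suc.IH)
    ultimately show ?L using * by (intro exI[of _ "m + j"]) simp
  qed
  also have "\<dots> \<longleftrightarrow> (\<exists>l. n = m + l \<and> ladder_time ?s (Suc i) = enat l)"
    by (auto simp only: ladder_time_Suc_eq_iff)
  finally show ?case .
qed

lemma first_ladder_time_eq_iff:
  assumes "s 0 = (0::real)"
  shows "ladder_time s 1 = enat m \<longleftrightarrow> 0 < s m \<and> (\<forall>k<m. s k \<le> 0)"
proof -
  have "ladder_time s 1 = enat m \<longleftrightarrow> 0 < m \<and> 0 < s m \<and> (\<forall>k. 0 < k \<and> k < m \<longrightarrow> s k \<le> 0)"
    using ladder_time_Suc_eq_iff[of s 0 m] assms by (auto simp: zero_enat_def)
  then show ?thesis
    using assms by (metis less_irrefl gr0I order_refl)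
qed


section \<open>Random walks with independent and identically distributed steps\<close>

definition psum :: "(nat \<Rightarrow> real) \<Rightarrow> nat \<Rightarrow> real" where
  "psum x k = (\<Sum>t<k. x t)"

lemma psum_0 [simp]: "psum x 0 = 0"
  by (simp add: psum_def)

lemma psum_shift: "psum x (m + k) - psum x m = psum (\<lambda>t. x (m + t)) k"
  by (induction k) (auto simp: psum_def)

lemma psum_Suc_shift: "psum x (Suc k) = x 0 + psum (\<lambda>t. x (Suc t)) k"
  using psum_shift[of x 1 k] by (simp add: psum_def)

lemma psum_cong: "(\<And>t. t < k \<Longrightarrow> x t = y t) \<Longrightarrow> psum x k = psum y k"
  by (simp add: psum_def)

lemma walk_eq_psum: "walk X i \<omega> = psum (\<lambda>t. X i (Suc t) \<omega>)"
  by (auto simp: walk_def psum_def sum.atLeast1_atMost_eq)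

text \<open>The value of \<open>\<phi>\<close> at the \<open>n\<close>-th ladder value, or 0 if there are fewer ladder epochs: the choices
  \<open>\<phi> = (\<lambda>_. 1)\<close>, \<open>\<phi> = ennreal\<close> and a decreasing exponential give the tail of the number of ladder epochs, the
  mean ladder value and its Laplace transform.\<close>

definition at_ladder :: "(real \<Rightarrow> ennreal) \<Rightarrow> nat \<Rightarrow> (nat \<Rightarrow> real) \<Rightarrow> ennreal" where
  "at_ladder \<phi> n x = (case ladder_time (psum x) n of enat m \<Rightarrow> \<phi> (psum x m) | \<infinity> \<Rightarrow> 0)"

lemma suminf_if_eq_enat:
  "(\<Sum>m. if t = enat m then f m else 0) = (case t of enat m \<Rightarrow> f m | \<infinity> \<Rightarrow> (0::ennreal))"
proof (cases t)
  case (enat n)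
  have "(\<Sum>m. if t = enat m then f m else 0) = (\<Sum>m\<in>{n}. if t = enat m then f m else 0)"
    by (intro suminf_finite) (auto simp: enat)
  then show ?thesis by (simp add: enat)
qed simp

lemma at_ladder_eq_suminf:
  "at_ladder \<phi> n x = (\<Sum>m. if ladder_time (psum x) n = enat m then \<phi> (psum x m) else 0)"
  by (simp add: at_ladder_def suminf_if_eq_enat)

lemma at_ladder_Suc:
  "at_ladder \<phi> (Suc n) x =
    (\<Sum>m. if ladder_time (psum x) 1 = enat m
       then at_ladder (\<lambda>s. \<phi> (psum x m + s)) n (\<lambda>k. x (m + k)) else 0)"
proof (cases "ladder_time (psum x) 1")
  case (enat m)
  let ?y = "\<lambda>k. x (m + k)"
  have *: "ladder_time (psum x) (Suc n) = enat l \<longleftrightarrow>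
      (\<exists>j. l = m + j \<and> ladder_time (psum ?y) n = enat j)" for l
    using ladder_time_Suc_shift[OF enat, of n l] by (simp add: psum_shift)
  have "at_ladder \<phi> (Suc n) x = at_ladder (\<lambda>s. \<phi> (psum x m + s)) n ?y"
  proof (cases "ladder_time (psum ?y) n")
    case (enat j)
    then have "ladder_time (psum x) (Suc n) = enat (m + j)"
      using *[of "m + j"] by simp
    moreover have "psum x (m + j) = psum x m + psum ?y j"
      using psum_shift[of x m j] by simp
    ultimately show ?thesis by (simp add: at_ladder_def enat)
  next
    case infinity
    then have "ladder_time (psum x) (Suc n) = \<infinity>"
      using * by (cases "ladder_time (psum x) (Suc n)") auto
    then show ?thesis by (simp add: at_ladder_def infinity)
  qed
  then show ?thesis
    unfolding suminf_if_eq_enat by (simp add: enat del: One_nat_def)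
next
  case infinity
  then show ?thesis
    using ladder_time_first_infinity[OF infinity, of n]
    by (simp add: at_ladder_def suminf_if_eq_enat del: One_nat_def)
qed

text \<open>The maximum of the walk up to time \<open>n\<close>, written with the recursion of a queue (Lindley's
  recursion): removing the first step leaves a walk of the same law.\<close>

primrec run_max :: "nat \<Rightarrow> (nat \<Rightarrow> real) \<Rightarrow> real" where
  "run_max 0 x = 0"
| "run_max (Suc n) x = max 0 (x 0 + run_max n (\<lambda>k. x (Suc k)))"

lemma run_max_nonneg: "0 \<le> run_max n x"
  by (cases n) auto

lemma run_max_mono_Suc: "run_max n x \<le> run_max (Suc n) x"
proof (induction n arbitrary: x)
  case (Suc n)
  show ?case using Suc[of "\<lambda>k. x (Suc k)"] by auto
qed simp

lemma incseq_run_max: "incseq (\<lambda>n. run_max n x)"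
  by (intro incseq_SucI run_max_mono_Suc)

lemma psum_le_run_max: "k \<le> n \<Longrightarrow> psum x k \<le> run_max n x"
proof (induction n arbitrary: x k)
  case (Suc n)
  show ?case
  proof (cases k)
    case (Suc j)
    then show ?thesis
      using Suc.IH[of j "\<lambda>k. x (Suc k)"] Suc.prems by (simp add: psum_Suc_shift)
  qed simp
qed simp

lemma run_max_attained: "\<exists>k\<le>n. run_max n x = psum x k"
proof (induction n arbitrary: x)
  case (Suc n)
  obtain k where k: "k \<le> n" "run_max n (\<lambda>k. x (Suc k)) = psum (\<lambda>k. x (Suc k)) k"
    using Suc by blast
  show ?case
  proof (cases "0 \<le> x 0 + run_max n (\<lambda>k. x (Suc k))")
    case True
    then show ?thesis using k by (intro exI[of _ "Suc k"]) (simp add: psum_Suc_shift)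
  next
    case False
    then show ?thesis by (intro exI[of _ 0]) simp
  qed
qed auto

lemma SUP_psum_le_SUP_run_max:
  "(SUP k. ennreal (psum x k)) \<le> (SUP n. ennreal (run_max n x))"
  by (intro SUP_mono) (auto intro!: ennreal_leI psum_le_run_max)

locale iid_steps = sequence_space F for F :: "real measure" +
  assumes sets_F [simp, measurable_cong]: "sets F = sets borel"
begin

lemma space_F [simp]: "space F = UNIV"
  using sets_eq_imp_space_eq[OF sets_F] by simp

lemma space_S [simp]: "space S = UNIV"
  by (auto simp: space_PiM)

lemma measurable_into_F: "f \<in> borel_measurable N \<Longrightarrow> f \<in> measurable N F"
  by (simp only: measurable_cong_sets[OF refl sets_F])

lemma measurable_psum [measurable]: "(\<lambda>x. psum x k) \<in> borel_measurable S"
  unfolding psum_def by measurable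

lemma measurable_shift [measurable]: "(\<lambda>x k. x (m + k)) \<in> measurable S S"
  by (rule measurable_PiM_single') (auto intro!: measurable_component_singleton)

lemma measurable_shift_Suc [measurable]: "(\<lambda>x k. x (Suc k)) \<in> measurable S S"
  using measurable_shift[of 1] by simp

lemma measurable_run_max [measurable]: "run_max n \<in> borel_measurable S"
proof (induction n)
  case (Suc n)
  note [measurable] = Suc
  show ?case by simp
qed simp

lemma pred_ladder_time [measurable]:
  "Measurable.pred S (\<lambda>x. ladder_time (psum x) n = enat m)"
proof (induction n arbitrary: m)
  case 0
  show ?case by simp
next
  case (Suc n)
  have 1: "Measurable.pred S (\<lambda>x. psum x j < psum x m)" for j
    by measurable
  have le: "Measurable.pred S (\<lambda>x. psum x k \<le> psum x j)" for j k
    unfolding pred_def by (intro borel_measurable_le measurable_psum)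
  have "Measurable.pred S (\<lambda>x. \<forall>k\<in>{j<..<m}. psum x k \<le> psum x j)" for j
    by (intro pred_intros_countable_bounded le)
  then have 2: "Measurable.pred S (\<lambda>x. \<forall>k. j < k \<and> k < m \<longrightarrow> psum x k \<le> psum x j)" for j
    by (simp only: Ball_def greaterThanLessThan_iff)
  have "Measurable.pred S (\<lambda>x. \<exists>j\<in>{..<m}. ladder_time (psum x) n = enat j \<and>
      psum x j < psum x m \<and> (\<forall>k. j < k \<and> k < m \<longrightarrow> psum x k \<le> psum x j))"
    by (intro pred_intros_countable_bounded pred_intros_logic Suc 1 2)
  then show ?case
    by (simp only: ladder_time_Suc_eq_iff Bex_def lessThan_iff)
qed

lemma measurable_at_ladder [measurable]:
  assumes [measurable]: "\<phi> \<in> borel_measurable borel"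
  shows "at_ladder \<phi> n \<in> borel_measurable S"
proof -
  have "(\<lambda>x. at_ladder \<phi> n x) \<in> borel_measurable S"
    unfolding at_ladder_eq_suminf by measurable
  then show ?thesis by simp
qed

text \<open>Splicing two independent copies of the step sequence at a fixed time gives back its law, and then a
  functional of the past and one of the future depend on different copies.\<close>

lemma nn_integral_past_times_future:
  assumes [measurable]: "\<Phi> \<in> borel_measurable S" "\<psi> \<in> borel_measurable S"
  assumes past: "\<And>x y. (\<And>k. k < m \<Longrightarrow> x k = y k) \<Longrightarrow> \<Phi> x = \<Phi> y"
  shows "(\<integral>\<^sup>+x. \<Phi> x * \<psi> (\<lambda>k. x (m + k)) \<partial>S) = (\<integral>\<^sup>+x. \<Phi> x \<partial>S) * (\<integral>\<^sup>+x. \<psi> x \<partial>S)"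
proof -
  have *: "\<Phi> (comb_seq m x y) * \<psi> (\<lambda>k. comb_seq m x y (m + k)) = \<Phi> x * \<psi> y" for x y
    using past[of "comb_seq m x y" x] by (simp add: comb_seq_def)
  have "(\<integral>\<^sup>+x. \<Phi> x * \<psi> (\<lambda>k. x (m + k)) \<partial>S) =
      (\<integral>\<^sup>+x. \<Phi> x * \<psi> (\<lambda>k. x (m + k)) \<partial>distr (S \<Otimes>\<^sub>M S) S (\<lambda>(x, y). comb_seq m x y))"
    by (simp add: PiM_comb_seq)
  also have "\<dots> = (\<integral>\<^sup>+(x, y). \<Phi> x * \<psi> y \<partial>(S \<Otimes>\<^sub>M S))"
    by (subst nn_integral_distr) (auto simp: * split_beta' intro!: nn_integral_cong)
  also have "\<dots> = (\<integral>\<^sup>+x. \<integral>\<^sup>+y. \<Phi> x * \<psi> y \<partial>S \<partial>S)"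
    by (subst P.nn_integral_fst[symmetric]) auto
  also have "\<dots> = (\<integral>\<^sup>+x. \<Phi> x \<partial>S) * (\<integral>\<^sup>+x. \<psi> x \<partial>S)"
    by (simp add: nn_integral_cmult nn_integral_multc)
  finally show ?thesis .
qed

text \<open>The strong Markov property at the first ladder time. It reduces to fixed times because the
  event that this time equals \<open>m\<close> depends on the first \<open>m\<close> steps only.\<close>

lemma strong_markov_first_ladder:
  assumes [measurable]: "\<phi> \<in> borel_measurable borel" "\<psi> \<in> borel_measurable S"
  shows "(\<integral>\<^sup>+x. (\<Sum>m. if ladder_time (psum x) 1 = enat m
      then \<phi> (psum x m) * \<psi> (\<lambda>k. x (m + k)) else 0) \<partial>S) =
    (\<integral>\<^sup>+x. at_ladder \<phi> 1 x \<partial>S) * (\<integral>\<^sup>+x. \<psi> x \<partial>S)"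
proof -
  let ?\<Phi> = "\<lambda>m x. if ladder_time (psum x) 1 = enat m then \<phi> (psum x m) else 0"
  have past: "?\<Phi> m x = ?\<Phi> m y" if "\<And>k. k < m \<Longrightarrow> x k = y k" for m x y
  proof -
    have "psum x k = psum y k" if "k \<le> m" for k
      using that \<open>\<And>k. k < m \<Longrightarrow> x k = y k\<close> by (intro psum_cong) auto
    then have "ladder_time (psum x) 1 = enat m \<longleftrightarrow> ladder_time (psum y) 1 = enat m"
        "psum x m = psum y m"
      by (auto simp: first_ladder_time_eq_iff simp del: One_nat_def)
    then show ?thesis by simp
  qed
  have "(\<integral>\<^sup>+x. (\<Sum>m. if ladder_time (psum x) 1 = enat m
      then \<phi> (psum x m) * \<psi> (\<lambda>k. x (m + k)) else 0) \<partial>S) =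
      (\<integral>\<^sup>+x. (\<Sum>m. ?\<Phi> m x * \<psi> (\<lambda>k. x (m + k))) \<partial>S)"
    by (intro nn_integral_cong suminf_cong) auto
  also have "\<dots> = (\<Sum>m. \<integral>\<^sup>+x. ?\<Phi> m x * \<psi> (\<lambda>k. x (m + k)) \<partial>S)"
    by (intro nn_integral_suminf) measurable
  also have "\<dots> = (\<Sum>m. (\<integral>\<^sup>+x. ?\<Phi> m x \<partial>S) * (\<integral>\<^sup>+x. \<psi> x \<partial>S))"
    by (intro suminf_cong nn_integral_past_times_future past) measurable
  also have "\<dots> = (\<Sum>m. \<integral>\<^sup>+x. ?\<Phi> m x \<partial>S) * (\<integral>\<^sup>+x. \<psi> x \<partial>S)"
    by simp
  also have "(\<Sum>m. \<integral>\<^sup>+x. ?\<Phi> m x \<partial>S) = (\<integral>\<^sup>+x. at_ladder \<phi> 1 x \<partial>S)"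
    unfolding at_ladder_eq_suminf by (intro nn_integral_suminf[symmetric]) measurable
  finally show ?thesis .
qed

definition ladder_prob :: ennreal where
  "ladder_prob = (\<integral>\<^sup>+x. at_ladder (\<lambda>_. 1) 1 x \<partial>S)"

definition ladder_height :: ennreal where
  "ladder_height = (\<integral>\<^sup>+x. at_ladder ennreal 1 x \<partial>S)"

text \<open>Ladder heights are independent and identically distributed as long as they exist, so functionals that
  turn their sum into a product become powers.\<close>

lemma nn_integral_at_ladder_multiplicative:
  assumes [measurable]: "\<phi> \<in> borel_measurable borel"
  assumes "\<phi> 0 = 1" "\<And>a b. \<phi> (a + b) = \<phi> a * \<phi> b"
  shows "(\<integral>\<^sup>+x. at_ladder \<phi> n x \<partial>S) = (\<integral>\<^sup>+x. at_ladder \<phi> 1 x \<partial>S) ^ n"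
proof (induction n)
  case 0
  show ?case by (simp add: at_ladder_def zero_enat_def assms P.emeasure_space_1 del: space_S)
next
  case (Suc n)
  have "at_ladder (\<lambda>s. \<phi> (a + s)) n y = \<phi> a * at_ladder \<phi> n y" for a y
    by (simp add: at_ladder_def assms split: enat.split)
  then have "(\<integral>\<^sup>+x. at_ladder \<phi> (Suc n) x \<partial>S) = (\<integral>\<^sup>+x. (\<Sum>m. if ladder_time (psum x) 1 = enat m
      then \<phi> (psum x m) * at_ladder \<phi> n (\<lambda>k. x (m + k)) else 0) \<partial>S)"
    by (simp only: at_ladder_Suc)
  also have "\<dots> = (\<integral>\<^sup>+x. at_ladder \<phi> 1 x \<partial>S) * (\<integral>\<^sup>+x. at_ladder \<phi> n x \<partial>S)"
    by (intro strong_markov_first_ladder) measurable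
  finally show ?case by (simp add: Suc)
qed

lemma prob_ladder: "(\<integral>\<^sup>+x. at_ladder (\<lambda>_. 1) n x \<partial>S) = ladder_prob ^ n"
  unfolding ladder_prob_def by (rule nn_integral_at_ladder_multiplicative) auto

text \<open>A walk that reaches its \<open>n\<close>-th ladder epoch has climbed \<open>n\<close> independent ladder heights.\<close>

lemma mean_ladder_value:
  "(\<integral>\<^sup>+x. at_ladder ennreal n x \<partial>S) = of_nat n * ladder_prob ^ (n - 1) * ladder_height"
proof (induction n)
  case 0
  show ?case by (simp add: at_ladder_def zero_enat_def)
next
  case (Suc n)
  have split: "at_ladder (\<lambda>s. ennreal (a + s)) n y =
      ennreal a * at_ladder (\<lambda>_. 1) n y + at_ladder ennreal n y" if "0 \<le> a" for a y
    using that ladder_value_ge_start[of "psum y" n]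
    by (auto simp: at_ladder_def split: enat.split)
  have "at_ladder ennreal (Suc n) x =
      (\<Sum>m. if ladder_time (psum x) 1 = enat m
        then ennreal (psum x m) * at_ladder (\<lambda>_. 1) n (\<lambda>k. x (m + k)) else 0) +
      (\<Sum>m. if ladder_time (psum x) 1 = enat m
        then 1 * at_ladder ennreal n (\<lambda>k. x (m + k)) else 0)" for x
    unfolding at_ladder_Suc
    using ladder_value_ge_start[of "psum x" 1]
    by (subst suminf_add) (auto simp: split intro!: suminf_cong simp del: One_nat_def)
  then have "(\<integral>\<^sup>+x. at_ladder ennreal (Suc n) x \<partial>S) =
      (\<integral>\<^sup>+x. (\<Sum>m. if ladder_time (psum x) 1 = enat m
        then ennreal (psum x m) * at_ladder (\<lambda>_. 1) n (\<lambda>k. x (m + k)) else 0) \<partial>S) +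
      (\<integral>\<^sup>+x. (\<Sum>m. if ladder_time (psum x) 1 = enat m
        then 1 * at_ladder ennreal n (\<lambda>k. x (m + k)) else 0) \<partial>S)"
    by (simp add: nn_integral_add del: One_nat_def mult_1)
  also have "\<dots> = ladder_height * (\<integral>\<^sup>+x. at_ladder (\<lambda>_. 1) n x \<partial>S) +
      ladder_prob * (\<integral>\<^sup>+x. at_ladder ennreal n x \<partial>S)"
    unfolding ladder_height_def ladder_prob_def
    by (intro arg_cong2[where f = "(+)"] strong_markov_first_ladder) measurable
  also have "\<dots> = of_nat (Suc n) * ladder_prob ^ (Suc n - 1) * ladder_height"
    unfolding Suc prob_ladder by (cases n) (auto simp: algebra_simps)
  finally show ?case .
qed

lemma ladder_prob_le_1: "ladder_prob \<le> 1"
proof -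
  have "ladder_prob \<le> (\<integral>\<^sup>+x. 1 \<partial>S)"
    unfolding ladder_prob_def by (intro nn_integral_mono) (auto simp: at_ladder_def split: enat.split)
  then show ?thesis by (simp add: P.emeasure_space_1 del: space_S)
qed

lemma distr_shift_Suc: "distr S S (\<lambda>x k. x (Suc k)) = S"
proof (rule measure_eqI)
  fix A assume "A \<in> sets (distr S S (\<lambda>x k. x (Suc k)))"
  then have [measurable]: "A \<in> sets S" by simp
  have "emeasure (distr S S (\<lambda>x k. x (Suc k))) A = (\<integral>\<^sup>+x. indicator A (\<lambda>k. x (Suc k)) \<partial>S)"
    by (subst nn_integral_distr[symmetric, of _ S S]) (auto simp del: nn_integral_distr)
  also have "\<dots> = emeasure S A"
    using nn_integral_past_times_future[of "\<lambda>_. 1" "indicator A" 1]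
    by (simp add: P.emeasure_space_1 del: space_S)
  finally show "emeasure (distr S S (\<lambda>x k. x (Suc k))) A = emeasure S A" .
qed simp

lemma integrable_first_step:
  assumes "integrable F (\<lambda>x. x)"
  shows "integrable S (\<lambda>x. x 0)"
proof -
  have "distr S F (\<lambda>x. x 0) = F" by (rule PiM_component) simp
  then show ?thesis
    using assms by (intro integrable_distr[of "\<lambda>x. x 0" S F "\<lambda>x. x"]) simp_all
qed

lemma integral_first_step: "(\<integral>x. x 0 \<partial>S) = (\<integral>x. x \<partial>F)"
proof -
  have "distr S F (\<lambda>x. x 0) = F" by (rule PiM_component) simp
  then show ?thesis
    using integral_distr[of "\<lambda>x. x 0" S F "\<lambda>x. x"] by simp
qed

lemma integrable_shift_Suc:
  fixes f :: "_ \<Rightarrow> real"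
  shows "integrable S f \<Longrightarrow> integrable S (\<lambda>x. f (\<lambda>k. x (Suc k)))"
  by (rule integrable_distr[OF measurable_shift_Suc]) (simp only: distr_shift_Suc)

lemma integrable_run_max:
  assumes "integrable F (\<lambda>x. x)"
  shows "integrable S (run_max n)"
proof (induction n)
  case (Suc n)
  show ?case using integrable_shift_Suc[OF Suc] integrable_first_step[OF assms] by simp
qed simp

text \<open>If the walk almost surely climbed a further ladder epoch for ever, it would almost surely be
  unbounded, because the Laplace transform of the ladder height is below 1.\<close>

lemma AE_unbounded_if_ladder_prob_1:
  assumes "ladder_prob = 1"
  shows "AE x in S. \<forall>c. \<exists>k. c < psum x k"
proof -
  let ?e = "\<lambda>s. ennreal (exp (- s))"
  define L where "L = (\<integral>\<^sup>+x. at_ladder ?e 1 x \<partial>S)"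
  have lt: "at_ladder ?e 1 x < 1" for x
    by (auto simp: at_ladder_def first_ladder_time_eq_iff ennreal_less_one_iff
        split: enat.split simp del: One_nat_def)
  have L: "L < 1"
  proof -
    have "L < (\<integral>\<^sup>+x. 1 \<partial>S)"
      unfolding L_def
    proof (rule nn_integral_less)
      have "L \<le> (\<integral>\<^sup>+x. 1 \<partial>S)"
        unfolding L_def using lt by (intro nn_integral_mono) (simp add: less_imp_le)
      then show "(\<integral>\<^sup>+x. at_ladder ?e 1 x \<partial>S) \<noteq> \<infinity>"
        unfolding L_def[symmetric] by (auto simp: P.emeasure_space_1 top_unique simp del: space_S)
      show "\<not> (AE x in S. 1 \<le> at_ladder ?e 1 x)"
        using lt by (simp add: not_le[symmetric] P.AE_False)
    qed (use lt in \<open>auto simp: less_imp_le\<close>)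
    then show ?thesis by (simp add: P.emeasure_space_1 del: space_S)
  qed
  have all: "AE x in S. \<forall>n. ladder_time (psum x) n \<noteq> \<infinity>"
    unfolding AE_all_countable
  proof
    fix n
    let ?g = "at_ladder (\<lambda>_. 1) n"
    have le: "?g x \<le> 1" for x by (simp add: at_ladder_def split: enat.split)
    have "(\<integral>\<^sup>+x. ?g x \<partial>S) = 1" by (simp add: prob_ladder assms)
    have "AE x in S. ?g x = 1"
    proof (rule ccontr)
      assume "\<not> (AE x in S. ?g x = 1)"
      then have "\<not> (AE x in S. 1 \<le> ?g x)" using le by (simp add: antisym_conv)
      then have "(\<integral>\<^sup>+x. ?g x \<partial>S) < (\<integral>\<^sup>+x. 1 \<partial>S)"
        by (intro nn_integral_less) (auto simp: \<open>(\<integral>\<^sup>+x. ?g x \<partial>S) = 1\<close> le)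
      then show False
        by (simp add: \<open>(\<integral>\<^sup>+x. ?g x \<partial>S) = 1\<close> P.emeasure_space_1 del: space_S)
    qed
    then show "AE x in S. ladder_time (psum x) n \<noteq> \<infinity>"
      by eventually_elim (auto simp: at_ladder_def split: enat.splits)
  qed
  have bdd: "emeasure S {x\<in>space S. \<forall>k. psum x k \<le> c} = 0" for c
  proof -
    let ?B = "{x\<in>space S. \<forall>k. psum x k \<le> c}"
    have B: "?B \<in> sets S" by measurable
    have "?e c * emeasure S ?B \<le> L ^ n" for n
    proof -
      have "?e c * emeasure S ?B = (\<integral>\<^sup>+x. ?e c * indicator ?B x \<partial>S)"
        by (rule nn_integral_cmult_indicator[OF B, symmetric])
      also have "\<dots> \<le> (\<integral>\<^sup>+x. at_ladder ?e n x \<partial>S)"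
        using all
      proof (intro nn_integral_mono_AE, eventually_elim)
        case (elim x)
        then obtain m where "ladder_time (psum x) n = enat m"
          using not_infinity_eq by metis
        then show ?case
          by (auto simp: at_ladder_def indicator_def intro!: ennreal_leI)
      qed
      also have "\<dots> = L ^ n"
        unfolding L_def
        by (intro nn_integral_at_ladder_multiplicative)
          (auto simp: mult_exp_exp ennreal_mult[symmetric])
      finally show ?thesis .
    qed
    moreover obtain l where "L = ennreal l" "0 \<le> l" "l < 1"
      using L by (cases L) (auto simp: ennreal_less_one_iff)
    then have "(\<lambda>n. L ^ n) \<longlonglongrightarrow> 0"
      using tendsto_ennrealI[OF LIMSEQ_power_zero[of l]] by (simp add: ennreal_power)
    ultimately have "?e c * emeasure S ?B \<le> 0"
      by (intro LIMSEQ_le_const[of "\<lambda>n. L ^ n" 0]) auto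
    then show ?thesis by simp
  qed
  have "AE x in S. \<forall>n::nat. \<exists>k. real n < psum x k"
    unfolding AE_all_countable
  proof
    fix n :: nat
    have B: "{x\<in>space S. \<forall>k. psum x k \<le> real n} \<in> sets S" by measurable
    show "AE x in S. \<exists>k. real n < psum x k"
      by (rule AE_I[OF _ bdd B]) (auto simp: not_less)
  qed
  then show ?thesis
    by eventually_elim (meson less_trans reals_Archimedean2)
qed

text \<open>Negative drift rules this out. By stationarity, the expected increase of the running maximum in
  Lindley's recursion is the expectation of the larger of two numbers: the first step, and the negative of
  the running maximum of the remaining walk. This increase is nonnegative, but it would tend to the mean step, which is
  negative, if the running maximum tended to infinity.\<close>

lemma ladder_prob_less_1:
  assumes int: "integrable F (\<lambda>x. x)" and neg: "(\<integral>x. x \<partial>F) < 0"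
  shows "ladder_prob < 1"
proof (rule ccontr)
  assume "\<not> ladder_prob < 1"
  with ladder_prob_le_1 have "ladder_prob = 1" by simp
  note unb = AE_unbounded_if_ladder_prob_1[OF this]
  have mean_shift: "(\<integral>x. f (\<lambda>k. x (Suc k)) \<partial>S) = (\<integral>x. f x \<partial>S)" if "integrable S f" for f :: "_ \<Rightarrow> real"
    using integral_distr[of "\<lambda>x k. x (Suc k)" S S f] that by (simp add: distr_shift_Suc)
  define D where "D n x = max (x 0) (- run_max n (\<lambda>k. x (Suc k)))" for n and x :: "nat \<Rightarrow> real"
  have D: "D n x = run_max (Suc n) x - run_max n (\<lambda>k. x (Suc k))" for n x
    by (auto simp: D_def max_def)
  have D_nonneg: "0 \<le> (\<integral>x. D n x \<partial>S)" for n
  proof -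
    have "(\<integral>x. D n x \<partial>S) = (\<integral>x. run_max (Suc n) x \<partial>S) - (\<integral>x. run_max n x \<partial>S)"
      unfolding D using integrable_run_max[OF int] integrable_shift_Suc by (simp add: mean_shift del: run_max.simps)
    moreover have "(\<integral>x. run_max n x \<partial>S) \<le> (\<integral>x. run_max (Suc n) x \<partial>S)"
      by (intro integral_mono integrable_run_max[OF int] run_max_mono_Suc)
    ultimately show ?thesis by simp
  qed
  have "AE x in distr S S (\<lambda>x k. x (Suc k)). \<forall>c. \<exists>k. c < psum x k"
    using unb by (simp only: distr_shift_Suc)
  then have unb': "AE x in S. \<forall>c. \<exists>k. c < psum (\<lambda>k. x (Suc k)) k"
    by (rule AE_distrD[rotated]) simp
  have [measurable]: "D n \<in> borel_measurable S" for n
    unfolding D_def by measurable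
  have "(\<lambda>n. \<integral>x. D n x \<partial>S) \<longlonglongrightarrow> (\<integral>x. x 0 \<partial>S)"
  proof (rule integral_dominated_convergence[where w = "\<lambda>x. \<bar>x 0\<bar>"])
    show "AE x in S. (\<lambda>n. D n x) \<longlonglongrightarrow> x 0"
      using unb'
    proof eventually_elim
      case (elim x)
      then obtain k where k: "- x 0 < psum (\<lambda>k. x (Suc k)) k" by blast
      have "D n x = x 0" if "n \<ge> k" for n
        using psum_le_run_max[OF that, of "\<lambda>k. x (Suc k)"] k by (simp add: D_def)
      then show ?case
        by (intro tendsto_eventually) (auto simp: eventually_sequentially)
    qed
    show "AE x in S. norm (D n x) \<le> \<bar>x 0\<bar>" for n
    proof (rule AE_I2)
      fix x
      show "norm (D n x) \<le> \<bar>x 0\<bar>"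
        using run_max_nonneg[of n "\<lambda>k. x (Suc k)"] by (simp add: D_def max_def abs_if)
    qed
  qed (simp_all only: integrable_first_step[OF int] integrable_abs, measurable)
  then have "0 \<le> (\<integral>x. x 0 \<partial>S)"
    by (rule LIMSEQ_le_const) (use D_nonneg in auto)
  with neg show False by (simp add: integral_first_step)
qed

text \<open>The running maximum is at most the first ladder height plus the running maximum of the walk
  after the first ladder time. As its mean is finite at each fixed time, the inequality can be
  solved for it.\<close>

lemma nn_integral_SUP_psum_le:
  assumes int: "integrable F (\<lambda>x. x)"
  shows "(1 - ladder_prob) * (\<integral>\<^sup>+x. (SUP k. ennreal (psum x k)) \<partial>S) \<le> ladder_height"
proof -
  define e where "e n = (\<integral>\<^sup>+x. ennreal (run_max n x) \<partial>S)" for n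
  have fin: "e n < top" for n
    using integrable_run_max[OF int, of n] by (simp add: e_def integrable_iff_bounded run_max_nonneg)
  \<comment> \<open>The maximum is attained at or after the first ladder time, or else it is 0.\<close>
  have rec: "ennreal (run_max n x) \<le>
      (\<Sum>m. if ladder_time (psum x) 1 = enat m then ennreal (psum x m) * 1 else 0) +
      (\<Sum>m. if ladder_time (psum x) 1 = enat m
        then 1 * ennreal (run_max n (\<lambda>k. x (m + k))) else 0)" for n x
  proof -
    obtain k where k: "k \<le> n" "run_max n x = psum x k"
      using run_max_attained[of n x] by blast
    show ?thesis
    proof (cases "ladder_time (psum x) 1")
      case (enat m)
      then have m: "0 < psum x m" "\<And>k. k < m \<Longrightarrow> psum x k \<le> 0"
        by (auto simp: first_ladder_time_eq_iff simp del: One_nat_def)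
      have "run_max n x \<le> psum x m + run_max n (\<lambda>k. x (m + k))"
      proof (cases "k < m")
        case True
        with m k run_max_nonneg[of n "\<lambda>k. x (m + k)"] show ?thesis by (smt (verit))
      next
        case False
        then have "psum x k = psum x m + psum (\<lambda>k. x (m + k)) (k - m)"
          using psum_shift[of x m "k - m"] by simp
        with k psum_le_run_max[of "k - m" n "\<lambda>k. x (m + k)"] show ?thesis by simp
      qed
      then show ?thesis
        unfolding suminf_if_eq_enat enat using m run_max_nonneg[of n "\<lambda>k. x (m + k)"]
        by (simp add: ennreal_leI flip: ennreal_plus)
    next
      case infinity
      have "\<not> 0 < psum x k"
      proof
        assume "0 < psum x k"
        define l where "l = (LEAST k. 0 < psum x k)"
        have "0 < psum x l" "\<And>k. k < l \<Longrightarrow> psum x k \<le> 0"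
          unfolding l_def using \<open>0 < psum x k\<close> by (auto intro: LeastI dest: not_less_Least simp: not_less[symmetric])
        then have "ladder_time (psum x) 1 = enat l"
          by (subst first_ladder_time_eq_iff) auto
        with infinity show False by simp
      qed
      then show ?thesis using k by (simp add: ennreal_neg)
    qed
  qed
  have bound: "(1 - ladder_prob) * e n \<le> ladder_height" for n
  proof -
    have "e n \<le> (\<integral>\<^sup>+x. (\<Sum>m. if ladder_time (psum x) 1 = enat m
          then ennreal (psum x m) * 1 else 0) +
        (\<Sum>m. if ladder_time (psum x) 1 = enat m
          then 1 * ennreal (run_max n (\<lambda>k. x (m + k))) else 0) \<partial>S)"
      unfolding e_def by (intro nn_integral_mono rec)
    also have "\<dots> = (\<integral>\<^sup>+x. (\<Sum>m. if ladder_time (psum x) 1 = enat m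
          then ennreal (psum x m) * 1 else 0) \<partial>S) +
        (\<integral>\<^sup>+x. (\<Sum>m. if ladder_time (psum x) 1 = enat m
          then 1 * ennreal (run_max n (\<lambda>k. x (m + k))) else 0) \<partial>S)"
      by (intro nn_integral_add) measurable
    also have "\<dots> = ladder_height * (\<integral>\<^sup>+x. 1 \<partial>S) + ladder_prob * e n"
      unfolding ladder_height_def ladder_prob_def e_def
      by (intro arg_cong2[where f = "(+)"] strong_markov_first_ladder) measurable
    finally have *: "e n \<le> ladder_height + ladder_prob * e n"
      by (simp add: P.emeasure_space_1 del: space_S)
    obtain l where l: "ladder_prob = ennreal l" "0 \<le> l" "l \<le> 1"
      using ladder_prob_le_1 by (cases ladder_prob) (auto simp: top_unique)
    obtain r where r: "e n = ennreal r" "0 \<le> r"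
      using fin[of n] by (cases "e n") auto
    show ?thesis
    proof (cases ladder_height)
      case (real h)
      then have "r \<le> h + l * r"
        using * l r by (simp flip: ennreal_mult ennreal_plus)
      then have "ennreal ((1 - l) * r) \<le> ennreal h"
        by (intro ennreal_leI) (simp add: algebra_simps)
      with l r real show ?thesis
        by (simp add: ennreal_mult ennreal_minus flip: ennreal_1)
    qed simp
  qed
  moreover have "(\<integral>\<^sup>+x. (SUP k. ennreal (psum x k)) \<partial>S) \<le> (SUP n. e n)"
  proof -
    have "(\<integral>\<^sup>+x. (SUP k. ennreal (psum x k)) \<partial>S) \<le> (\<integral>\<^sup>+x. (SUP n. ennreal (run_max n x)) \<partial>S)"
      by (intro nn_integral_mono SUP_psum_le_SUP_run_max)
    also have "\<dots> = (SUP n. e n)"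
      unfolding e_def
      by (intro nn_integral_monotone_convergence_SUP)
        (auto simp: incseq_def le_fun_def intro!: ennreal_leI incseqD[OF incseq_run_max])
    finally show ?thesis .
  qed
  ultimately have "(1 - ladder_prob) * (\<integral>\<^sup>+x. (SUP k. ennreal (psum x k)) \<partial>S) \<le>
      (SUP n. (1 - ladder_prob) * e n)"
    by (simp add: SUP_mult_left_ennreal[symmetric] mult_left_mono)
  also have "\<dots> \<le> ladder_height"
    by (intro SUP_least bound)
  finally show ?thesis .
qed

end

section \<open>The number of ladder epochs\<close>

lemma num_ladder_epochs_eqI:
  assumes "ladder_time s n < \<infinity>" "ladder_time s (Suc n) = \<infinity>"
  shows "num_ladder_epochs s = n"
  unfolding num_ladder_epochs_def
proof (rule Max_eqI)
  have le: "i \<le> n" if "ladder_time s i < \<infinity>" for i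
  proof (rule ccontr)
    assume "\<not> i \<le> n"
    then have "ladder_time s (Suc n) < \<infinity>"
      using ladder_time_finite_antimono[of "Suc n" i s] that by simp
    then show False using assms(2) by simp
  qed
  then show "finite {i. ladder_time s i < \<infinity>}"
    by (intro finite_subset[of _ "{..n}", OF _ finite_atMost]) (simp add: subset_iff)
  show "i \<le> n" if "i \<in> {i. ladder_time s i < \<infinity>}" for i
    using that le by auto
qed (use assms in auto)

lemma num_ladder_epochs_spec:
  assumes "ladder_time s m = \<infinity>"
  shows "ladder_time s i < \<infinity> \<longleftrightarrow> i \<le> num_ladder_epochs s"
proof -
  define n where "n = (LEAST m. ladder_time s m = \<infinity>)"
  have n: "ladder_time s n = \<infinity>" and least: "\<And>k. k < n \<Longrightarrow> ladder_time s k < \<infinity>"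
    unfolding n_def using assms by (auto intro: LeastI dest: not_less_Least)
  then obtain k where k: "n = Suc k"
    by (cases n) (auto simp: zero_enat_def)
  have num: "num_ladder_epochs s = k"
    using n least[of k] by (intro num_ladder_epochs_eqI) (auto simp: k)
  show ?thesis
    using ladder_time_finite_antimono[of "Suc k" i s] n least[of i]
    by (metis k less_infinityE less_Suc_eq_le not_less_eq_eq not_infinity_eq num enat_ord_simps(4))
qed

context iid_steps
begin

lemma measurable_num_ladder_epochs [measurable]:
  "(\<lambda>x. num_ladder_epochs (psum x)) \<in> measurable S (count_space UNIV)"
proof -
  have "Measurable.pred S (\<lambda>x. \<exists>m. ladder_time (psum x) i = enat m)" for i
    by (intro pred_intros_countable pred_ladder_time)
  then have "Measurable.pred S (\<lambda>x. ladder_time (psum x) i < \<infinity>)" for i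
    by (simp only: less_infinityE enat_ord_simps not_infinity_eq)
  then show ?thesis
    unfolding num_ladder_epochs_def by (rule measurable_Max_nat)
qed

lemma ladder_finite_sets: "{x\<in>space S. ladder_time (psum x) n < \<infinity>} \<in> sets S"
proof -
  have "Measurable.pred S (\<lambda>x. \<exists>m. ladder_time (psum x) n = enat m)"
    by (intro pred_intros_countable pred_ladder_time)
  then show ?thesis
    by (simp only: pred_def enat_ord_simps not_infinity_eq)
qed

lemma emeasure_ladder: "emeasure S {x\<in>space S. ladder_time (psum x) n < \<infinity>} = ladder_prob ^ n"
proof -
  have "emeasure S {x\<in>space S. ladder_time (psum x) n < \<infinity>} =
      (\<integral>\<^sup>+x. indicator {x\<in>space S. ladder_time (psum x) n < \<infinity>} x \<partial>S)"
    by (rule nn_integral_indicator[OF ladder_finite_sets, symmetric])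
  also have "\<dots> = (\<integral>\<^sup>+x. at_ladder (\<lambda>_. 1) n x \<partial>S)"
    by (intro nn_integral_cong) (auto simp: at_ladder_def split: enat.split)
  finally show ?thesis by (simp add: prob_ladder)
qed

lemma AE_finitely_many_ladder_epochs:
  assumes "ladder_prob < 1"
  shows "AE x in S. \<exists>m. ladder_time (psum x) m = \<infinity>"
proof -
  obtain q where q: "ladder_prob = ennreal q" "0 \<le> q" "q < 1"
    using assms by (cases ladder_prob) (auto simp: ennreal_less_one_iff)
  have "Measurable.pred S (\<lambda>x. \<forall>n. \<exists>m. ladder_time (psum x) n = enat m)"
    by (intro pred_intros_countable pred_ladder_time)
  then have meas: "{x\<in>space S. \<forall>n. ladder_time (psum x) n < \<infinity>} \<in> sets S"
    by (simp only: pred_def enat_ord_simps not_infinity_eq)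
  have "emeasure S {x\<in>space S. \<forall>n. ladder_time (psum x) n < \<infinity>} \<le> ladder_prob ^ n" for n
    unfolding emeasure_ladder[symmetric] by (intro emeasure_mono ladder_finite_sets) auto
  moreover have "(\<lambda>n. ladder_prob ^ n) \<longlonglongrightarrow> 0"
    using tendsto_ennrealI[OF LIMSEQ_power_zero[of q]] q by (simp add: ennreal_power)
  ultimately have "emeasure S {x\<in>space S. \<forall>n. ladder_time (psum x) n < \<infinity>} \<le> 0"
    by (intro LIMSEQ_le_const[of "\<lambda>n. ladder_prob ^ n" 0]) auto
  then show ?thesis
    using meas by (intro AE_I[of _ _ "{x\<in>space S. \<forall>n. ladder_time (psum x) n < \<infinity>}"]) auto
qed

text \<open>By the strong Markov property the number of ladder epochs is geometric.\<close>

lemma nn_integral_num_ladder_epochs: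
  assumes q: "ladder_prob = ennreal q" "0 \<le> q" "q < 1"
  shows "(\<integral>\<^sup>+x. f (num_ladder_epochs (psum x)) \<partial>S) = (\<Sum>n. f n * ennreal (q ^ n * (1 - q)))"
proof -
  let ?N = "\<lambda>x. num_ladder_epochs (psum x)"
  let ?A = "\<lambda>n. {x\<in>space S. ladder_time (psum x) n < \<infinity>}"
  note meas = ladder_finite_sets
  have law: "emeasure S {x\<in>space S. ?N x = n} = ennreal (q ^ n * (1 - q))" for n
  proof -
    have "AE x in S. \<exists>m. ladder_time (psum x) m = \<infinity>"
      using q by (intro AE_finitely_many_ladder_epochs) (simp add: ennreal_less_one_iff)
    then have "AE x in S. x \<in> {x\<in>space S. ?N x = n} \<longleftrightarrow> x \<in> ?A n - ?A (Suc n)"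
    proof eventually_elim
      case (elim x)
      then obtain m where "ladder_time (psum x) m = \<infinity>" by blast
      note spec = num_ladder_epochs_spec[OF this]
      have "?N x = n \<longleftrightarrow> n \<le> ?N x \<and> \<not> Suc n \<le> ?N x" by auto
      then show ?case by (simp only: mem_Collect_eq Diff_iff spec space_S UNIV_I simp_thms)
    qed
    then have "emeasure S {x\<in>space S. ?N x = n} = emeasure S (?A n - ?A (Suc n))"
    proof (rule emeasure_eq_AE)
      show "{x\<in>space S. ?N x = n} \<in> sets S"
        using measurable_sets[OF measurable_num_ladder_epochs, of "{n}"]
        by (simp only: vimage_def Int_def mem_Collect_eq singleton_iff conj_commute) simp
    qed (intro sets.Diff meas)
    also have "\<dots> = emeasure S (?A n) - emeasure S (?A (Suc n))"
      using meas ladder_time_finite_antimono[of n "Suc n"]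
      by (intro emeasure_Diff) (auto)
    also have "\<dots> = ennreal (q ^ n - q ^ Suc n)"
      unfolding emeasure_ladder q(1) using q by (simp only: ennreal_power ennreal_minus zero_le_power)
    finally show ?thesis by (simp add: algebra_simps)
  qed
  have "(\<integral>\<^sup>+x. f (?N x) \<partial>S) =
      (\<integral>\<^sup>+x. (\<Sum>n. f n * indicator {x\<in>space S. ?N x = n} x) \<partial>S)"
  proof (intro nn_integral_cong)
    fix x
    have "(\<Sum>n. f n * indicator {x\<in>space S. ?N x = n} x) =
        (\<Sum>n\<in>{?N x}. f n * indicator {x\<in>space S. ?N x = n} x)"
      by (intro suminf_finite) auto
    then show "f (?N x) = (\<Sum>n. f n * indicator {x\<in>space S. ?N x = n} x)" by simp
  qed
  also have "\<dots> = (\<Sum>n. \<integral>\<^sup>+x. f n * indicator {x\<in>space S. ?N x = n} x \<partial>S)"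
    by (intro nn_integral_suminf) measurable
  also have "\<dots> = (\<Sum>n. f n * ennreal (q ^ n * (1 - q)))"
    by (intro suminf_cong, subst nn_integral_cmult_indicator) (measurable, simp only: law)
  finally show ?thesis .
qed

lemma nn_integral_power_num_ladder_epochs:
  assumes q: "ladder_prob = ennreal q" "0 \<le> q" "q < 1" and u: "0 \<le> u" "u \<le> 1"
  shows "(\<integral>\<^sup>+x. ennreal (u ^ num_ladder_epochs (psum x)) \<partial>S) = ennreal ((1 - q) / (1 - q * u))"
proof -
  have "q * u < 1"
    using q u by (metis mult.right_neutral mult_left_mono order_le_less_trans)
  then have "(\<lambda>n. (1 - q) * (q * u) ^ n) sums ((1 - q) * (1 / (1 - q * u)))"
    using q u by (intro sums_mult geometric_sums) auto
  then have "(\<Sum>n. ennreal ((1 - q) * (q * u) ^ n)) = ennreal ((1 - q) / (1 - q * u))"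
    using q u by (subst suminf_ennreal_eq) auto
  moreover have "ennreal (u ^ n) * ennreal (q ^ n * (1 - q)) = ennreal ((1 - q) * (q * u) ^ n)" for n
    using q u by (simp add: ennreal_mult[symmetric] power_mult_distrib mult_ac)
  ultimately show ?thesis
    by (subst nn_integral_num_ladder_epochs[OF q, of "\<lambda>n. ennreal (u ^ n)"]) simp
qed

lemma nn_integral_num_ladder_epochs_times_power:
  assumes q: "ladder_prob = ennreal q" "0 \<le> q" "q < 1" and u: "0 \<le> u" "u \<le> 1"
  shows "(\<integral>\<^sup>+x. ennreal (real (num_ladder_epochs (psum x)) * u ^ num_ladder_epochs (psum x)) \<partial>S) =
    ennreal ((1 - q) * (q * u) / (1 - q * u)\<^sup>2)"
proof -
  have "q * u < 1"
    using q u by (metis mult.right_neutral mult_left_mono order_le_less_trans)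
  then have "(\<lambda>n. (1 - q) * (q * u) * (of_nat (Suc n) * (q * u) ^ n)) sums
      ((1 - q) * (q * u) * (1 / (1 - q * u)\<^sup>2))"
    using q u by (intro sums_mult geometric_deriv_sums) auto
  then have "(\<lambda>n. real (Suc n) * u ^ Suc n * (q ^ Suc n * (1 - q))) sums
      ((1 - q) * (q * u) / (1 - q * u)\<^sup>2)"
    by (simp add: power_mult_distrib mult_ac)
  then have "(\<lambda>n. real n * u ^ n * (q ^ n * (1 - q))) sums ((1 - q) * (q * u) / (1 - q * u)\<^sup>2)"
    by (subst (asm) sums_Suc_iff) simp
  then have "(\<Sum>n. ennreal (real n * u ^ n * (q ^ n * (1 - q)))) =
      ennreal ((1 - q) * (q * u) / (1 - q * u)\<^sup>2)"
    using q u by (subst suminf_ennreal_eq) auto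
  then show ?thesis
    using q u
    by (subst nn_integral_num_ladder_epochs[OF q, of "\<lambda>n. ennreal (real n * u ^ n)"])
      (simp add: ennreal_mult[symmetric])
qed

end

section \<open>The constant of the Poissonised rule\<close>

lemma exp_minus_le_quadratic:
  fixes p :: real
  assumes "0 \<le> p"
  shows "exp (- p) \<le> 1 - p + p\<^sup>2"
proof -
  have "1 \<le> 1 + p ^ 3" using assms by simp
  also have "\<dots> = (1 + p) * (1 - p + p\<^sup>2)" by (simp add: power2_eq_square power3_eq_cube algebra_simps)
  also have "\<dots> \<le> exp p * (1 - p + p\<^sup>2)"
  proof (rule mult_right_mono)
    have "0 \<le> (1 - p / 2)\<^sup>2 + 3 / 4 * p\<^sup>2" by simp
    also have "\<dots> = 1 - p + p\<^sup>2" by (simp add: power2_eq_square field_simps)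
    finally show "0 \<le> 1 - p + p\<^sup>2" .
  qed (rule exp_ge_add_one_self)
  finally show ?thesis by (simp add: exp_minus field_simps)
qed

text \<open>The left-hand side is the limit of the right-hand side as \<open>p\<close> tends to \<open>0\<close>, where the numbers of
  ladder epochs become exponential after rescaling. For the comparison, the tangent bound \<open>1 - p / K \<le> u\<close>
  reduces the claim to \<open>(1 - p / (K + 1)) ^ (K + 1) \<le> exp (- p) \<le> 1 - p * (1 - p)\<close>.\<close>

lemma poissonised_constant_le:
  fixes p :: real and K :: nat
  assumes K: "K \<ge> 1" and p: "0 < p" "p \<le> 1"
  defines "u \<equiv> exp (- p / K)"
  shows "(K / (K + 1)) ^ (K + 1) \<le> (p / (1 - (1 - p) * u)) ^ (K + 1) * (1 - p * (1 - p) * u)"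
proof -
  define q where "q = 1 - p"
  have q: "0 \<le> q" "q < 1" using p by (auto simp: q_def)
  have u: "1 - p / K \<le> u" "u \<le> 1" "0 < u"
    using exp_ge_add_one_self[of "- p / K"] p K by (auto simp: u_def)
  have "q * (1 - p / K) \<le> q * u" using u q by (intro mult_left_mono)
  then have v_le: "1 - q * u \<le> p * (K + q) / K"
    using K by (simp add: q_def field_simps)
  have v_pos: "0 < 1 - q * u"
    using q u by (metis diff_gt_0_iff_gt mult.right_neutral mult_left_mono order_le_less_trans)
  have "K / (K + q) \<le> p / (1 - q * u)"
    using v_le v_pos K q p by (simp add: field_simps)
  then have 1: "(K / (K + q)) ^ (K + 1) \<le> (p / (1 - q * u)) ^ (K + 1)"
    using q by (intro power_mono) auto
  have "((K + q) / (K + 1)) ^ (K + 1) \<le> exp (- p / (K + 1)) ^ (K + 1)"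
  proof (rule power_mono)
    have "(K + q) / (K + 1) = 1 + - p / (K + 1)" by (simp add: q_def field_simps)
    also have "\<dots> \<le> exp (- p / (K + 1))" by (rule exp_ge_add_one_self)
    finally show "(K + q) / (K + 1) \<le> exp (- p / (K + 1))" .
  qed (use q in auto)
  also have "\<dots> = exp (- p)"
    by (simp add: exp_of_nat_mult[symmetric] del: power_Suc)
  also have "\<dots> \<le> 1 - p + p\<^sup>2" using p by (intro exp_minus_le_quadratic) simp
  also have "\<dots> = 1 - p * q * 1" by (simp add: q_def power2_eq_square algebra_simps)
  also have "\<dots> \<le> 1 - p * q * u" using u p q by (intro diff_left_mono mult_left_mono) auto
  finally have 2: "((K + q) / (K + 1)) ^ (K + 1) \<le> 1 - p * q * u" .
  have "(K / (K + 1)) ^ (K + 1) = (K / (K + q)) ^ (K + 1) * ((K + q) / (K + 1)) ^ (K + 1)"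
    using K q by (simp add: power_mult_distrib[symmetric])
  also have "\<dots> \<le> (p / (1 - q * u)) ^ (K + 1) * (1 - p * q * u)"
    using 1 2 q p v_pos by (intro mult_mono) auto
  finally show ?thesis by (simp add: q_def mult.assoc)
qed

lemma pmf_poisson0: "0 \<le> a \<Longrightarrow> pmf (poisson0_pmf a) n = a ^ n / fact n * exp (- a)"
  by (cases n) (auto simp: poisson0_pmf_def pmf_return)

text \<open>Stopping at ladder epoch \<open>n + 1\<close> earns \<open>(n + 1) * q ^ n\<close> mean ladder heights; with Poisson weights
  the sum is a value of the exponential series and of its derivative.\<close>

lemma suminf_poisson_weights:
  fixes a q :: real
  assumes "0 \<le> a" "0 \<le> q"
  shows "(\<Sum>n. ennreal (pmf (poisson0_pmf a) n * (real (Suc n) * q ^ n))) =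
    ennreal (exp (- (1 - q) * a) * (1 + q * a))"
proof -
  have pmf: "pmf (poisson0_pmf a) n = a ^ n / fact n * exp (- a)" for n
    by (rule pmf_poisson0[OF assms(1)])
  let ?z = "a * q"
  have z: "(\<lambda>n. ?z ^ n /\<^sub>R fact n) sums exp ?z" by (rule exp_converges)
  have "(\<lambda>n. ?z * (?z ^ n /\<^sub>R fact n)) sums (?z * exp ?z)" by (intro sums_mult z)
  moreover have "?z * (?z ^ n /\<^sub>R fact n) = real (Suc n) * (?z ^ Suc n /\<^sub>R fact (Suc n))" for n
    by (simp add: field_simps del: of_nat_Suc)
  ultimately have "(\<lambda>n. real (Suc n) * (?z ^ Suc n /\<^sub>R fact (Suc n))) sums (?z * exp ?z)"
    by (simp only:)
  then have "(\<lambda>n. real n * (?z ^ n /\<^sub>R fact n)) sums (?z * exp ?z)"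
    by (subst (asm) sums_Suc_iff) simp
  from sums_mult[OF sums_add[OF this z], of "exp (- a)"]
  have "(\<lambda>n. exp (- a) * (real n * (?z ^ n /\<^sub>R fact n) + ?z ^ n /\<^sub>R fact n)) sums
      (exp (- a) * (?z * exp ?z + exp ?z))" .
  moreover have "exp (- a) * (real n * (?z ^ n /\<^sub>R fact n) + ?z ^ n /\<^sub>R fact n) =
      pmf (poisson0_pmf a) n * (real (Suc n) * q ^ n)" for n
    by (simp add: pmf power_mult_distrib field_simps)
  moreover have "exp (- a) * (?z * exp ?z + exp ?z) = exp (- (1 - q) * a) * (1 + q * a)"
    by (simp add: exp_diff exp_minus field_simps exp_add[symmetric])
  ultimately show ?thesis
    using assms by (subst suminf_ennreal_eq) auto
qed

section \<open>The Poissonised rule\<close>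

lemma (in prob_space) indep_vars_blocks:
  assumes "indep_vars M' X I" "\<And>j. j \<in> L \<Longrightarrow> B j \<subseteq> I" "disjoint_family_on B L"
    and "\<And>j. j \<in> L \<Longrightarrow> f j \<in> measurable (PiM (B j) M') (N j)"
  shows "indep_vars N (\<lambda>j \<omega>. f j (\<lambda>i\<in>B j. X i \<omega>)) L"
  using indep_vars_restrict[OF assms(1-3)] assms(4) by (rule indep_vars_compose2)

text \<open>Restricting the measure to an event that is independent of \<open>W\<close> scales the law of \<open>W\<close>.\<close>

lemma (in prob_space) nn_integral_indicator_times_indep:
  assumes W [measurable]: "W \<in> measurable M N" and A [measurable]: "A \<in> events"
    and f [measurable]: "f \<in> borel_measurable N"
    and indep: "\<And>B. B \<in> sets N \<Longrightarrow> prob ((W -` B \<inter> space M) \<inter> A) = prob (W -` B \<inter> space M) * prob A"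
  shows "(\<integral>\<^sup>+\<omega>. indicator A \<omega> * f (W \<omega>) \<partial>M) = emeasure M A * (\<integral>\<^sup>+\<omega>. f (W \<omega>) \<partial>M)"
proof -
  have "distr (density M (indicator A)) N W = scale_measure (emeasure M A) (distr M N W)"
  proof (rule measure_eqI)
    fix B assume "B \<in> sets (distr (density M (indicator A)) N W)"
    then have B [measurable]: "B \<in> sets N" by simp
    have "emeasure (distr (density M (indicator A)) N W) B =
        (\<integral>\<^sup>+\<omega>. indicator A \<omega> * indicator (W -` B \<inter> space M) \<omega> \<partial>M)"
      by (simp add: emeasure_distr emeasure_density)
    also have "\<dots> = (\<integral>\<^sup>+\<omega>. indicator ((W -` B \<inter> space M) \<inter> A) \<omega> \<partial>M)"
      by (intro nn_integral_cong) (auto simp: indicator_def)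
    also have "\<dots> = emeasure M ((W -` B \<inter> space M) \<inter> A)"
      by (rule nn_integral_indicator) measurable
    also have "\<dots> = emeasure M A * emeasure M (W -` B \<inter> space M)"
      by (simp add: emeasure_eq_measure indep[OF B] ennreal_mult mult.commute)
    finally show "emeasure (distr (density M (indicator A)) N W) B =
        emeasure (scale_measure (emeasure M A) (distr M N W)) B"
      by (simp add: emeasure_distr)
  qed simp
  then have "(\<integral>\<^sup>+y. f y \<partial>distr (density M (indicator A)) N W) =
      (\<integral>\<^sup>+y. f y \<partial>scale_measure (emeasure M A) (distr M N W))" by simp
  then show ?thesis
    by (simp add: nn_integral_distr nn_integral_density nn_integral_scale_measure)
qed

locale walks =
  fixes K :: nat and F :: "real measure" and M :: "'w measure" and X :: "nat \<Rightarrow> nat \<Rightarrow> 'w \<Rightarrow> real"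
  assumes neg: "negative_mean_dist F" and incr: "walk_increments K F M X"

sublocale walks \<subseteq> Om: prob_space M
  using incr by (simp add: walk_increments_def)

sublocale walks \<subseteq> iid_steps F
proof -
  interpret F: prob_space F
    using neg by (simp add: negative_mean_dist_def)
  show "iid_steps F"
    by unfold_locales (use neg in \<open>auto simp: negative_mean_dist_def\<close>)
qed

context walks
begin

abbreviation steps :: "nat \<Rightarrow> 'w \<Rightarrow> nat \<Rightarrow> real" where
  "steps i \<omega> \<equiv> \<lambda>t. X i (Suc t) \<omega>"

lemma indep_increments: "Om.indep_vars (\<lambda>_. borel) (\<lambda>(i, t). X i t) ({0..K} \<times> {1..})"
  using incr by (simp add: walk_increments_def)

lemma measurable_increment: "i \<le> K \<Longrightarrow> 1 \<le> t \<Longrightarrow> X i t \<in> borel_measurable M"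
  using indep_increments by (auto simp: Om.indep_vars_def)

lemma distr_steps:
  assumes "i \<le> K"
  shows "distr M S (steps i) = S"
proof -
  have meas: "X i (Suc t) \<in> borel_measurable M" for t
    using assms by (intro measurable_increment) auto
  have "Om.indep_vars (\<lambda>_. borel)
      (\<lambda>t \<omega>. (\<lambda>x. x (i, Suc t)) (\<lambda>p\<in>{(i, Suc t)}. (\<lambda>(i, t). X i t) p \<omega>)) UNIV"
    by (rule Om.indep_vars_blocks[OF indep_increments])
      (use assms in \<open>auto simp: disjoint_family_on_def\<close>)
  then have "Om.indep_vars (\<lambda>_. borel) (\<lambda>t. X i (Suc t)) UNIV"
    by simp
  then have "distr M (PiM UNIV (\<lambda>_. borel)) (\<lambda>\<omega>. \<lambda>t\<in>UNIV. X i (Suc t) \<omega>) =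
      PiM UNIV (\<lambda>t. distr M borel (X i (Suc t)))"
    by (subst (asm) Om.indep_vars_iff_distr_eq_PiM') (use meas in auto)
  moreover have "distr M borel (X i (Suc t)) = F" for t
    using incr assms by (auto simp: walk_increments_def)
  ultimately have "distr M (PiM UNIV (\<lambda>_. borel)) (steps i) = S"
    by (simp only: restrict_UNIV)
  moreover have "distr M (PiM UNIV (\<lambda>_. borel)) (steps i) = distr M S (steps i)"
    by (intro distr_cong sets_PiM_cong) auto
  ultimately show ?thesis by simp
qed

lemma measurable_steps [measurable]:
  assumes "i \<le> K"
  shows "steps i \<in> measurable M S"
proof (rule measurable_PiM_single')
  show "(\<lambda>\<omega>. X i (Suc t) \<omega>) \<in> measurable M F" for t
    using assms by (intro measurable_into_F measurable_increment) simp_all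
qed auto

lemma nn_integral_steps:
  assumes "i \<le> K" "f \<in> borel_measurable S"
  shows "(\<integral>\<^sup>+\<omega>. f (steps i \<omega>) \<partial>M) = (\<integral>\<^sup>+x. f x \<partial>S)"
proof -
  have "f \<in> borel_measurable (distr M S (steps i))" using assms(2) by simp
  then have "(\<integral>\<^sup>+x. f x \<partial>distr M S (steps i)) = (\<integral>\<^sup>+\<omega>. f (steps i \<omega>) \<partial>M)"
    by (rule nn_integral_distr[OF measurable_steps[OF assms(1)]])
  then show ?thesis by (simp only: distr_steps[OF assms(1)])
qed

lemma expected_max_eq: "expected_max M X = (\<integral>\<^sup>+x. (SUP k. ennreal (psum x k)) \<partial>S)"
  unfolding expected_max_def walk_eq_psum
  by (rule nn_integral_steps[where f = "\<lambda>x. (SUP k. ennreal (psum x k))"]) measurable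

lemma obtain_ladder_prob:
  obtains q where "ladder_prob = ennreal q" "0 \<le> q" "q < 1"
  using ladder_prob_less_1 neg
  by (cases ladder_prob) (auto simp: negative_mean_dist_def ennreal_less_one_iff)

lemma expected_max_le: "(1 - ladder_prob) * expected_max M X \<le> ladder_height"
  unfolding expected_max_eq
  by (rule nn_integral_SUP_psum_le) (use neg in \<open>simp add: negative_mean_dist_def\<close>)

abbreviation epochs :: "nat \<Rightarrow> 'w \<Rightarrow> nat" where
  "epochs i \<omega> \<equiv> num_ladder_epochs (psum (steps i \<omega>))"

lemma indep_epochs: "Om.indep_vars (\<lambda>_. count_space UNIV) epochs {1..K}"
proof -
  let ?B = "\<lambda>i. {i} \<times> {1..}"
  let ?f = "\<lambda>i x. num_ladder_epochs (psum (\<lambda>t. x (i, Suc t)))"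
  have "Om.indep_vars (\<lambda>_. count_space UNIV)
      (\<lambda>i \<omega>. ?f i (\<lambda>p\<in>?B i. (\<lambda>(i, t). X i t) p \<omega>)) {1..K}"
  proof (rule Om.indep_vars_blocks[OF indep_increments])
    fix i
    have "(\<lambda>x t. x (i, Suc t)) \<in> measurable (PiM (?B i) (\<lambda>_. borel)) S"
    proof (rule measurable_PiM_single')
      show "(\<lambda>x. x (i, Suc t)) \<in> measurable (PiM (?B i) (\<lambda>_. borel)) F" for t
        by (intro measurable_into_F measurable_component_singleton) simp
    qed auto
    then show "?f i \<in> measurable (PiM (?B i) (\<lambda>_. borel)) (count_space UNIV)"
      by (rule measurable_compose[OF _ measurable_num_ladder_epochs])
  qed (auto simp: disjoint_family_on_def)
  then show ?thesis by simp
qed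

lemma mean_ladder_epochs_eq:
  "mean_ladder_epochs K X \<omega> = (\<Sum>i = 1..K. real (epochs i \<omega>)) / real K"
  by (simp add: mean_ladder_epochs_def walk_eq_psum)

lemma measurable_epochs: "i \<le> K \<Longrightarrow> epochs i \<in> measurable M (count_space UNIV)"
  by (rule measurable_compose[OF measurable_steps measurable_num_ladder_epochs])

lemma measurable_mean_ladder_epochs [measurable]:
  "mean_ladder_epochs K X \<in> borel_measurable M"
proof -
  have "(\<lambda>\<omega>. real (epochs i \<omega>)) \<in> borel_measurable M" if "i \<in> {1..K}" for i
    using that by (intro measurable_compose[OF measurable_epochs]) auto
  then have "(\<lambda>\<omega>. (\<Sum>i = 1..K. real (epochs i \<omega>)) / real K) \<in> borel_measurable M"
    by (intro borel_measurable_divide borel_measurable_sum) auto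
  then show ?thesis by (simp only: mean_ladder_epochs_eq[symmetric])
qed

text \<open>The number of auxiliary ladder epochs is negative binomial, so its Laplace transform is
  explicit; the factor \<open>1 + q * G\<close> contributes its derivative.\<close>

lemma nn_integral_mean_ladder_epochs:
  assumes K: "K \<ge> 1" and q: "ladder_prob = ennreal q" "0 \<le> q" "q < 1"
  defines "p \<equiv> 1 - q"
  defines "u \<equiv> exp (- p / K)"
  shows "(\<integral>\<^sup>+\<omega>. ennreal (exp (- p * mean_ladder_epochs K X \<omega>) * (1 + q * mean_ladder_epochs K X \<omega>)) \<partial>M) =
    ennreal ((p / (1 - q * u)) ^ K * ((1 - p * q * u) / (1 - q * u)))"
proof -
  have "0 \<le> p / K" using q by (simp add: p_def)
  then have u: "0 \<le> u" "u \<le> 1" by (auto simp: u_def)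
  have v: "0 < 1 - q * u"
    using q u by (metis diff_gt_0_iff_gt mult.right_neutral mult_left_mono order_le_less_trans)
  define a where "a = p / (1 - q * u)"
  define b where "b = p * (q * u) / (1 - q * u)\<^sup>2"
  have ab: "0 \<le> a" "0 \<le> b" using q u v by (auto simp: a_def b_def p_def)
  let ?pw = "\<lambda>n. ennreal (u ^ n)" and ?npw = "\<lambda>n. ennreal (real n * u ^ n)"
  have indep: "(\<integral>\<^sup>+\<omega>. (\<Prod>i = 1..K. f i (epochs i \<omega>)) \<partial>M) = (\<Prod>i = 1..K. \<integral>\<^sup>+\<omega>. f i (epochs i \<omega>) \<partial>M)"
    for f :: "nat \<Rightarrow> nat \<Rightarrow> ennreal"
  proof (rule Om.indep_vars_nn_integral)
    show "Om.indep_vars (\<lambda>_. borel) (\<lambda>i \<omega>. f i (epochs i \<omega>)) {1..K}"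
      by (rule Om.indep_vars_compose2[OF indep_epochs, where Y = f]) simp
  qed auto
  have pw: "(\<integral>\<^sup>+\<omega>. ?pw (epochs i \<omega>) \<partial>M) = ennreal a" if "i \<in> {1..K}" for i
    using that nn_integral_power_num_ladder_epochs[OF q u]
    by (subst nn_integral_steps[where f = "\<lambda>x. ?pw (num_ladder_epochs (psum x))"])
      (auto simp: a_def p_def)
  have npw: "(\<integral>\<^sup>+\<omega>. ?npw (epochs i \<omega>) \<partial>M) = ennreal b" if "i \<in> {1..K}" for i
    using that nn_integral_num_ladder_epochs_times_power[OF q u]
    by (subst nn_integral_steps[where f = "\<lambda>x. ?npw (num_ladder_epochs (psum x))"])
      (auto simp: b_def p_def)
  \<comment> \<open>With \<open>u = exp (- p / K)\<close> the integrand is a sum of products of functions of single counts.\<close>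
  let ?f = "\<lambda>j i n. if i = j then ?npw n else ?pw n"
  have split: "ennreal (exp (- p * mean_ladder_epochs K X \<omega>) * (1 + q * mean_ladder_epochs K X \<omega>)) =
      (\<Prod>i = 1..K. ?pw (epochs i \<omega>)) +
      (\<Sum>j = 1..K. ennreal (q / K) * (\<Prod>i = 1..K. ?f j i (epochs i \<omega>)))" for \<omega>
  proof -
    let ?P = "\<Prod>i = 1..K. u ^ epochs i \<omega>"
    have "exp (- p * mean_ladder_epochs K X \<omega>) = exp (\<Sum>i = 1..K. real (epochs i \<omega>) * (- p / K))"
      unfolding sum_distrib_right[symmetric] by (simp add: mean_ladder_epochs_eq mult.commute)
    also have "\<dots> = ?P"
      by (simp add: exp_sum u_def exp_of_nat_mult[symmetric] mult.commute)
    finally have exp: "exp (- p * mean_ladder_epochs K X \<omega>) = ?P" .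
    have f: "(\<Prod>i = 1..K. ?f j i (epochs i \<omega>)) = ennreal (real (epochs j \<omega>) * ?P)"
      if "j \<in> {1..K}" for j
    proof -
      have "(\<Prod>i = 1..K. ?f j i (epochs i \<omega>)) =
          (\<Prod>i = 1..K. ennreal ((if i = j then real (epochs i \<omega>) else 1) * u ^ epochs i \<omega>))"
        by (intro prod.cong) auto
      also have "\<dots> = ennreal ((\<Prod>i = 1..K. if i = j then real (epochs i \<omega>) else 1) * ?P)"
        using u by (subst prod_ennreal) (auto simp: prod.distrib)
      finally show ?thesis using that by simp
    qed
    have P0: "0 \<le> ?P" using u by (intro prod_nonneg) auto
    have "(\<Prod>i = 1..K. ?pw (epochs i \<omega>)) = ennreal ?P"
      using u by (intro prod_ennreal) auto
    moreover have "(\<Sum>j = 1..K. ennreal (q / K) * (\<Prod>i = 1..K. ?f j i (epochs i \<omega>))) =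
        (\<Sum>j = 1..K. ennreal (q / K * (real (epochs j \<omega>) * ?P)))"
      using q P0 by (intro sum.cong refl, subst f) (auto intro!: ennreal_mult[symmetric] mult_nonneg_nonneg simp del: times_divide_eq_left)
    moreover have "\<dots> = ennreal (\<Sum>j = 1..K. q / K * (real (epochs j \<omega>) * ?P))"
      using q P0 by (intro sum_ennreal) auto
    moreover have "(\<Sum>j = 1..K. q / K * (real (epochs j \<omega>) * ?P)) = ?P * (q * mean_ladder_epochs K X \<omega>)"
      by (simp add: mean_ladder_epochs_eq sum_distrib_left sum_divide_distrib mult_ac)
    moreover have "0 \<le> mean_ladder_epochs K X \<omega>"
      by (simp add: mean_ladder_epochs_eq sum_nonneg)
    ultimately show ?thesis
      using q P0 unfolding exp by (simp add: ring_distribs ennreal_plus[symmetric] del: ennreal_plus)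
  qed
  have [measurable]: "(\<lambda>\<omega>. f (epochs i \<omega>)) \<in> borel_measurable M" if "i \<in> {1..K}" for i and f :: "nat \<Rightarrow> ennreal"
    using that by (intro measurable_compose[OF measurable_epochs]) auto
  have "(\<integral>\<^sup>+\<omega>. ennreal (exp (- p * mean_ladder_epochs K X \<omega>) * (1 + q * mean_ladder_epochs K X \<omega>)) \<partial>M) =
      (\<integral>\<^sup>+\<omega>. (\<Prod>i = 1..K. ?pw (epochs i \<omega>)) \<partial>M) +
      (\<Sum>j = 1..K. ennreal (q / K) * (\<integral>\<^sup>+\<omega>. (\<Prod>i = 1..K. ?f j i (epochs i \<omega>)) \<partial>M))"
  proof -
    have m1: "(\<lambda>\<omega>. \<Prod>i = 1..K. g i (epochs i \<omega>)) \<in> borel_measurable M" for g :: "nat \<Rightarrow> nat \<Rightarrow> ennreal"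
      by (intro borel_measurable_prod_ennreal) measurable
    show ?thesis
      unfolding split
      by (subst nn_integral_add) (auto intro!: m1 borel_measurable_sum borel_measurable_times
          simp: nn_integral_sum nn_integral_cmult m1)
  qed
  also have "\<dots> = ennreal a ^ K + (\<Sum>j = 1..K. ennreal (q / K) * (ennreal b * ennreal a ^ (K - 1)))"
  proof -
    have "(\<Prod>i = 1..K. \<integral>\<^sup>+\<omega>. ?f j i (epochs i \<omega>) \<partial>M) = ennreal b * ennreal a ^ (K - 1)"
      if j: "j \<in> {1..K}" for j
    proof -
      have "(\<Prod>i = 1..K. \<integral>\<^sup>+\<omega>. ?f j i (epochs i \<omega>) \<partial>M) = (\<Prod>i = 1..K. if i = j then ennreal b else ennreal a)"
        using pw npw by (intro prod.cong) auto
      also have "\<dots> = ennreal b * (\<Prod>i \<in> {1..K} - {j}. if i = j then ennreal b else ennreal a)"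
        using j by (subst prod.remove[of _ j]) auto
      also have "(\<Prod>i \<in> {1..K} - {j}. if i = j then ennreal b else ennreal a) =
          (\<Prod>i \<in> {1..K} - {j}. ennreal a)"
        by (intro prod.cong) auto
      also have "\<dots> = ennreal a ^ (K - 1)" using j by simp
      finally show ?thesis .
    qed
    then show ?thesis
      unfolding indep[of "\<lambda>_. ?pw"] indep[of "?f j" for j] using pw by simp
  qed
  also have "\<dots> = ennreal (a ^ K + q * (b * a ^ (K - 1)))"
  proof -
    have "ennreal (q / K) * (ennreal b * ennreal a ^ (K - 1)) = ennreal (q / K * (b * a ^ (K - 1)))"
      using ab q by (simp only: ennreal_power ennreal_mult zero_le_power mult_nonneg_nonneg
          divide_nonneg_nonneg of_nat_0_le_iff)
    then have "(\<Sum>j = 1..K. ennreal (q / K) * (ennreal b * ennreal a ^ (K - 1))) =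
        (\<Sum>j = 1..K. ennreal (q / K * (b * a ^ (K - 1))))" by simp
    also have "\<dots> = ennreal (\<Sum>j = 1..K. q / K * (b * a ^ (K - 1)))"
      using ab q by (intro sum_ennreal) auto
    also have "(\<Sum>j = 1..K. q / K * (b * a ^ (K - 1))) = q * (b * a ^ (K - 1))"
      using K by simp
    finally show ?thesis
      using ab q by (simp add: ennreal_power ennreal_plus)
  qed
  also have "a ^ K + q * (b * a ^ (K - 1)) = a ^ K * ((1 - p * q * u) / (1 - q * u))"
  proof -
    have "b * a ^ (K - 1) = a ^ K * (q * u / (1 - q * u))"
    proof -
      have "b = a * (q * u / (1 - q * u))"
        by (simp add: a_def b_def power2_eq_square)
      moreover have "a * a ^ (K - 1) = a ^ K" using K by (cases K) auto
      ultimately show ?thesis by (simp add: mult_ac)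
    qed
    then have "a ^ K + q * (b * a ^ (K - 1)) = a ^ K * (1 + q * (q * u / (1 - q * u)))"
      by (simp only: distrib_left mult_1_right mult.left_commute[of q])
    also have "1 + q * (q * u / (1 - q * u)) = (1 - p * q * u) / (1 - q * u)"
      using v by (simp add: p_def field_simps)
    finally show ?thesis .
  qed
  finally show ?thesis by (simp add: a_def)
qed

text \<open>The index \<open>Y\<close> is independent of the walk, and a walk stopped at its \<open>n\<close>-th ladder epoch earns
  \<open>n\<close> mean ladder heights with the probability of reaching that epoch.\<close>

lemma expected_reward_poissonised_ge:
  assumes K: "K \<ge> 1" and q: "ladder_prob = ennreal q" "0 \<le> q" "q < 1"
    and Y: "poissonised_index K M X Y"
  shows "(\<integral>\<^sup>+\<omega>. ennreal (exp (- (1 - q) * mean_ladder_epochs K X \<omega>) * (1 + q * mean_ladder_epochs K X \<omega>)) \<partial>M) *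
      ladder_height \<le> expected_reward M X (poissonised_time X Y)"
proof -
  let ?G = "mean_ladder_epochs K X"
  let ?walk = "vimage_algebra (space M) (walk X 0) (\<Pi>\<^sub>M t\<in>UNIV. borel)"
  let ?data = "vimage_algebra (space M) (\<lambda>\<omega>. (aux_data K X \<omega>, Y \<omega>)) (aux_space K \<Otimes>\<^sub>M count_space UNIV)"
  have indep: "Om.indep_set (sets ?walk) (sets ?data)"
    and cond: "\<And>n. AE \<omega> in M. real_cond_exp M (vimage_algebra (space M) ?G borel)
        (indicator {\<omega> \<in> space M. Y \<omega> = Suc n}) \<omega> = pmf (poisson0_pmf (?G \<omega>)) n"
    using Y by (auto simp: poissonised_index_def)
  let ?E = "\<lambda>n. {\<omega> \<in> space M. Y \<omega> = n}"
  have E: "?E n \<in> sets ?data" for n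
  proof -
    have "aux_data K X \<omega> \<in> space (aux_space K)" for \<omega>
      by (auto simp: aux_data_def aux_space_def space_PiM)
    then have "?E n = (\<lambda>\<omega>. (aux_data K X \<omega>, Y \<omega>)) -` (space (aux_space K) \<times> {n}) \<inter> space M"
      by auto
    then show ?thesis
      by (auto intro!: in_vimage_algebra)
  qed
  have E_events: "?E n \<in> sets M" for n
    using E Om.indep_setD_ev2[OF indep] by blast
  have walk_sets: "steps 0 -` B \<inter> space M \<in> sets ?walk" if B: "B \<in> sets S" for B
  proof -
    have "(\<lambda>s t. s (Suc t) - s t :: real) \<in> measurable (PiM UNIV (\<lambda>_. borel)) S"
    proof (rule measurable_PiM_single')
      show "(\<lambda>s. s (Suc t) - s t :: real) \<in> measurable (PiM UNIV (\<lambda>_. borel)) F" for t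
        by (intro measurable_into_F borel_measurable_diff measurable_component_singleton UNIV_I)
    qed auto
    from measurable_sets[OF this B]
    have "(\<lambda>s t. s (Suc t) - s t) -` B \<in> sets (PiM UNIV (\<lambda>_. borel :: real measure))"
      by (simp add: space_PiM)
    then have "walk X 0 -` ((\<lambda>s t. s (Suc t) - s t) -` B) \<inter> space M \<in> sets ?walk"
      by (rule in_vimage_algebra)
    also have "walk X 0 -` ((\<lambda>s t. s (Suc t) - s t) -` B) \<inter> space M = steps 0 -` B \<inter> space M"
      by (auto simp: walk_def)
    finally show ?thesis .
  qed
  have G0: "0 \<le> ?G \<omega>" for \<omega>
    by (simp add: mean_ladder_epochs_eq sum_nonneg)
  \<comment> \<open>Integrating the conditional law of \<open>Y\<close> gives its law.\<close>
  have prob_Y: "emeasure M (?E (Suc n)) = (\<integral>\<^sup>+\<omega>. ennreal (pmf (poisson0_pmf (?G \<omega>)) n) \<partial>M)" for n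
  proof -
    have "subalgebra M (vimage_algebra (space M) ?G borel)"
      unfolding subalgebra_def
      by (auto simp: sets_vimage_algebra2 intro: measurable_sets[OF measurable_mean_ladder_epochs])
    then interpret finite_measure_subalgebra M "vimage_algebra (space M) ?G borel"
      by unfold_locales
    have int: "integrable M (indicator (?E (Suc n)) :: _ \<Rightarrow> real)"
      using E_events by (simp add: Om.emeasure_eq_measure)
    have meas: "(\<lambda>\<omega>. pmf (poisson0_pmf (?G \<omega>)) n) \<in> borel_measurable M"
      by (simp add: pmf_poisson0 G0)
    have int': "integrable M (\<lambda>\<omega>. pmf (poisson0_pmf (?G \<omega>)) n)"
      using real_cond_exp_int(1)[OF int] meas cond[of n]
      by (subst integrable_cong_AE[symmetric]) auto
    have "(\<integral>\<omega>. pmf (poisson0_pmf (?G \<omega>)) n \<partial>M) =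
        (\<integral>\<omega>. real_cond_exp M (vimage_algebra (space M) ?G borel) (indicator (?E (Suc n))) \<omega> \<partial>M)"
      using meas cond[of n] by (intro integral_cong_AE) auto
    also have "\<dots> = measure M (?E (Suc n))"
      using real_cond_exp_int(2)[OF int] E_events by simp
    finally have "(\<integral>\<omega>. pmf (poisson0_pmf (?G \<omega>)) n \<partial>M) = measure M (?E (Suc n))" .
    with int' show ?thesis
      by (simp add: nn_integral_eq_integral Om.emeasure_eq_measure)
  qed
  have summand: "(\<integral>\<^sup>+\<omega>. indicator (?E (Suc n)) \<omega> * at_ladder ennreal (Suc n) (steps 0 \<omega>) \<partial>M) =
      (\<integral>\<^sup>+\<omega>. ennreal (pmf (poisson0_pmf (?G \<omega>)) n * (real (Suc n) * q ^ n)) \<partial>M) * ladder_height" for n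
  proof -
    have "(\<integral>\<^sup>+\<omega>. indicator (?E (Suc n)) \<omega> * at_ladder ennreal (Suc n) (steps 0 \<omega>) \<partial>M) =
        emeasure M (?E (Suc n)) * (\<integral>\<^sup>+\<omega>. at_ladder ennreal (Suc n) (steps 0 \<omega>) \<partial>M)"
      by (rule Om.nn_integral_indicator_times_indep[where N = S])
        (use E_events walk_sets E in \<open>auto intro!: Om.indep_setD[OF indep]\<close>)
    also have "(\<integral>\<^sup>+\<omega>. at_ladder ennreal (Suc n) (steps 0 \<omega>) \<partial>M) = ennreal (real (Suc n) * q ^ n) * ladder_height"
      using q mean_ladder_value[of "Suc n"]
      by (subst nn_integral_steps)
        (auto simp: ennreal_mult ennreal_power ennreal_of_nat_eq_real_of_nat simp del: of_nat_Suc)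
    also have "emeasure M (?E (Suc n)) * (ennreal (real (Suc n) * q ^ n) * ladder_height) =
        (\<integral>\<^sup>+\<omega>. ennreal (pmf (poisson0_pmf (?G \<omega>)) n) * ennreal (real (Suc n) * q ^ n) \<partial>M) * ladder_height"
      unfolding prob_Y by (subst nn_integral_multc) (simp_all add: pmf_poisson0 G0 mult.assoc)
    also have "\<dots> = (\<integral>\<^sup>+\<omega>. ennreal (pmf (poisson0_pmf (?G \<omega>)) n * (real (Suc n) * q ^ n)) \<partial>M) * ladder_height"
      using q by (subst ennreal_mult[symmetric]) simp_all
    finally show ?thesis .
  qed
  have le: "(\<Sum>n. indicator (?E (Suc n)) \<omega> * at_ladder ennreal (Suc n) (steps 0 \<omega>)) \<le>
      ennreal (stopped_reward (walk X 0 \<omega>) (poissonised_time X Y \<omega>))" if "\<omega> \<in> space M" for \<omega>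
  proof (cases "Y \<omega>")
    case 0
    then show ?thesis by simp
  next
    case (Suc m)
    have "(\<Sum>n. indicator (?E (Suc n)) \<omega> * at_ladder ennreal (Suc n) (steps 0 \<omega>)) =
        (\<Sum>n\<in>{m}. indicator (?E (Suc n)) \<omega> * at_ladder ennreal (Suc n) (steps 0 \<omega>))"
      by (intro suminf_finite) (auto simp: Suc)
    also have "\<dots> \<le> at_ladder ennreal (Y \<omega>) (steps 0 \<omega>)"
      by (simp add: Suc indicator_def)
    also have "\<dots> \<le> ennreal (stopped_reward (walk X 0 \<omega>) (poissonised_time X Y \<omega>))"
      unfolding at_ladder_def poissonised_time_def walk_eq_psum
      by (auto split: enat.split intro: ennreal_leI)
    finally show ?thesis .
  qed
  have m0: "(\<lambda>\<omega>. at_ladder ennreal n (steps 0 \<omega>)) \<in> borel_measurable M" for n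
    by (rule measurable_compose[OF measurable_steps]) auto
  have "(\<integral>\<^sup>+\<omega>. ennreal (exp (- (1 - q) * ?G \<omega>) * (1 + q * ?G \<omega>)) \<partial>M) =
      (\<integral>\<^sup>+\<omega>. (\<Sum>n. ennreal (pmf (poisson0_pmf (?G \<omega>)) n * (real (Suc n) * q ^ n))) \<partial>M)"
    by (intro nn_integral_cong suminf_poisson_weights[symmetric] G0 q(2))
  also have "\<dots> = (\<Sum>n. \<integral>\<^sup>+\<omega>. ennreal (pmf (poisson0_pmf (?G \<omega>)) n * (real (Suc n) * q ^ n)) \<partial>M)"
    by (intro nn_integral_suminf) (simp add: pmf_poisson0 G0)
  finally have "(\<integral>\<^sup>+\<omega>. ennreal (exp (- (1 - q) * ?G \<omega>) * (1 + q * ?G \<omega>)) \<partial>M) * ladder_height =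
      (\<Sum>n. \<integral>\<^sup>+\<omega>. indicator (?E (Suc n)) \<omega> * at_ladder ennreal (Suc n) (steps 0 \<omega>) \<partial>M)"
    by (simp add: summand)
  also have "\<dots> = (\<integral>\<^sup>+\<omega>. (\<Sum>n. indicator (?E (Suc n)) \<omega> * at_ladder ennreal (Suc n) (steps 0 \<omega>)) \<partial>M)"
    using E_events by (intro nn_integral_suminf[symmetric]) (auto intro!: borel_measurable_times m0)
  also have "\<dots> \<le> expected_reward M X (poissonised_time X Y)"
    unfolding expected_reward_def by (intro nn_integral_mono le)
  finally show ?thesis .
qed

theorem poissonised_prophet_inequality:
  assumes K: "K \<ge> 1" and Y: "poissonised_index K M X Y"
  shows "ennreal ((real K / (real K + 1)) ^ (K + 1)) * expected_max M X \<le>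
    expected_reward M X (poissonised_time X Y)"
proof -
  obtain q where q: "ladder_prob = ennreal q" "0 \<le> q" "q < 1"
    by (rule obtain_ladder_prob)
  define p where "p = 1 - q"
  define u where "u = exp (- p / K)"
  have p: "0 < p" "p \<le> 1" using q by (auto simp: p_def)
  have u: "0 \<le> u" "u \<le> 1" using p by (auto simp: u_def)
  have v: "0 < 1 - q * u"
    using q u by (metis diff_gt_0_iff_gt mult.right_neutral mult_left_mono order_le_less_trans)
  let ?W = "(p / (1 - q * u)) ^ K * ((1 - p * q * u) / (1 - q * u))"
  have "p * q * u \<le> 1 * 1 * 1" using p q u by (intro mult_mono) auto
  then have W: "0 \<le> ?W" using v p by simp
  have "(real K / (real K + 1)) ^ (K + 1) \<le> (p / (1 - q * u)) ^ (K + 1) * (1 - p * q * u)"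
    using poissonised_constant_le[OF K p] by (simp add: u_def p_def add.commute)
  also have "\<dots> = ?W * p" by simp
  finally have "ennreal ((real K / (real K + 1)) ^ (K + 1)) * expected_max M X \<le>
      ennreal (?W * p) * expected_max M X"
    by (intro mult_right_mono ennreal_leI) auto
  also have "\<dots> = ennreal ?W * ((1 - ladder_prob) * expected_max M X)"
  proof -
    have "ennreal (?W * p) = ennreal ?W * ennreal p"
      using W p by (intro ennreal_mult) auto
    moreover have "1 - ladder_prob = ennreal p"
      using q by (simp add: p_def ennreal_minus flip: ennreal_1)
    ultimately show ?thesis by (simp only: mult.assoc)
  qed
  also have "\<dots> \<le> ennreal ?W * ladder_height"
    by (intro mult_left_mono expected_max_le) auto
  also have "\<dots> \<le> expected_reward M X (poissonised_time X Y)"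
    using expected_reward_poissonised_ge[OF K q Y] nn_integral_mean_ladder_epochs[OF K q]
    by (simp add: p_def u_def)
  finally show ?thesis .
qed

end

section \<open>A Bayesian bound for stopping a geometric walk\<close>

definition unit_lborel :: "real measure" where
  "unit_lborel = restrict_space lborel {0<..<1}"

lemma space_unit_lborel [simp]: "space unit_lborel = {0<..<1}"
  by (simp add: unit_lborel_def space_restrict_space)

lemma measurable_unit_lborel_ident [measurable]: "(\<lambda>p. p) \<in> borel_measurable unit_lborel"
  unfolding unit_lborel_def by (intro measurable_restrict_space1) simp

text \<open>Induction on \<open>b\<close>: the derivative of \<open>p ^ (a + 1) * (1 - p) ^ (b + 1)\<close> integrates to 0.\<close>

lemma has_integral_beta:
  "((\<lambda>p::real. p ^ a * (1 - p) ^ b) has_integral (fact a * fact b / fact (a + b + 1))) {0..1}"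
proof (induction b arbitrary: a)
  case 0
  have deriv: "((\<lambda>p. p ^ Suc a / real (Suc a)) has_real_derivative p ^ a) (at p within {0..1})" for p
    using DERIV_cdivide[OF DERIV_pow[of "Suc a" p "{0..1}"], of "real (Suc a)"]
    by (simp del: of_nat_Suc)
  have "((\<lambda>p::real. p ^ a) has_integral (1 ^ Suc a / real (Suc a) - 0 ^ Suc a / real (Suc a))) {0..1}"
    using deriv
    by (intro fundamental_theorem_of_calculus)
      (auto simp: has_real_derivative_iff_has_vector_derivative simp del: of_nat_Suc)
  moreover have "fact a * fact 0 / fact (a + 0 + 1) = 1 / real (Suc a)" by simp
  ultimately show ?case by simp
next
  case (Suc b)
  let ?f = "\<lambda>p::real. real (Suc a) * (p ^ a * (1 - p) ^ Suc b) - real (Suc b) * (p ^ Suc a * (1 - p) ^ b)"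
  have deriv: "((\<lambda>p. p ^ Suc a * (1 - p) ^ Suc b) has_real_derivative ?f p) (at p within {0..1})" for p
  proof -
    have 1: "((\<lambda>p. p ^ Suc a) has_real_derivative real (Suc a) * p ^ a) (at p within {0..1})"
      using DERIV_pow[of "Suc a" p "{0..1}"] by simp
    have "((\<lambda>p::real. 1 - p) has_real_derivative - 1) (at p within {0..1})"
      by (auto intro!: derivative_eq_intros)
    from DERIV_mult[OF 1 DERIV_power[OF this, of "Suc b"]] show ?thesis
      by (rule DERIV_cong) (simp add: algebra_simps)
  qed
  have "(?f has_integral ((1::real) ^ Suc a * (1 - 1) ^ Suc b - 0 ^ Suc a * (1 - 0) ^ Suc b)) {0..1}"
    using deriv
    by (intro fundamental_theorem_of_calculus)
      (auto simp only: has_real_derivative_iff_has_vector_derivative)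
  then have "(?f has_integral 0) {0..1}" by simp
  from has_integral_add[OF this has_integral_mult_right[OF Suc.IH[of "Suc a"], of "real (Suc b)"]]
  have "((\<lambda>p. real (Suc a) * (p ^ a * (1 - p) ^ Suc b)) has_integral
      (real (Suc b) * (fact (Suc a) * fact b / fact (Suc a + b + 1)))) {0..1}"
    by (simp del: power_Suc of_nat_Suc fact_Suc)
  from has_integral_mult_right[OF this, of "1 / real (Suc a)"]
  have "((\<lambda>p. p ^ a * (1 - p) ^ Suc b) has_integral
      (1 / real (Suc a) * (real (Suc b) * (fact (Suc a) * fact b / fact (Suc a + b + 1))))) {0..1}"
    by (simp del: power_Suc of_nat_Suc fact_Suc)
  moreover have "1 / real (Suc a) * (real (Suc b) * (fact (Suc a) * fact b / fact (Suc a + b + 1))) =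
      (fact a * fact (Suc b) / fact (a + Suc b + 1) :: real)"
  proof -
    have "Suc a + b + 1 = a + Suc b + 1" by simp
    then show ?thesis
      unfolding fact_Suc[of a] fact_Suc[of b] by (simp del: fact_Suc of_nat_Suc)
  qed
  ultimately show ?case by (simp only:)
qed

definition beta_int :: "nat \<Rightarrow> nat \<Rightarrow> real" where
  "beta_int a b = fact a * fact b / fact (a + b + 1)"

lemma beta_int_pos: "0 < beta_int a b"
  by (simp add: beta_int_def)

lemma beta_int_0: "beta_int 0 b = 1 / (real b + 1)"
proof -
  have "beta_int 0 b = fact b / ((real b + 1) * fact b)"
    by (simp add: beta_int_def add.commute)
  also have "\<dots> = 1 / (real b + 1)" by simp
  finally show ?thesis .
qed

lemma nn_integral_beta:
  "(\<integral>\<^sup>+p. ennreal (p ^ a * (1 - p) ^ b) \<partial>unit_lborel) = ennreal (beta_int a b)"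
proof -
  have "((\<lambda>p::real. p ^ a * (1 - p) ^ b) has_integral beta_int a b) {0<..<1}"
    using has_integral_beta[of a b]
    by (simp add: beta_int_def has_integral_Icc_iff_Ioo)
  then have "((\<lambda>p::real. indicator {0<..<1} p * (p ^ a * (1 - p) ^ b)) has_integral beta_int a b) UNIV"
  proof -
    have "(\<lambda>p::real. indicator {0<..<1} p * (p ^ a * (1 - p) ^ b)) =
        (\<lambda>p. if p \<in> {0<..<1} then p ^ a * (1 - p) ^ b else 0)"
      by (auto simp: fun_eq_iff)
    with \<open>(_ has_integral _) {0<..<1}\<close> show ?thesis
      by (simp only: has_integral_restrict_UNIV)
  qed
  then have "(\<integral>\<^sup>+p. ennreal (indicator {0<..<1} p * (p ^ a * (1 - p) ^ b)) \<partial>lborel) = ennreal (beta_int a b)"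
    by (intro nn_integral_has_integral_lborel) (auto simp: indicator_def)
  moreover have "(\<integral>\<^sup>+p. ennreal (indicator {0<..<1} p * (p ^ a * (1 - p) ^ b)) \<partial>lborel) =
      (\<integral>\<^sup>+p. ennreal (p ^ a * (1 - p) ^ b) * indicator {0<..<1} p \<partial>lborel)"
    by (intro nn_integral_cong) (auto simp: indicator_def)
  ultimately show ?thesis
    unfolding unit_lborel_def by (subst nn_integral_restrict_space) auto
qed

lemma fact_add_ge: "fact m * (real m + 1) ^ k \<le> fact (m + k)"
proof (induction k)
  case (Suc k)
  have "fact m * (real m + 1) ^ Suc k = (real m + 1) * (fact m * (real m + 1) ^ k)" by simp
  also have "\<dots> \<le> real (m + k + 1) * fact (m + k)"
    by (intro mult_mono Suc) auto
  finally show ?case by simp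
qed simp

lemma fact_add_le: "fact (n + k) \<le> fact n * (real n + real k) ^ k"
proof (induction k)
  case (Suc k)
  have "fact (n + Suc k) = real (n + Suc k) * (fact (n + k) :: real)" by simp
  also have "\<dots> \<le> real (n + Suc k) * (fact n * (real n + real k) ^ k)"
    by (intro mult_left_mono Suc) auto
  also have "\<dots> \<le> real (n + Suc k) * (fact n * (real n + real (Suc k)) ^ k)"
    by (intro mult_left_mono power_mono) auto
  finally show ?case by (simp add: mult_ac del: of_nat_Suc add_Suc_right)
qed simp

definition opt_const :: "nat \<Rightarrow> real" where
  "opt_const K = (real K / (real K + 1)) ^ (K + 1)"

lemma opt_const_nonneg: "0 \<le> opt_const K"
  by (simp add: opt_const_def)

text \<open>The inequality of arithmetic and geometric means for \<open>K\<close> copies of \<open>x / K\<close> and one \<open>y\<close>: this is where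
  the optimal constant appears.\<close>

lemma optimal_constant_ge:
  fixes x y :: real and K :: nat
  assumes K: "K \<ge> 1" and x: "0 < x" and y: "0 \<le> y"
  shows "K * y * x ^ K \<le> opt_const K * (x + y) ^ (K + 1)"
proof -
  define z where "z = x / K"
  have z: "0 < z" "x = K * z" using x K by (auto simp: z_def)
  define r where "r = (x + y) / z / real (K + 1)"
  have "1 + real (K + 1) * (r - 1) \<le> (1 + (r - 1)) ^ (K + 1)"
    using z x y by (intro Bernoulli_inequality) (auto simp: r_def)
  moreover have "real (K + 1) * r = (x + y) / z"
    by (simp add: r_def)
  ultimately have "(x + y) / z - K \<le> r ^ (K + 1)"
    by (simp add: algebra_simps)
  moreover have "(x + y) / z - K = y / z"
    using z by (simp add: field_simps)
  ultimately have "y / z * z ^ (K + 1) \<le> r ^ (K + 1) * z ^ (K + 1)"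
    using z by (intro mult_right_mono) auto
  also have "r ^ (K + 1) * z ^ (K + 1) = ((x + y) / (K + 1)) ^ (K + 1)"
    using z by (simp only: power_mult_distrib[symmetric]) (simp add: r_def)
  finally have "y * z ^ K \<le> ((x + y) / (K + 1)) ^ (K + 1)"
    using z by simp
  then have "real K ^ (K + 1) * (y * z ^ K) \<le> real K ^ (K + 1) * ((x + y) / (K + 1)) ^ (K + 1)"
    by (intro mult_left_mono) auto
  moreover have "real K ^ (K + 1) * (y * z ^ K) = K * y * x ^ K"
    by (simp add: z(2) power_mult_distrib)
  moreover have "real K ^ (K + 1) * ((x + y) / (K + 1)) ^ (K + 1) = opt_const K * (x + y) ^ (K + 1)"
    by (simp add: opt_const_def power_divide add.commute del: power_Suc)
  ultimately show ?thesis by (simp only:)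
qed

text \<open>Under the improper prior with density \<open>1 / p\<close>, the left-hand side is the total normalised reward for
  stopping at time \<open>y + 1\<close> when \<open>K\<close> auxiliary walks have survived for \<open>n\<close> steps in total, and the Beta integral on the
  right is the mass of this observation. Replacing quotients of factorials by powers costs the factor
  \<open>(1 + K / n0) ^ K\<close>, which is close to 1 for large \<open>n0\<close>.\<close>

lemma posterior_reward_le:
  fixes K n0 n y :: nat
  assumes K: "K \<ge> 1" and n0: "n0 \<ge> 1" and n: "n0 \<le> n"
  shows "(real y + 1) * beta_int K (n + y) \<le>
    opt_const K * (1 + real K / real n0) ^ K * beta_int (K - 1) n"
proof -
  let ?c = "opt_const K"
  define a where "a = real n + (real y + 1)"
  have a: "0 < a" by (simp add: a_def)
  have f1: "fact (n + y) * a ^ (K + 1) \<le> fact (K + (n + y) + 1)"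
    using fact_add_ge[of "n + y" "K + 1"] by (simp add: a_def add_ac)
  have f2: "fact (K - 1 + n + 1) \<le> fact n * (real n + real K) ^ K"
    using fact_add_le[of n K] K by (simp add: add.commute)
  have "(real y + 1) * beta_int K (n + y) \<le> (real y + 1) * (fact K * fact (n + y) / (fact (n + y) * a ^ (K + 1)))"
    unfolding beta_int_def using f1 a by (intro mult_left_mono divide_left_mono) auto
  also have "\<dots> = (real y + 1) * fact K / a ^ (K + 1)" by simp
  also have "\<dots> = fact (K - 1) * (K * (real y + 1) * real n ^ K) / (real n ^ K * a ^ (K + 1))"
    using K n n0 by (simp add: fact_reduce mult_ac)
  also have "\<dots> \<le> fact (K - 1) * (?c * a ^ (K + 1)) / (real n ^ K * a ^ (K + 1))"
    using optimal_constant_ge[OF K, of "real n" "real y + 1"] n n0 a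
    by (intro divide_right_mono mult_left_mono) (simp_all add: a_def)
  also have "\<dots> = ?c * (fact (K - 1) / real n ^ K)" using a by simp
  also have "\<dots> \<le> ?c * ((1 + real K / real n0) ^ K * (fact (K - 1) * fact n / fact (K - 1 + n + 1)))"
  proof (intro mult_left_mono)
    have "(real n + K) ^ K = (real n * (1 + K / n)) ^ K"
      using n n0 by (simp add: distrib_left)
    also have "\<dots> = real n ^ K * (1 + K / n) ^ K" by (rule power_mult_distrib)
    also have "\<dots> \<le> real n ^ K * (1 + real K / real n0) ^ K"
      using n n0 by (intro mult_left_mono power_mono add_left_mono divide_left_mono) auto
    finally have "fact (K - 1 + n + 1) \<le> fact n * (real n ^ K * (1 + real K / real n0) ^ K)"
      using f2 by (meson fact_ge_zero mult_left_mono order_trans)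
    moreover have "k / N \<le> A * (k * f / G)" if "0 < N" "0 < G" "0 \<le> k" "G \<le> f * (N * A)"
      for k N G f A :: real
      using that mult_left_mono[of G "f * (N * A)" k] by (simp add: field_simps)
    ultimately show "fact (K - 1) / real n ^ K \<le> (1 + real K / real n0) ^ K * (fact (K - 1) * fact n / fact (K - 1 + n + 1))"
      using n n0 by simp
  qed (simp add: opt_const_nonneg)
  finally show ?thesis by (simp add: beta_int_def mult.assoc)
qed

lemma geometric_reward_le_1:
  fixes p :: real
  assumes "0 < p" "p < 1"
  shows "p * ((real y + 1) * (1 - p) ^ y) \<le> 1"
proof -
  have "(real y + 1) * (1 - p) ^ y = (\<Sum>j\<le>y. (1 - p) ^ y)" by simp
  also have "\<dots> \<le> (\<Sum>j\<le>y. (1 - p) ^ j)"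
    using assms by (intro sum_mono power_decreasing) auto
  also have "\<dots> = (1 - (1 - p) ^ Suc y) / p"
    using assms by (subst sum_gp0) auto
  finally have "p * ((real y + 1) * (1 - p) ^ y) \<le> 1 - (1 - p) ^ Suc y"
    using assms by (simp add: field_simps)
  also have "\<dots> \<le> 1" using assms by simp
  finally show ?thesis .
qed

text \<open>The density \<open>1 / p\<close> is invariant under rescaling, which makes it least favourable, but it is not
  integrable. It is the geometric series in \<open>1 - p\<close>; a partial sum of this series has a harmonic number as total
  mass and keeps all integrals polynomial.\<close>

definition prior :: "nat \<Rightarrow> real \<Rightarrow> real" where
  "prior N p = (\<Sum>j\<le>N. (1 - p) ^ j)"

lemma prior_eq: "0 < p \<Longrightarrow> p * prior N p = 1 - (1 - p) ^ Suc N"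
  unfolding prior_def by (subst sum_gp0) auto

lemma prior_nonneg: "0 < p \<Longrightarrow> p < 1 \<Longrightarrow> 0 \<le> prior N p"
  by (simp add: prior_def sum_nonneg)

lemma p_prior_le_1: "0 < p \<Longrightarrow> p < 1 \<Longrightarrow> p * prior N p \<le> 1"
  by (subst prior_eq) auto

lemma measurable_prior [measurable]: "prior N \<in> borel_measurable unit_lborel"
  unfolding prior_def by measurable

lemma nn_integral_prior: "(\<integral>\<^sup>+p. ennreal (prior N p) \<partial>unit_lborel) = ennreal (harm (Suc N))"
proof -
  have "(\<integral>\<^sup>+p. ennreal (prior N p) \<partial>unit_lborel) =
      (\<integral>\<^sup>+p. (\<Sum>j\<le>N. ennreal (p ^ 0 * (1 - p) ^ j)) \<partial>unit_lborel)"
    unfolding prior_def by (intro nn_integral_cong) (auto simp: sum_ennreal)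
  also have "\<dots> = (\<Sum>j\<le>N. ennreal (beta_int 0 j))"
    by (subst nn_integral_sum) (auto simp only: nn_integral_beta, measurable)
  also have "\<dots> = ennreal (\<Sum>j\<le>N. beta_int 0 j)"
    by (intro sum_ennreal) (simp add: beta_int_pos less_imp_le)
  also have "(\<Sum>j\<le>N. beta_int 0 j) = harm (Suc N)"
  proof -
    have "harm (Suc N) = (\<Sum>k<Suc N. inverse (real (Suc k)))"
      unfolding harm_def by (simp only: sum.atLeast1_atMost_eq One_nat_def)
    also have "\<dots> = (\<Sum>k\<le>N. inverse (real (Suc k)))"
      by (simp only: lessThan_Suc_atMost)
    also have "\<dots> = (\<Sum>j\<le>N. beta_int 0 j)"
      by (intro sum.cong) (auto simp: beta_int_0 inverse_eq_divide add.commute)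
    finally show ?thesis by simp
  qed
  finally show ?thesis .
qed

lemma nn_integral_tail_prior_le:
  "(\<integral>\<^sup>+p. ennreal ((1 - p) ^ (N + 1) * prior N p) \<partial>unit_lborel) \<le> 1"
proof -
  have "(\<integral>\<^sup>+p. ennreal ((1 - p) ^ (N + 1) * prior N p) \<partial>unit_lborel) =
      (\<integral>\<^sup>+p. (\<Sum>j\<le>N. ennreal (p ^ 0 * (1 - p) ^ (N + 1 + j))) \<partial>unit_lborel)"
    unfolding prior_def
    by (intro nn_integral_cong) (auto simp: sum_ennreal sum_distrib_left power_add mult_ac)
  also have "\<dots> = (\<Sum>j\<le>N. ennreal (beta_int 0 (N + 1 + j)))"
    by (subst nn_integral_sum) (auto simp only: nn_integral_beta, measurable)
  also have "\<dots> = ennreal (\<Sum>j\<le>N. beta_int 0 (N + 1 + j))"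
    by (intro sum_ennreal) (simp add: beta_int_pos less_imp_le)
  also have "(\<Sum>j\<le>N. beta_int 0 (N + 1 + j)) \<le> (\<Sum>j\<le>N. 1 / (real N + 1))"
    by (intro sum_mono) (auto simp: beta_int_0 intro!: divide_left_mono mult_pos_pos)
  also have "(\<Sum>j\<le>N. 1 / (real N + 1)) = 1" by simp
  finally show ?thesis by (simp add: ennreal_leI)
qed

text \<open>Summed over a box of observations, the masses under the density \<open>1 / p\<close> stay below the truncated
  prior: the box factorises, each factor is \<open>p\<close> times a partial geometric sum and hence at most 1, and one
  factor without \<open>p\<close> is left.\<close>

lemma sum_mass_le_prior:
  assumes "K \<ge> 1" "0 < p" "p < 1"
  shows "(\<Sum>g\<in>PiE {1..K} (\<lambda>_. {..N}). p ^ (K - 1) * (1 - p) ^ (\<Sum>i = 1..K. g i)) \<le> prior N p"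
proof -
  have "(\<Sum>g\<in>PiE {1..K} (\<lambda>_. {..N}). p ^ (K - 1) * (1 - p) ^ (\<Sum>i = 1..K. g i)) =
      p ^ (K - 1) * (\<Sum>g\<in>PiE {1..K} (\<lambda>_. {..N}). \<Prod>i = 1..K. (1 - p) ^ g i)"
    by (simp add: sum_distrib_left power_sum)
  also have "(\<Sum>g\<in>PiE {1..K} (\<lambda>_. {..N}). \<Prod>i = 1..K. (1 - p) ^ g i) = prior N p ^ K"
    by (subst prod_sum_PiE[symmetric]) (auto simp: prior_def)
  also have "p ^ (K - 1) * prior N p ^ K = (p * prior N p) ^ (K - 1) * prior N p"
    using assms(1) by (cases K) (auto simp: power_mult_distrib)
  also have "\<dots> \<le> 1 * prior N p"
    using assms p_prior_le_1[of p N] prior_nonneg[of p N]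
    by (intro mult_right_mono power_le_one) auto
  finally show ?thesis by simp
qed

text \<open>The weight \<open>v g y\<close> stands for the probability that a rule stops at time \<open>y + 1\<close> when the auxiliary walks
  have survived for \<open>g i\<close> steps, and the last term of the hypothesis covers auxiliary walks that survive for more than
  \<open>N\<close> steps. Averaging over the prior bounds the guaranteed ratio \<open>c\<close>: observations with a small total
  contribute a bounded amount, the others at most about the optimal constant times the harmonic mass of the prior.
  Truncating prior and observations at the same \<open>N\<close> keeps the last term bounded.\<close>

lemma bayes_bound:
  fixes K :: nat and v :: "(nat \<Rightarrow> nat) \<Rightarrow> nat \<Rightarrow> real"
  assumes K: "K \<ge> 1" and n0: "n0 \<ge> 1" and v: "\<And>g y. 0 \<le> v g y" "\<And>g. (\<Sum>y. ennreal (v g y)) \<le> 1"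
    and c: "0 \<le> c" "\<And>p :: real. 0 < p \<Longrightarrow> p < 1 \<Longrightarrow> ennreal c \<le>
      (\<Sum>g\<in>PiE {1..K} (\<lambda>_. {..N}). \<Sum>y. ennreal (v g y *
        (p ^ K * (1 - p) ^ (\<Sum>i = 1..K. g i) * (p * ((real y + 1) * (1 - p) ^ y))))) +
      ennreal (real K * (1 - p) ^ (N + 1))"
  shows "c * harm (Suc N) \<le>
    real (n0 ^ K) + opt_const K * (1 + real K / real n0) ^ K * harm (Suc N) + K"
proof -
  let ?box = "PiE {1..K} (\<lambda>_. {..N})"
  let ?n = "\<lambda>g. \<Sum>i = 1..K. g i :: nat"
  let ?c1 = "opt_const K * (1 + real K / real n0) ^ K"
  let ?t = "\<lambda>g y p. p ^ K * (1 - p) ^ ?n g * (p * ((real y + 1) * (1 - p) ^ y)) * prior N p"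
  define T where "T g y = (\<integral>\<^sup>+p. ennreal (?t g y p) \<partial>unit_lborel)" for g y
  have fin: "finite ?box" by (intro finite_PiE) auto
  have c1: "0 \<le> ?c1" by (simp add: opt_const_nonneg)
  have t0: "0 \<le> ?t g y p" if "0 < p" "p < 1" for g y p
    using that prior_nonneg[OF that] by simp
  \<comment> \<open>A crude bound; it is applied to the at most \<open>n0 ^ K\<close> observations with a small total.\<close>
  have small: "T g y \<le> 1" for g y
  proof -
    have "T g y \<le> (\<integral>\<^sup>+p. ennreal (p ^ 0 * (1 - p) ^ 0) \<partial>unit_lborel)"
      unfolding T_def
    proof (intro nn_integral_mono ennreal_leI)
      fix p assume "p \<in> space unit_lborel"
      then have p: "0 < p" "p < 1" by auto
      have "?t g y p = p ^ (K - 1) * (1 - p) ^ ?n g * (p * ((real y + 1) * (1 - p) ^ y)) * (p * prior N p)"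
        using K by (cases K) auto
      also have "\<dots> \<le> 1 * 1 * 1 * 1"
        using p geometric_reward_le_1[OF p] p_prior_le_1[OF p] prior_nonneg[OF p]
        by (intro mult_mono power_le_one mult_nonneg_nonneg zero_le_power) auto
      finally show "?t g y p \<le> p ^ 0 * (1 - p) ^ 0" by simp
    qed
    also have "\<dots> = 1" unfolding nn_integral_beta by (simp add: beta_int_def)
    finally show ?thesis .
  qed
  \<comment> \<open>For large totals the truncated prior is replaced by \<open>1 / p\<close>.\<close>
  have bulk: "T g y \<le> ennreal (?c1 * beta_int (K - 1) (?n g))" if "n0 \<le> ?n g" for g y
  proof -
    have "T g y \<le> (\<integral>\<^sup>+p. ennreal (real y + 1) * ennreal (p ^ K * (1 - p) ^ (?n g + y)) \<partial>unit_lborel)"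
      unfolding T_def
    proof (intro nn_integral_mono)
      fix p assume "p \<in> space unit_lborel"
      then have p: "0 < p" "p < 1" by auto
      have "?t g y p = (real y + 1) * (p ^ K * (1 - p) ^ (?n g + y)) * (p * prior N p)"
        by (simp add: power_add)
      also have "\<dots> \<le> (real y + 1) * (p ^ K * (1 - p) ^ (?n g + y)) * 1"
        using p p_prior_le_1[OF p] by (intro mult_left_mono) auto
      finally show "ennreal (?t g y p) \<le> ennreal (real y + 1) * ennreal (p ^ K * (1 - p) ^ (?n g + y))"
        using p by (subst ennreal_mult[symmetric]) (auto intro: ennreal_leI)
    qed
    also have "\<dots> = ennreal (real y + 1) * ennreal (beta_int K (?n g + y))"
      by (subst nn_integral_cmult) (measurable, simp only: nn_integral_beta)
    also have "\<dots> = ennreal ((real y + 1) * beta_int K (?n g + y))"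
      by (intro ennreal_mult[symmetric]) (auto simp: beta_int_pos less_imp_le)
    also have "\<dots> \<le> ennreal (?c1 * beta_int (K - 1) (?n g))"
      by (intro ennreal_leI posterior_reward_le K n0 that)
    finally show ?thesis .
  qed
  define R where "R g = (\<Sum>y. ennreal (v g y) * T g y)" for g
  have R_le: "R g \<le> b" if "\<And>y. T g y \<le> b" for g b
  proof -
    have "R g \<le> (\<Sum>y. ennreal (v g y) * b)"
      unfolding R_def by (intro suminf_le mult_left_mono that) auto
    also have "\<dots> = (\<Sum>y. ennreal (v g y)) * b" by simp
    also have "\<dots> \<le> 1 * b" by (intro mult_right_mono v) auto
    finally show ?thesis by simp
  qed
  have "(\<Sum>g\<in>?box. R g) = (\<Sum>g\<in>{g\<in>?box. ?n g < n0}. R g) + (\<Sum>g\<in>{g\<in>?box. n0 \<le> ?n g}. R g)"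
    using fin by (subst sum.union_disjoint[symmetric]) (auto intro!: sum.cong)
  also have "\<dots> \<le> of_nat (n0 ^ K) + ennreal (?c1 * harm (Suc N))"
  proof (rule add_mono)
    have "(\<Sum>g\<in>{g\<in>?box. ?n g < n0}. R g) \<le> (\<Sum>g\<in>{g\<in>?box. ?n g < n0}. 1)"
      by (intro sum_mono R_le small)
    also have "\<dots> = of_nat (card {g\<in>?box. ?n g < n0})" by simp
    also have "card {g\<in>?box. ?n g < n0} \<le> card (PiE {1..K} (\<lambda>_. {..<n0}))"
    proof (intro card_mono finite_PiE)
      show "{g\<in>?box. ?n g < n0} \<subseteq> PiE {1..K} (\<lambda>_. {..<n0})"
      proof safe
        fix g i assume g: "g \<in> ?box" "?n g < n0" and i: "i \<in> {1..K}"
        have "g i \<le> ?n g" using i by (intro member_le_sum) auto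
        then show "g i < n0" using g by simp
      qed auto
    qed auto
    also have "\<dots> = n0 ^ K" by (simp add: card_PiE)
    finally show "(\<Sum>g\<in>{g\<in>?box. ?n g < n0}. R g) \<le> of_nat (n0 ^ K)" by simp
  next
    have "(\<Sum>g\<in>{g\<in>?box. n0 \<le> ?n g}. R g) \<le> (\<Sum>g\<in>{g\<in>?box. n0 \<le> ?n g}. ennreal (?c1 * beta_int (K - 1) (?n g)))"
      by (intro sum_mono R_le bulk) auto
    also have "\<dots> \<le> (\<Sum>g\<in>?box. ennreal (?c1 * beta_int (K - 1) (?n g)))"
      using fin by (intro sum_mono2) auto
    also have "\<dots> = (\<Sum>g\<in>?box. ennreal ?c1 * ennreal (beta_int (K - 1) (?n g)))"
      by (intro sum.cong refl ennreal_mult c1 less_imp_le[OF beta_int_pos])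
    also have "\<dots> = ennreal ?c1 * (\<Sum>g\<in>?box. ennreal (beta_int (K - 1) (?n g)))"
      by (rule sum_distrib_left[symmetric])
    also have "(\<Sum>g\<in>?box. ennreal (beta_int (K - 1) (?n g))) =
        (\<integral>\<^sup>+p. (\<Sum>g\<in>?box. ennreal (p ^ (K - 1) * (1 - p) ^ ?n g)) \<partial>unit_lborel)"
      by (subst nn_integral_sum) (measurable, simp only: nn_integral_beta)
    also have "\<dots> \<le> (\<integral>\<^sup>+p. ennreal (prior N p) \<partial>unit_lborel)"
      using sum_mass_le_prior[OF K]
      by (intro nn_integral_mono) (auto simp: sum_ennreal intro!: ennreal_leI)
    also have "\<dots> = ennreal (harm (Suc N))" by (rule nn_integral_prior)
    finally show "(\<Sum>g\<in>{g\<in>?box. n0 \<le> ?n g}. R g) \<le> ennreal (?c1 * harm (Suc N))"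
      using c1 by (simp add: ennreal_mult harm_nonneg mult_left_mono del: harm_Suc)
  qed
  finally have R_sum: "(\<Sum>g\<in>?box. R g) \<le> of_nat (n0 ^ K) + ennreal (?c1 * harm (Suc N))" .
  have "ennreal c * ennreal (harm (Suc N)) = (\<integral>\<^sup>+p. ennreal c * ennreal (prior N p) \<partial>unit_lborel)"
    by (subst nn_integral_cmult) (measurable, simp only: nn_integral_prior)
  also have "\<dots> \<le> (\<integral>\<^sup>+p. (\<Sum>g\<in>?box. \<Sum>y. ennreal (v g y) * ennreal (?t g y p)) +
      ennreal K * ennreal ((1 - p) ^ (N + 1) * prior N p) \<partial>unit_lborel)"
  proof (intro nn_integral_mono)
    fix p assume "p \<in> space unit_lborel"
    then have p: "0 < p" "p < 1" by auto
    have "ennreal c * ennreal (prior N p) \<le> ((\<Sum>g\<in>?box. \<Sum>y. ennreal (v g y *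
        (p ^ K * (1 - p) ^ ?n g * (p * ((real y + 1) * (1 - p) ^ y))))) +
        ennreal (real K * (1 - p) ^ (N + 1))) * ennreal (prior N p)"
      by (rule mult_right_mono[OF c(2)[OF p]]) simp
    also have "\<dots> = (\<Sum>g\<in>?box. \<Sum>y. ennreal (v g y) * ennreal (?t g y p)) +
      ennreal K * ennreal ((1 - p) ^ (N + 1) * prior N p)"
      using p v prior_nonneg[OF p]
      by (simp add: distrib_right sum_distrib_right ennreal_mult[symmetric] mult.assoc
          flip: ennreal_suminf_multc)
    finally show "ennreal c * ennreal (prior N p) \<le>
      (\<Sum>g\<in>?box. \<Sum>y. ennreal (v g y) * ennreal (?t g y p)) +
      ennreal K * ennreal ((1 - p) ^ (N + 1) * prior N p)" .
  qed
  also have "\<dots> = (\<Sum>g\<in>?box. R g) + ennreal K * (\<integral>\<^sup>+p. ennreal ((1 - p) ^ (N + 1) * prior N p) \<partial>unit_lborel)"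
  proof (subst nn_integral_add)
    have "(\<integral>\<^sup>+p. (\<Sum>g\<in>?box. \<Sum>y. ennreal (v g y) * ennreal (?t g y p)) \<partial>unit_lborel) = (\<Sum>g\<in>?box. R g)"
      unfolding R_def T_def
      by (subst nn_integral_sum, measurable)
        (intro sum.cong refl, subst nn_integral_suminf, measurable,
          intro suminf_cong nn_integral_cmult, measurable)
    moreover have "(\<integral>\<^sup>+p. ennreal K * ennreal ((1 - p) ^ (N + 1) * prior N p) \<partial>unit_lborel) =
        ennreal K * (\<integral>\<^sup>+p. ennreal ((1 - p) ^ (N + 1) * prior N p) \<partial>unit_lborel)"
      by (intro nn_integral_cmult) measurable
    ultimately show "(\<integral>\<^sup>+p. (\<Sum>g\<in>?box. \<Sum>y. ennreal (v g y) * ennreal (?t g y p)) \<partial>unit_lborel) +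
        (\<integral>\<^sup>+p. ennreal K * ennreal ((1 - p) ^ (N + 1) * prior N p) \<partial>unit_lborel) =
      (\<Sum>g\<in>?box. R g) + ennreal K * (\<integral>\<^sup>+p. ennreal ((1 - p) ^ (N + 1) * prior N p) \<partial>unit_lborel)"
      by simp
  qed measurable
  also have "\<dots> \<le> of_nat (n0 ^ K) + ennreal (?c1 * harm (Suc N)) + ennreal K * 1"
    by (intro add_mono R_sum mult_left_mono nn_integral_tail_prior_le) auto
  also have "\<dots> = ennreal (real (n0 ^ K) + ?c1 * harm (Suc N) + K)"
    using c1 harm_nonneg[of "Suc N", where 'a = real]
    by (simp add: ennreal_of_nat_eq_real_of_nat ennreal_plus del: harm_Suc)
  finally have "ennreal (c * harm (Suc N)) \<le> ennreal (real (n0 ^ K) + ?c1 * harm (Suc N) + K)"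
    using c(1) harm_nonneg[of "Suc N", where 'a = real] by (simp add: ennreal_mult del: harm_Suc)
  then show ?thesis
    using c1 harm_nonneg[of "Suc N", where 'a = real] by (subst (asm) ennreal_le_iff) auto
qed

text \<open>First \<open>n0\<close> is taken so large that its correction factor keeps the constant below \<open>c\<close>; then the harmonic
  terms dominate as \<open>N\<close> grows.\<close>

lemma bayes_optimality:
  fixes K :: nat and v :: "(nat \<Rightarrow> nat) \<Rightarrow> nat \<Rightarrow> real"
  assumes K: "K \<ge> 1" and v: "\<And>g y. 0 \<le> v g y" "\<And>g. (\<Sum>y. ennreal (v g y)) \<le> 1"
    and c: "0 \<le> c" "\<And>N (p :: real). 0 < p \<Longrightarrow> p < 1 \<Longrightarrow> ennreal c \<le>
      (\<Sum>g\<in>PiE {1..K} (\<lambda>_. {..N}). \<Sum>y. ennreal (v g y *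
        (p ^ K * (1 - p) ^ (\<Sum>i = 1..K. g i) * (p * ((real y + 1) * (1 - p) ^ y))))) +
      ennreal (real K * (1 - p) ^ (N + 1))"
  shows "c \<le> opt_const K"
proof (rule ccontr)
  let ?c = "opt_const K"
  assume "\<not> c \<le> ?c"
  then have less: "?c < c" by simp
  have "(\<lambda>n. ?c * (1 + real K * inverse (real n)) ^ K) \<longlonglongrightarrow> ?c * (1 + real K * 0) ^ K"
    by (intro tendsto_intros lim_inverse_n)
  then have "eventually (\<lambda>n. ?c * (1 + real K * inverse (real n)) ^ K < c) sequentially"
    using less by (intro order_tendstoD) auto
  then obtain n0 where n0: "n0 \<ge> 1" "?c * (1 + K / real n0) ^ K < c"
    by (metis (no_types, lifting) divide_inverse eventually_sequentially linorder_le_cases order_refl)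
  let ?c1 = "?c * (1 + K / real n0) ^ K"
  have bound: "(c - ?c1) * harm (Suc N) \<le> real (n0 ^ K) + K" for N
    using bayes_bound[OF K n0(1) v c] by (simp add: algebra_simps del: harm_Suc)
  have "filterlim (\<lambda>n. harm n :: real) at_top sequentially" by (rule harm_at_top)
  then have "eventually (\<lambda>n. harm n \<ge> (real (n0 ^ K) + K) / (c - ?c1) + 1) sequentially"
    by (simp add: filterlim_at_top)
  then obtain N where "harm (Suc N) \<ge> (real (n0 ^ K) + K) / (c - ?c1) + 1"
    by (metis (no_types, lifting) eventually_sequentially le_SucI order_refl)
  moreover have d: "0 < c - ?c1" using n0 by simp
  ultimately have "(c - ?c1) * ((real (n0 ^ K) + K) / (c - ?c1) + 1) \<le> (c - ?c1) * harm (Suc N)"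
    by (intro mult_left_mono) auto
  moreover have "d * (x / d + 1) = x + d" if "0 < d" for d x :: real
    using that by (simp add: distrib_left)
  ultimately have "real (n0 ^ K) + K + (c - ?c1) \<le> (c - ?c1) * harm (Suc N)"
    using d by metis
  then show False using bound[of N] d by linarith
qed

section \<open>Coupled walks that climb by unit steps until a deep fall\<close>

definition uniform01 :: "real measure" where
  "uniform01 = uniform_measure lborel {0<..<1}"

lemma sets_uniform01 [simp, measurable_cong]: "sets uniform01 = sets borel"
  by (simp add: uniform01_def)

lemma space_uniform01 [simp]: "space uniform01 = UNIV"
  by (simp add: uniform01_def)

lemma prob_space_uniform01: "prob_space uniform01"
  unfolding uniform01_def by (intro prob_space_uniform_measure) auto

lemma emeasure_uniform01:
  assumes "A \<in> sets borel"
  shows "emeasure uniform01 A = emeasure lborel ({0<..<1} \<inter> A)"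
proof -
  have "emeasure uniform01 A = emeasure lborel ({0<..<1} \<inter> A) / ennreal 1"
    using assms by (simp add: uniform01_def emeasure_uniform_measure)
  moreover have "emeasure lborel ({0<..<1} \<inter> A) \<le> emeasure lborel {0<..<1::real}"
    by (intro emeasure_mono) auto
  then obtain r where "emeasure lborel ({0<..<1} \<inter> A) = ennreal r" "0 \<le> r"
    by (cases "emeasure lborel ({0<..<1} \<inter> A)") (auto simp: top_unique)
  ultimately show ?thesis by (simp only: divide_ennreal zero_less_one div_by_1)
qed

lemma emeasure_uniform01_lessThan:
  assumes "0 \<le> a" "a \<le> 1"
  shows "emeasure uniform01 {..<a} = ennreal a"
proof -
  have "{0<..<1} \<inter> {..<a} = {0<..<a}" using assms by auto
  then show ?thesis using assms by (simp add: emeasure_uniform01)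
qed

lemma emeasure_uniform01_atMost:
  assumes "0 \<le> a" "a \<le> 1"
  shows "emeasure uniform01 {..a} = ennreal a"
proof (cases "a = 1")
  case True
  then have "{0<..<1} \<inter> {..a} = {0<..<1}" by auto
  then show ?thesis using True by (simp add: emeasure_uniform01)
next
  case False
  then have "{0<..<1} \<inter> {..a} = {0<..a}" using assms by auto
  then show ?thesis using assms by (simp add: emeasure_uniform01)
qed

lemma emeasure_uniform01_atLeast:
  assumes "0 \<le> a" "a \<le> 1"
  shows "emeasure uniform01 {a..} = ennreal (1 - a)"
proof (cases "a = 0")
  case True
  then have "{0<..<1} \<inter> {a..} = {0<..<1}" by auto
  then show ?thesis using True by (simp add: emeasure_uniform01)
next
  case False
  then have "{0<..<1} \<inter> {a..} = {a..<1}" using assms by auto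
  then show ?thesis using assms by (simp add: emeasure_uniform01)
qed

lemma emeasure_uniform01_greaterThan:
  assumes "0 \<le> a" "a \<le> 1"
  shows "emeasure uniform01 {a<..} = ennreal (1 - a)"
proof -
  have "{0<..<1} \<inter> {a<..} = {a<..<1}" using assms by auto
  then show ?thesis using assms by (simp add: emeasure_uniform01)
qed

text \<open>Seed \<open>Inl (i, t)\<close> drives step \<open>t\<close> of walk \<open>i\<close>, and seed \<open>Inr k\<close> is the randomisation at time \<open>k\<close>.\<close>

type_synonym seeds = "(nat \<times> nat) + nat \<Rightarrow> real"

definition seed_space :: "seeds measure" where
  "seed_space = PiM UNIV (\<lambda>_. uniform01)"

interpretation seed: product_prob_space "\<lambda>_ :: (nat \<times> nat) + nat. uniform01" UNIV
  by (intro product_prob_spaceI prob_space_uniform01)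

lemma space_seed_space [simp]: "space seed_space = UNIV"
  by (auto simp: seed_space_def space_PiM)

interpretation seed_space: prob_space seed_space
  unfolding seed_space_def by unfold_locales

lemma measurable_seed [measurable]: "(\<lambda>\<omega>. \<omega> j) \<in> borel_measurable seed_space"
proof -
  have "(\<lambda>\<omega>. \<omega> j) \<in> measurable seed_space uniform01"
    unfolding seed_space_def by (rule measurable_component_singleton) simp
  then show ?thesis by (simp only: measurable_cong_sets[OF refl sets_uniform01])
qed

lemma distr_seed: "distr seed_space borel (\<lambda>\<omega>. \<omega> j) = uniform01"
proof -
  have "distr seed_space borel (\<lambda>\<omega>. \<omega> j) = distr seed_space uniform01 (\<lambda>\<omega>. \<omega> j)"
    by (intro distr_cong) auto
  also have "\<dots> = uniform01"
    unfolding seed_space_def by (rule seed.PiM_component) simp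
  finally show ?thesis .
qed

lemma indep_seeds: "seed_space.indep_vars (\<lambda>_. borel) (\<lambda>j \<omega>. \<omega> j) UNIV"
proof -
  have "distr seed_space (PiM UNIV (\<lambda>_. borel)) (\<lambda>\<omega>. \<lambda>j\<in>UNIV. \<omega> j) =
      distr seed_space seed_space (\<lambda>\<omega>. \<omega>)"
    by (intro distr_cong) (auto simp: seed_space_def intro!: sets_PiM_cong)
  also have "\<dots> = PiM UNIV (\<lambda>j. distr seed_space borel (\<lambda>\<omega>. \<omega> j))"
    unfolding distr_seed by (simp add: distr_id seed_space_def)
  finally show ?thesis
    by (subst seed_space.indep_vars_iff_distr_eq_PiM') auto
qed

definition seed_box :: "((nat \<times> nat) + nat) set \<Rightarrow> ((nat \<times> nat) + nat \<Rightarrow> real set) \<Rightarrow> seeds set" where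
  "seed_box J A = {\<omega>. \<forall>j\<in>J. \<omega> j \<in> A j}"

lemma seed_box_sets:
  assumes "finite J" "\<And>j. j \<in> J \<Longrightarrow> A j \<in> sets borel"
  shows "seed_box J A \<in> sets seed_space"
proof -
  have "{\<omega>\<in>space seed_space. \<forall>j\<in>J. \<omega> j \<in> A j} \<in> sets seed_space"
    using assms measurable_sets[OF measurable_seed]
    by (intro sets.sets_Collect_finite_All) (auto simp: vimage_def)
  then show ?thesis by (simp add: seed_box_def)
qed

lemma emeasure_seed_box:
  assumes "finite J" "\<And>j. j \<in> J \<Longrightarrow> A j \<in> sets borel"
    and "\<And>j. j \<in> J \<Longrightarrow> emeasure uniform01 (A j) = ennreal (f j)" "\<And>j. j \<in> J \<Longrightarrow> 0 \<le> f j"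
  shows "emeasure seed_space (seed_box J A) = ennreal (\<Prod>j\<in>J. f j)"
proof -
  have "emeasure seed_space {\<omega>\<in>space seed_space. \<forall>j\<in>J. \<omega> j \<in> A j} = (\<Prod>j\<in>J. emeasure uniform01 (A j))"
    unfolding seed_space_def using assms by (intro seed.emeasure_PiM_Collect) auto
  also have "\<dots> = ennreal (\<Prod>j\<in>J. f j)"
    using assms by (simp add: prod_ennreal)
  finally show ?thesis by (simp add: seed_box_def)
qed

definition coin :: "real \<Rightarrow> real \<Rightarrow> nat \<Rightarrow> nat \<Rightarrow> seeds \<Rightarrow> real" where
  "coin p B i t \<omega> = (if p \<le> \<omega> (Inl (i, t)) then 1 else - B)"

definition coin_dist :: "real \<Rightarrow> real \<Rightarrow> real measure" where
  "coin_dist p B = distr uniform01 borel (\<lambda>u. if p \<le> u then 1 else - B)"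

lemma negative_mean_coin_dist:
  assumes p: "0 < p" "p < 1" and B: "1 < (1 + B) * p"
  shows "negative_mean_dist (coin_dist p B)"
proof -
  have eq: "(if p \<le> u then 1 else - B) = 1 - (1 + B) * indicator {..<p} u" for u :: real
    by (auto simp: indicator_def)
  have int: "integrable uniform01 (\<lambda>u. 1 - (1 + B) * indicator {..<p} u)"
    by (intro Bochner_Integration.integrable_diff integrable_mult_right) (auto simp: seed.M.emeasure_eq_measure)
  have "measure uniform01 {..<p} = p"
    using emeasure_uniform01_lessThan[of p] p by (simp add: measure_def)
  then have "(\<integral>u. 1 - (1 + B) * indicator {..<p} u \<partial>uniform01) = 1 - (1 + B) * p"
    using seed.M.prob_space
    by (subst Bochner_Integration.integral_diff) (auto simp: seed.M.emeasure_eq_measure)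
  moreover have "prob_space (coin_dist p B)"
    unfolding coin_dist_def by (intro seed.M.prob_space_distr) measurable
  ultimately show ?thesis
    using int B unfolding negative_mean_dist_def coin_dist_def
    by (simp add: integrable_distr_eq integral_distr eq)
qed

lemma randomised_walk_increments_coin:
  "randomised_walk_increments K (coin_dist p B) seed_space (coin p B) (\<lambda>k \<omega>. \<omega> (Inr k))"
proof -
  define h :: "(nat \<times> nat) + nat \<Rightarrow> real \<Rightarrow> real" where
    "h j u = (case j of Inl _ \<Rightarrow> (if p \<le> u then 1 else - B) | Inr _ \<Rightarrow> u)" for j u
  have h [measurable]: "h j \<in> borel_measurable borel" for j
  proof (cases j)
    case (Inl a)
    then have "h j = (\<lambda>u. if p \<le> u then 1 else - B)" by (simp add: fun_eq_iff h_def)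
    then show ?thesis by simp
  next
    case (Inr k)
    then have "h j = (\<lambda>u. u)" by (simp add: fun_eq_iff h_def)
    then show ?thesis by simp
  qed
  have "seed_space.indep_vars (\<lambda>_. borel) (\<lambda>j \<omega>. h j (\<omega> j)) UNIV"
    by (rule seed_space.indep_vars_compose2[OF indep_seeds]) (rule h)
  moreover have eq: "(\<lambda>j \<omega>. h j (\<omega> j)) = case_sum (\<lambda>(i, t). coin p B i t) (\<lambda>k \<omega>. \<omega> (Inr k))"
    by (auto simp: fun_eq_iff h_def coin_def split: sum.split)
  ultimately have indep: "seed_space.indep_vars (\<lambda>_. borel)
      (case_sum (\<lambda>(i, t). coin p B i t) (\<lambda>k \<omega>. \<omega> (Inr k))) UNIV"
    by (simp only:)
  have "seed_space.indep_vars (\<lambda>_. borel)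
      (\<lambda>j \<omega>. (\<lambda>x. x (Inl j)) (\<lambda>i\<in>{Inl j}. case_sum (\<lambda>(i, t). coin p B i t) (\<lambda>k \<omega>. \<omega> (Inr k)) i \<omega>))
      ({0..K} \<times> {1..})"
    by (rule seed_space.indep_vars_blocks[OF indep]) (auto simp: disjoint_family_on_def)
  then have "seed_space.indep_vars (\<lambda>_. borel) (\<lambda>(i, t). coin p B i t) ({0..K} \<times> {1..})"
    by (rule iffD1[OF seed_space.indep_vars_cong, rotated -1]) (auto simp: fun_eq_iff)
  moreover have "distr seed_space borel (coin p B i t) = coin_dist p B" for i t
  proof -
    have "distr (distr seed_space borel (\<lambda>\<omega>. \<omega> (Inl (i, t)))) borel (\<lambda>u. if p \<le> u then 1 else - B) =
        distr seed_space borel ((\<lambda>u. if p \<le> u then 1 else - B) \<circ> (\<lambda>\<omega>. \<omega> (Inl (i, t))))"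
      by (intro distr_distr) measurable
    then show ?thesis
      by (simp add: distr_seed coin_dist_def coin_def[abs_def] comp_def)
  qed
  ultimately show ?thesis
    using seed_space.indep_vars_subset[OF indep, of "({0..K} \<times> {1..}) <+> {1..}"]
    by (simp add: randomised_walk_increments_def walk_increments_def distr_seed uniform01_def[symmetric]
        seed_space.prob_space_axioms)
qed

lemma walks_coin:
  assumes "0 < p" "p < 1" "1 < (1 + B) * p"
  shows "walks K (coin_dist p B) seed_space (coin p B)"
  using negative_mean_coin_dist[OF assms] randomised_walk_increments_coin[of K p B]
  by unfold_locales (auto simp: randomised_walk_increments_def)

definition alive :: "real \<Rightarrow> nat \<Rightarrow> nat \<Rightarrow> seeds \<Rightarrow> bool" where
  "alive p i y \<omega> \<longleftrightarrow> (\<forall>t\<in>{1..y}. p \<le> \<omega> (Inl (i, t)))"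

lemma alive_0 [simp]: "alive p i 0 \<omega>"
  by (simp add: alive_def)

lemma alive_mono: "alive p i y \<omega> \<Longrightarrow> x \<le> y \<Longrightarrow> alive p i x \<omega>"
  by (auto simp: alive_def)

lemma walk_coin_alive: "alive p i y \<omega> \<Longrightarrow> walk (coin p B) i \<omega> y = real y"
  by (simp add: walk_def coin_def alive_def)

lemma walk_coin_antimono: "B0 \<le> B \<Longrightarrow> walk (coin p B) i \<omega> k \<le> walk (coin p B0) i \<omega> k"
  unfolding walk_def by (intro sum_mono) (auto simp: coin_def)

text \<open>A single fall accounts for the whole additional depth, and the other steps are not raised by it.\<close>

lemma walk_coin_fallen:
  assumes "B0 \<le> B" "\<not> alive p i k \<omega>"
  shows "walk (coin p B) i \<omega> k \<le> walk (coin p B0) i \<omega> k - (B - B0)"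
proof -
  obtain t where t: "t \<in> {1..k}" "\<omega> (Inl (i, t)) < p"
    using assms(2) by (auto simp: alive_def not_le)
  have "B - B0 = coin p B0 i t \<omega> - coin p B i t \<omega>"
    using t by (simp add: coin_def)
  also have "\<dots> \<le> (\<Sum>t = 1..k. coin p B0 i t \<omega> - coin p B i t \<omega>)"
    using t(1) assms(1) by (intro member_le_sum) (auto simp: coin_def)
  also have "\<dots> = walk (coin p B0) i \<omega> k - walk (coin p B) i \<omega> k"
    by (simp add: walk_def sum_subtractf)
  finally show ?thesis by simp
qed

text \<open>Until its fall a walk counts its steps; afterwards the additional depth outweighs everything that the
  walk with shallower falls ever gains.\<close>

lemma positive_part_walk_coin:
  assumes "B0 \<le> B" "\<And>k. walk (coin p B0) i \<omega> k \<le> B - B0"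
  shows "max 0 (walk (coin p B) i \<omega> k) = (if alive p i k \<omega> then real k else 0)"
  using walk_coin_fallen[OF assms(1), of p i k \<omega>] assms(2)[of k] by (auto simp: walk_coin_alive)

lemma measurable_coin [measurable]: "coin p B i t \<in> borel_measurable seed_space"
  unfolding coin_def[abs_def] by measurable

lemma measurable_walk_coin [measurable]: "(\<lambda>\<omega>. walk (coin p B) i \<omega> k) \<in> borel_measurable seed_space"
  unfolding walk_def by measurable

text \<open>Steps are at most 1, hence so are ladder heights, and the bound on the expected maximum becomes finite.\<close>

lemma nn_integral_SUP_walk_coin_finite:
  assumes "0 < p" "p < 1" "1 < (1 + B) * p" "0 \<le> B"
  shows "(\<integral>\<^sup>+\<omega>. (SUP k. ennreal (walk (coin p B) i \<omega> k)) \<partial>seed_space) < \<infinity>"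
proof -
  interpret walks i "coin_dist p B" seed_space "coin p B"
    by (rule walks_coin[OF assms(1-3)])
  have "AE u in coin_dist p B. u \<le> 1"
    unfolding coin_dist_def using assms(4) by (subst AE_distr_iff) auto
  then have "AE x in S. \<forall>t. x t \<le> 1"
    unfolding AE_all_countable by (intro allI AE_component) auto
  then have "AE x in S. at_ladder ennreal 1 x \<le> 1"
  proof eventually_elim
    case (elim x)
    show ?case
    proof (cases "ladder_time (psum x) 1")
      case (enat m)
      then have m: "0 < psum x m" "\<And>k. k < m \<Longrightarrow> psum x k \<le> 0"
        by (auto simp: first_ladder_time_eq_iff simp del: One_nat_def)
      then obtain l where l: "m = Suc l" by (cases m) auto
      have "psum x m = psum x l + x l" by (simp add: l psum_def)
      also have "\<dots> \<le> 1" using m(2)[of l] spec[OF elim, of l] l by linarith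
      finally show ?thesis using enat by (simp add: at_ladder_def ennreal_le_1)
    qed (simp add: at_ladder_def)
  qed
  then have "ladder_height \<le> (\<integral>\<^sup>+x. 1 \<partial>S)"
    unfolding ladder_height_def by (rule nn_integral_mono_AE)
  then have h: "ladder_height \<le> 1" by (simp add: P.emeasure_space_1 del: space_S)
  obtain q where q: "ladder_prob = ennreal q" "0 \<le> q" "q < 1" by (rule obtain_ladder_prob)
  have "(\<integral>\<^sup>+\<omega>. (SUP k. ennreal (walk (coin p B) i \<omega> k)) \<partial>seed_space) =
      (\<integral>\<^sup>+x. (SUP k. ennreal (psum x k)) \<partial>S)"
    unfolding walk_eq_psum
    by (rule nn_integral_steps[where f = "\<lambda>x. (SUP k. ennreal (psum x k))"]) measurable
  also have "\<dots> < \<infinity>"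
  proof (rule ccontr)
    assume "\<not> (\<integral>\<^sup>+x. (SUP k. ennreal (psum x k)) \<partial>S) < \<infinity>"
    then have "expected_max seed_space (coin p B) = \<infinity>"
      unfolding expected_max_eq by (simp add: not_less top_unique)
    moreover have "1 - ladder_prob = ennreal (1 - q)"
      using q by (simp add: ennreal_minus flip: ennreal_1)
    ultimately have "(1 - ladder_prob) * expected_max seed_space (coin p B) = \<infinity>"
      using q by (simp add: ennreal_mult_eq_top_iff)
    with expected_max_le h show False by (simp add: top_unique)
  qed
  finally show ?thesis .
qed

lemma seed_box_alive:
  "{\<omega>. alive p i y \<omega>} = seed_box (Inl ` ({i} \<times> {1..y})) (\<lambda>_. {p..})"
  by (auto simp: alive_def seed_box_def)

lemma emeasure_alive:
  assumes "0 < p" "p < 1"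
  shows "emeasure seed_space {\<omega>. alive p i y \<omega>} = ennreal ((1 - p) ^ y)"
  unfolding seed_box_alive using assms
  by (subst emeasure_seed_box[where f = "\<lambda>_. 1 - p"])
    (auto simp: emeasure_uniform01_atLeast card_image)

lemma alive_sets: "{\<omega>. alive p i y \<omega>} \<in> sets seed_space"
  unfolding seed_box_alive by (intro seed_box_sets) auto

lemma suminf_geometric_Suc:
  assumes "0 < p" "p < (1::real)"
  shows "(\<Sum>y. ennreal ((1 - p) ^ Suc y)) = ennreal ((1 - p) / p)"
proof -
  have "(\<lambda>y. (1 - p) * (1 - p) ^ y) sums ((1 - p) * (1 / (1 - (1 - p))))"
    using assms by (intro sums_mult geometric_sums) auto
  then show ?thesis using assms by (subst suminf_ennreal_eq) auto
qed

text \<open>The initial climb alone already contributes the mean \<open>(1 - p) / p\<close> of a geometric variable.\<close>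

lemma expected_max_coin_ge:
  assumes "0 < p" "p < 1"
  shows "ennreal ((1 - p) / p) \<le> expected_max seed_space (coin p B)"
proof -
  have le: "(\<Sum>y. indicator {\<omega>. alive p 0 (Suc y) \<omega>} \<omega>) \<le> (SUP k. ennreal (walk (coin p B) 0 \<omega> k))" for \<omega>
    unfolding suminf_eq_SUP
  proof (rule SUP_least)
    fix n
    have "\<exists>a\<le>n. alive p 0 a \<omega> \<and> (\<Sum>y<n. indicator {\<omega>. alive p 0 (Suc y) \<omega>} \<omega>) \<le> (of_nat a :: ennreal)"
    proof (induction n)
      case (Suc n)
      show ?case
      proof (cases "alive p 0 (Suc n) \<omega>")
        case True
        have "(\<Sum>y<Suc n. indicator {\<omega>. alive p 0 (Suc y) \<omega>} \<omega>) \<le> (\<Sum>y<Suc n. 1 :: ennreal)"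
          by (intro sum_mono) (auto simp: indicator_def)
        with True show ?thesis by (intro exI[of _ "Suc n"]) simp
      next
        case False
        from Suc obtain a where "a \<le> n" "alive p 0 a \<omega>"
          "(\<Sum>y<n. indicator {\<omega>. alive p 0 (Suc y) \<omega>} \<omega>) \<le> (of_nat a :: ennreal)" by blast
        with False show ?thesis by (intro exI[of _ a]) auto
      qed
    qed auto
    then obtain a where a: "alive p 0 a \<omega>"
      "(\<Sum>y<n. indicator {\<omega>. alive p 0 (Suc y) \<omega>} \<omega>) \<le> (of_nat a :: ennreal)" by blast
    note a(2)
    also have "of_nat a = ennreal (walk (coin p B) 0 \<omega> a)"
      by (simp add: walk_coin_alive[OF a(1)] ennreal_of_nat_eq_real_of_nat)
    also have "\<dots> \<le> (SUP k. ennreal (walk (coin p B) 0 \<omega> k))" by (rule SUP_upper) simp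
    finally show "(\<Sum>y<n. indicator {\<omega>. alive p 0 (Suc y) \<omega>} \<omega>) \<le>
        (SUP k. ennreal (walk (coin p B) 0 \<omega> k))" .
  qed
  have "ennreal ((1 - p) / p) = (\<Sum>y. emeasure seed_space {\<omega>. alive p 0 (Suc y) \<omega>})"
    by (simp only: emeasure_alive[OF assms] suminf_geometric_Suc[OF assms])
  also have "\<dots> = (\<Sum>y. \<integral>\<^sup>+\<omega>. indicator {\<omega>. alive p 0 (Suc y) \<omega>} \<omega> \<partial>seed_space)"
    by (simp only: nn_integral_indicator[OF alive_sets])
  also have "\<dots> = (\<integral>\<^sup>+\<omega>. (\<Sum>y. indicator {\<omega>. alive p 0 (Suc y) \<omega>} \<omega>) \<partial>seed_space)"
    by (intro nn_integral_suminf[symmetric] borel_measurable_indicator alive_sets)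
  also have "\<dots> \<le> expected_max seed_space (coin p B)"
    unfolding expected_max_def by (intro nn_integral_mono le)
  finally show ?thesis .
qed

section \<open>The reward of a rule on the limiting walks\<close>

text \<open>The auxiliary data produced by walks that climb to the heights \<open>g\<close> and fall for ever.\<close>

definition limit_data :: "nat \<Rightarrow> (nat \<Rightarrow> nat) \<Rightarrow> nat \<times> nat \<Rightarrow> real" where
  "limit_data K g = (\<lambda>(i, t) \<in> {1..K} \<times> UNIV. if t \<le> g i then real t else 0)"

text \<open>While the main walk is alive it has been seen to climb by one in each step, so the rule's stopping
  probability at time \<open>k\<close> is a function of \<open>g\<close>.\<close>

definition limit_rule ::
    "(nat \<Rightarrow> (nat \<times> nat \<Rightarrow> real) \<Rightarrow> (nat \<Rightarrow> real) \<Rightarrow> real) \<Rightarrow> nat \<Rightarrow> (nat \<Rightarrow> nat) \<Rightarrow> nat \<Rightarrow> real" where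
  "limit_rule r K g k = r k (limit_data K g) (\<lambda>j\<in>{1..k}. real j)"

text \<open>The probability that a rule which is fed with a main walk that never falls stops at time \<open>y + 1\<close>.\<close>

definition limit_weight ::
    "(nat \<Rightarrow> (nat \<times> nat \<Rightarrow> real) \<Rightarrow> (nat \<Rightarrow> real) \<Rightarrow> real) \<Rightarrow> nat \<Rightarrow> (nat \<Rightarrow> nat) \<Rightarrow> nat \<Rightarrow> real" where
  "limit_weight r K g y = (\<Prod>k\<in>{1..<Suc y}. 1 - limit_rule r K g k) * limit_rule r K g (Suc y)"

lemma limit_rule_bounds:
  assumes "stopping_rule K r" "1 \<le> k"
  shows "0 \<le> limit_rule r K g k" "limit_rule r K g k \<le> 1"
proof -
  have "limit_data K g \<in> space (aux_space K)"
    by (auto simp: limit_data_def aux_space_def space_PiM)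
  moreover have "(\<lambda>j\<in>{1..k}. real j) \<in> space (\<Pi>\<^sub>M j\<in>{1..k}. borel)"
    by (auto simp: space_PiM)
  ultimately have "limit_rule r K g k \<in> {0..1}"
    using assms unfolding stopping_rule_def limit_rule_def by blast
  then show "0 \<le> limit_rule r K g k" "limit_rule r K g k \<le> 1" by auto
qed

lemma limit_weight_nonneg:
  assumes "stopping_rule K r"
  shows "0 \<le> limit_weight r K g y"
  unfolding limit_weight_def
  using limit_rule_bounds[OF assms] by (intro mult_nonneg_nonneg prod_nonneg) auto

lemma suminf_limit_weight_le_1:
  assumes "stopping_rule K r"
  shows "(\<Sum>y. ennreal (limit_weight r K g y)) \<le> 1"
  unfolding suminf_eq_SUP
proof (rule SUP_least)
  fix n
  let ?R = "\<lambda>n. \<Prod>k\<in>{1..<Suc n}. 1 - limit_rule r K g k"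
  have "(\<Sum>y<n. limit_weight r K g y) = 1 - ?R n"
  proof (induction n)
    case (Suc n)
    have "?R (Suc n) = ?R n * (1 - limit_rule r K g (Suc n))"
      by (subst prod.atLeastLessThan_Suc) auto
    with Suc show ?case by (simp add: limit_weight_def algebra_simps del: prod.op_ivl_Suc)
  qed simp
  also have "\<dots> \<le> 1"
  proof -
    have "0 \<le> ?R n" by (intro prod_nonneg) (use limit_rule_bounds[OF assms] in simp)
    then show ?thesis by simp
  qed
  finally have "(\<Sum>y<n. limit_weight r K g y) \<le> 1" .
  then show "(\<Sum>y<n. ennreal (limit_weight r K g y)) \<le> 1"
    by (simp add: sum_ennreal limit_weight_nonneg[OF assms] ennreal_le_1)
qed

text \<open>These are the coordinates and the sides of the set of seeds for which auxiliary walk \<open>i\<close> falls after exactly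
  \<open>g i\<close> steps, the main walk survives until time \<open>m\<close>, and the rule stops exactly then. The set is a box because on
  it the rule sees fixed data; so its probability is a product.\<close>

definition stop_indices :: "nat \<Rightarrow> (nat \<Rightarrow> nat) \<Rightarrow> nat \<Rightarrow> ((nat \<times> nat) + nat) set" where
  "stop_indices K g m = Inl ` ({0} \<times> {1..m}) \<union> Inl ` (SIGMA i : {1..K}. {1..Suc (g i)}) \<union> Inr ` {1..m}"

definition stop_sides ::
    "(nat \<Rightarrow> (nat \<times> nat \<Rightarrow> real) \<Rightarrow> (nat \<Rightarrow> real) \<Rightarrow> real) \<Rightarrow> real \<Rightarrow> nat \<Rightarrow> (nat \<Rightarrow> nat) \<Rightarrow> nat \<Rightarrow>
      (nat \<times> nat) + nat \<Rightarrow> real set" where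
  "stop_sides r p K g m j = (case j of
      Inl (i, t) \<Rightarrow> (if i \<noteq> 0 \<and> t = Suc (g i) then {..<p} else {p..})
    | Inr k \<Rightarrow> (if k = m then {..limit_rule r K g k} else {limit_rule r K g k<..}))"

abbreviation stop_box where
  "stop_box r p K g m \<equiv> seed_box (stop_indices K g m) (stop_sides r p K g m)"

lemma finite_stop_indices: "finite (stop_indices K g m)"
  by (simp add: stop_indices_def)

lemma stop_sides_sets: "stop_sides r p K g m j \<in> sets borel"
  by (auto simp: stop_sides_def split: sum.split)

lemma emeasure_stop_box:
  assumes r: "stopping_rule K r" and p: "0 < p" "p < 1"
  shows "emeasure seed_space (stop_box r p K g (Suc y)) =
    ennreal ((1 - p) ^ Suc y * (p ^ K * (1 - p) ^ (\<Sum>i = 1..K. g i)) * limit_weight r K g y)"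
proof -
  let ?m = "Suc y"
  define f where "f j = (case j of
      Inl (i, t) \<Rightarrow> (if i \<noteq> 0 \<and> t = Suc (g i) then p else 1 - p)
    | Inr k \<Rightarrow> (if k = ?m then limit_rule r K g k else 1 - limit_rule r K g k))" for j
  have "emeasure seed_space (stop_box r p K g ?m) = ennreal (\<Prod>j\<in>stop_indices K g ?m. f j)"
  proof (rule emeasure_seed_box[OF finite_stop_indices stop_sides_sets])
    fix j assume "j \<in> stop_indices K g ?m"
    then have k: "1 \<le> k" if "j = Inr k" for k
      using that by (auto simp: stop_indices_def)
    show "emeasure uniform01 (stop_sides r p K g ?m j) = ennreal (f j)"
      using p limit_rule_bounds[OF r k]
      by (auto simp: stop_sides_def f_def emeasure_uniform01_lessThan emeasure_uniform01_atLeast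
          emeasure_uniform01_atMost emeasure_uniform01_greaterThan split: sum.split)
    show "0 \<le> f j"
      using p limit_rule_bounds[OF r k] by (auto simp: f_def split: sum.split)
  qed
  also have "(\<Prod>j\<in>stop_indices K g ?m. f j) =
      (\<Prod>j\<in>Inl ` ({0} \<times> {1..?m}). f j) * (\<Prod>j\<in>Inl ` (SIGMA i : {1..K}. {1..Suc (g i)}). f j) *
      (\<Prod>j\<in>Inr ` {1..?m}. f j)"
  proof -
    let ?A = "Inl ` ({0} \<times> {1..?m}) :: ((nat \<times> nat) + nat) set"
    let ?B = "Inl ` (SIGMA i : {1..K}. {1..Suc (g i)}) :: ((nat \<times> nat) + nat) set"
    have "prod f (?A \<union> ?B \<union> Inr ` {1..?m}) = prod f (?A \<union> ?B) * prod f (Inr ` {1..?m})"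
      by (intro prod.union_disjoint) auto
    also have "prod f (?A \<union> ?B) = prod f ?A * prod f ?B"
      by (intro prod.union_disjoint) auto
    finally show ?thesis by (simp only: stop_indices_def)
  qed
  also have "(\<Prod>j\<in>Inl ` ({0} \<times> {1..?m}). f j) = (1 - p) ^ ?m"
  proof -
    have "(\<Prod>j\<in>Inl ` ({0} \<times> {1..?m}). f j) = (\<Prod>j\<in>(Inl ` ({0} \<times> {1..?m}) :: ((nat \<times> nat) + nat) set). 1 - p)"
      by (intro prod.cong) (auto simp: f_def)
    also have "\<dots> = (1 - p) ^ ?m" by (subst prod_constant) (simp add: card_image del: power_Suc)
    finally show ?thesis .
  qed
  also have "(\<Prod>j\<in>Inl ` (SIGMA i : {1..K}. {1..Suc (g i)}). f j) = p ^ K * (1 - p) ^ (\<Sum>i = 1..K. g i)"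
  proof -
    have "(\<Prod>j\<in>Inl ` (SIGMA i : {1..K}. {1..Suc (g i)}). f j) =
        (\<Prod>(i, t)\<in>(SIGMA i : {1..K}. {1..Suc (g i)}). if t = Suc (g i) then p else 1 - p)"
      by (subst prod.reindex) (auto simp: f_def inj_on_def intro!: prod.cong)
    also have "\<dots> = (\<Prod>i = 1..K. \<Prod>t = 1..Suc (g i). if t = Suc (g i) then p else 1 - p)"
      by (subst prod.Sigma) auto
    also have "\<dots> = (\<Prod>i = 1..K. p * (1 - p) ^ g i)"
      by (intro prod.cong) (auto simp: prod.nat_ivl_Suc')
    also have "\<dots> = p ^ K * (1 - p) ^ (\<Sum>i = 1..K. g i)"
      by (simp add: prod.distrib power_sum)
    finally show ?thesis .
  qed
  also have "(\<Prod>j\<in>Inr ` {1..?m}. f j) = limit_weight r K g y"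
  proof -
    have "(\<Prod>j\<in>Inr ` {1..?m}. f j) = (\<Prod>k = 1..?m. f (Inr k))"
      by (subst prod.reindex) (auto simp: inj_on_def)
    also have "\<dots> = (\<Prod>k\<in>{1..<?m}. f (Inr k)) * f (Inr ?m)"
      by (subst atLeastLessThanSuc_atLeastAtMost[symmetric], subst prod.atLeastLessThan_Suc) auto
    also have "(\<Prod>k\<in>{1..<?m}. f (Inr k)) = (\<Prod>k\<in>{1..<?m}. 1 - limit_rule r K g k)"
      by (intro prod.cong) (auto simp: f_def)
    finally show ?thesis by (simp add: f_def limit_weight_def)
  qed
  finally show ?thesis .
qed

lemma emeasure_two_alive:
  assumes "0 < p" "p < 1" "i \<noteq> 0"
  shows "emeasure seed_space ({\<omega>. alive p 0 y \<omega>} \<inter> {\<omega>. alive p i n \<omega>}) = ennreal ((1 - p) ^ y * (1 - p) ^ n)"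
proof -
  have "{\<omega>. alive p 0 y \<omega>} \<inter> {\<omega>. alive p i n \<omega>} =
      seed_box (Inl ` ({0} \<times> {1..y} \<union> {i} \<times> {1..n})) (\<lambda>_. {p..})"
    by (auto simp: alive_def seed_box_def)
  moreover have "card (Inl ` ({0} \<times> {1..y} \<union> {i} \<times> {1..n}) :: ((nat \<times> nat) + nat) set) = y + n"
  proof -
    have "card ({0} \<times> {1..y} \<union> {i} \<times> {1..n}) = card ({0 :: nat} \<times> {1..y}) + card ({i} \<times> {1..n})"
      by (rule card_Un_disjoint) (use assms in auto)
    then show ?thesis by (subst card_image) (auto simp: card_cartesian_product)
  qed
  ultimately show ?thesis
    using assms
    by (simp, subst emeasure_seed_box[where f = "\<lambda>_. 1 - p"])
      (auto simp: emeasure_uniform01_atLeast power_add)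
qed

text \<open>A bound on the reward if no fallen walk returns. Either every auxiliary walk falls by time \<open>N + 1\<close>, and then
  the seeds lie in a stop box whenever the reward is positive, or some auxiliary walk survives longer, and then the reward
  is at most the survival time of the main walk.\<close>

definition limit_reward_bound where
  "limit_reward_bound r p K N \<omega> =
    (\<Sum>g\<in>PiE {1..K} (\<lambda>_. {..N}). \<Sum>y. ennreal (real (Suc y)) * indicator (stop_box r p K g (Suc y)) \<omega>) +
    (\<Sum>i = 1..K. \<Sum>y. indicator ({\<omega>. alive p 0 (Suc y) \<omega>} \<inter> {\<omega>. alive p i (N + 1) \<omega>}) (\<omega> :: seeds) :: ennreal)"

lemma induced_time_eq_enat:
  assumes "induced_time K r X U \<omega> = enat m"
  shows "1 \<le> m" "U m \<omega> \<le> r m (aux_data K X \<omega>) (\<lambda>j\<in>{1..m}. max 0 (walk X 0 \<omega> j))"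
    "\<And>k. 1 \<le> k \<Longrightarrow> k < m \<Longrightarrow> r k (aux_data K X \<omega>) (\<lambda>j\<in>{1..k}. max 0 (walk X 0 \<omega> j)) < U k \<omega>"
  using assms unfolding induced_time_def Inf_enat_image_eq_iff by (auto simp: not_le)

lemma reward_coin_le_limit:
  assumes B: "B0 \<le> B" and good: "\<And>i k. i \<le> K \<Longrightarrow> walk (coin p B0) i \<omega> k \<le> B - B0"
  shows "ennreal (stopped_reward (walk (coin p B) 0 \<omega>) (induced_time K r (coin p B) (\<lambda>k \<omega>. \<omega> (Inr k)) \<omega>))
    \<le> limit_reward_bound r p K N \<omega>"
proof (cases "induced_time K r (coin p B) (\<lambda>k \<omega>. \<omega> (Inr k)) \<omega>")
  case (enat m)
  note pos = positive_part_walk_coin[OF B good]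
  note stop = induced_time_eq_enat[OF enat]
  show ?thesis
  proof (cases "alive p 0 m \<omega>")
    case True
    have reward: "ennreal (stopped_reward (walk (coin p B) 0 \<omega>) (enat m)) = of_nat m"
      using pos[of 0 m] True by (simp add: ennreal_of_nat_eq_real_of_nat)
    obtain y where y: "m = Suc y" using stop(1) by (cases m) auto
    show ?thesis
    proof (cases "\<exists>i\<in>{1..K}. alive p i (N + 1) \<omega>")
      case True
      then obtain i where i: "i \<in> {1..K}" "alive p i (N + 1) \<omega>" by blast
      let ?f = "\<lambda>i y. indicator ({\<omega>. alive p 0 (Suc y) \<omega>} \<inter> {\<omega>. alive p i (N + 1) \<omega>}) \<omega> :: ennreal"
      have "of_nat m = (\<Sum>y<m. ?f i y)"
        using alive_mono[OF \<open>alive p 0 m \<omega>\<close>] i(2) by simp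
      also have "\<dots> \<le> (\<Sum>y. ?f i y)" by (intro sum_le_suminf) auto
      also have "\<dots> \<le> (\<Sum>i = 1..K. \<Sum>y. ?f i y)"
        using i(1) by (intro member_le_sum) auto
      also have "\<dots> \<le> limit_reward_bound r p K N \<omega>"
        unfolding limit_reward_bound_def by simp
      finally show ?thesis using reward enat by simp
    next
      case False
      have "\<forall>i\<in>{1..K}. \<exists>n\<le>N. alive p i n \<omega> \<and> \<not> alive p i (Suc n) \<omega>"
      proof
        fix i assume "i \<in> {1..K}"
        then have "\<not> alive p i (N + 1) \<omega>" using False by blast
        then show "\<exists>n\<le>N. alive p i n \<omega> \<and> \<not> alive p i (Suc n) \<omega>"
          using ex_least_nat_less[of "\<lambda>n. \<not> alive p i n \<omega>" "N + 1"] alive_mono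
          by (auto simp: less_Suc_eq_le)
      qed
      then obtain g0 where g0: "\<And>i. i \<in> {1..K} \<Longrightarrow> g0 i \<le> N \<and> alive p i (g0 i) \<omega> \<and> \<not> alive p i (Suc (g0 i)) \<omega>"
        by metis
      define g where "g = restrict g0 {1..K}"
      have g: "g \<in> PiE {1..K} (\<lambda>_. {..N})"
        "\<And>i. i \<in> {1..K} \<Longrightarrow> alive p i (g i) \<omega>" "\<And>i. i \<in> {1..K} \<Longrightarrow> \<not> alive p i (Suc (g i)) \<omega>"
        using g0 by (auto simp: g_def)
      have alive_iff: "alive p i t \<omega> \<longleftrightarrow> t \<le> g i" if "i \<in> {1..K}" for i t
        using g(2,3)[OF that] alive_mono by (metis not_less_eq_eq)
      have data: "aux_data K (coin p B) \<omega> = limit_data K g"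
        unfolding aux_data_def limit_data_def
        by (intro restrict_ext) (auto simp: pos alive_iff)
      have seen: "(\<lambda>j\<in>{1..k}. max 0 (walk (coin p B) 0 \<omega> j)) = (\<lambda>j\<in>{1..k}. real j)" if "k \<le> m" for k
        using that alive_mono[OF \<open>alive p 0 m \<omega>\<close>] by (intro restrict_ext) (auto simp: pos)
      have "\<omega> \<in> stop_box r p K g m"
        unfolding seed_box_def
      proof safe
        fix j assume j: "j \<in> stop_indices K g m"
        consider t where "j = Inl (0, t)" "t \<in> {1..m}"
          | i t where "j = Inl (i, t)" "i \<in> {1..K}" "t \<in> {1..Suc (g i)}"
          | k where "j = Inr k" "k \<in> {1..m}"
          using j by (auto simp: stop_indices_def)
        then show "\<omega> j \<in> stop_sides r p K g m j"
        proof cases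
          case 1
          then show ?thesis using \<open>alive p 0 m \<omega>\<close> by (auto simp: stop_sides_def alive_def)
        next
          case 2
          have up: "p \<le> \<omega> (Inl (i, t))" if "t \<le> g i"
            using g(2)[OF 2(2)] 2(3) that by (auto simp: alive_def)
          obtain s where s: "s \<in> {1..Suc (g i)}" "\<omega> (Inl (i, s)) < p"
            using g(3)[OF 2(2)] by (auto simp: alive_def not_le)
          have "\<not> s \<le> g i"
          proof
            assume "s \<le> g i"
            with s have "s \<in> {1..g i}" by simp
            with g(2)[OF 2(2)] have "p \<le> \<omega> (Inl (i, s))" unfolding alive_def by blast
            with s show False by simp
          qed
          then have "\<omega> (Inl (i, Suc (g i))) < p"
            using s by (auto simp: le_Suc_eq)
          then show ?thesis
            using 2 up by (auto simp: stop_sides_def le_Suc_eq)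
        next
          case 3
          then show ?thesis
            using stop(2) stop(3)[of k] seen[of k]
            by (auto simp: stop_sides_def limit_rule_def data)
        qed
      qed
      let ?f = "\<lambda>g y. ennreal (real (Suc y)) * indicator (stop_box r p K g (Suc y)) \<omega>"
      have "of_nat m = (\<Sum>z\<in>{y}. ?f g z)"
        using \<open>\<omega> \<in> stop_box r p K g m\<close> by (simp add: y ennreal_of_nat_eq_real_of_nat del: of_nat_Suc)
      also have "\<dots> \<le> (\<Sum>z. ?f g z)" by (intro sum_le_suminf) auto
      also have "\<dots> \<le> (\<Sum>g\<in>PiE {1..K} (\<lambda>_. {..N}). \<Sum>z. ?f g z)"
        using g(1) by (intro member_le_sum finite_PiE) auto
      also have "\<dots> \<le> limit_reward_bound r p K N \<omega>"
        unfolding limit_reward_bound_def by simp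
      finally show ?thesis using reward enat by simp
    qed
  next
    case False
    then show ?thesis using enat pos[of 0 m] by simp
  qed
qed simp

lemma measurable_limit_reward_bound [measurable]:
  "limit_reward_bound r p K N \<in> borel_measurable seed_space"
  unfolding limit_reward_bound_def[abs_def]
  by (intro borel_measurable_add borel_measurable_sum borel_measurable_suminf_order borel_measurable_times_ennreal
      borel_measurable_indicator borel_measurable_const sets.Int alive_sets seed_box_sets
      finite_stop_indices stop_sides_sets)

lemma nn_integral_limit_reward_bound:
  assumes r: "stopping_rule K r" and p: "0 < p" "p < 1"
  shows "ennreal (p / (1 - p)) * (\<integral>\<^sup>+\<omega>. limit_reward_bound r p K N \<omega> \<partial>seed_space) =
    (\<Sum>g\<in>PiE {1..K} (\<lambda>_. {..N}). \<Sum>y. ennreal (limit_weight r K g y *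
        (p ^ K * (1 - p) ^ (\<Sum>i = 1..K. g i) * (p * ((real y + 1) * (1 - p) ^ y))))) +
      ennreal (real K * (1 - p) ^ (N + 1))"
proof -
  let ?box = "PiE {1..K} (\<lambda>_. {..N})"
  let ?a = "\<lambda>g y \<omega>. ennreal (real (Suc y)) * indicator (stop_box r p K g (Suc y)) \<omega> :: ennreal"
  let ?b = "\<lambda>i y \<omega>. indicator ({\<omega>. alive p 0 (Suc y) \<omega>} \<inter> {\<omega>. alive p i (N + 1) \<omega>}) \<omega> :: ennreal"
  have ma: "?a g y \<in> borel_measurable seed_space" for g y
    by (intro borel_measurable_times_ennreal borel_measurable_indicator borel_measurable_const
        seed_box_sets finite_stop_indices stop_sides_sets)
  have mb: "?b i y \<in> borel_measurable seed_space" for i y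
    by (intro borel_measurable_indicator sets.Int alive_sets)
  have a: "ennreal (p / (1 - p)) * (\<integral>\<^sup>+\<omega>. ?a g y \<omega> \<partial>seed_space) =
      ennreal (limit_weight r K g y *
        (p ^ K * (1 - p) ^ (\<Sum>i = 1..K. g i) * (p * ((real y + 1) * (1 - p) ^ y))))" for g y
  proof -
    let ?w = "(1 - p) ^ Suc y * (p ^ K * (1 - p) ^ (\<Sum>i = 1..K. g i)) * limit_weight r K g y"
    have w: "0 \<le> ?w" using p limit_weight_nonneg[OF r] by (intro mult_nonneg_nonneg) auto
    have "(\<integral>\<^sup>+\<omega>. ?a g y \<omega> \<partial>seed_space) = ennreal (real (Suc y)) * ennreal ?w"
      unfolding emeasure_stop_box[OF r p, symmetric]
      by (intro nn_integral_cmult_indicator seed_box_sets finite_stop_indices stop_sides_sets)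
    also have "ennreal (p / (1 - p)) * \<dots> = ennreal (p / (1 - p) * (real (Suc y) * ?w))"
      using p w by (simp only: ennreal_mult[symmetric] of_nat_0_le_iff divide_nonneg_pos
          less_imp_le diff_gt_0_iff_gt mult_nonneg_nonneg)
    also have "p / (1 - p) * (real (Suc y) * ?w) = limit_weight r K g y *
        (p ^ K * (1 - p) ^ (\<Sum>i = 1..K. g i) * (p * ((real y + 1) * (1 - p) ^ y)))"
      using p by (simp add: field_simps)
    finally show ?thesis .
  qed
  have b: "ennreal (p / (1 - p)) * (\<Sum>y. \<integral>\<^sup>+\<omega>. ?b i y \<omega> \<partial>seed_space) = ennreal ((1 - p) ^ (N + 1))"
    if "i \<in> {1..K}" for i
  proof -
    have "(\<integral>\<^sup>+\<omega>. ?b i y \<omega> \<partial>seed_space) = ennreal ((1 - p) ^ (N + 1)) * ennreal ((1 - p) ^ Suc y)" for y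
      using that p emeasure_two_alive[of p i "Suc y" "N + 1"]
      by (subst nn_integral_indicator)
        (auto intro!: sets.Int alive_sets simp: ennreal_mult[symmetric] mult_ac)
    then have "(\<Sum>y. \<integral>\<^sup>+\<omega>. ?b i y \<omega> \<partial>seed_space) = ennreal ((1 - p) ^ (N + 1)) * ennreal ((1 - p) / p)"
      by (simp only: ennreal_suminf_cmult suminf_geometric_Suc[OF p])
    moreover have "ennreal (p / (1 - p)) * (ennreal ((1 - p) ^ (N + 1)) * ennreal ((1 - p) / p)) =
        ennreal (p / (1 - p) * ((1 - p) ^ (N + 1) * ((1 - p) / p)))"
    proof -
      have "0 \<le> p / (1 - p)" "0 \<le> (1 - p) ^ (N + 1)" "0 \<le> (1 - p) / p" using p by auto
      then show ?thesis by (simp only: ennreal_mult mult_nonneg_nonneg)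
    qed
    moreover have "p / (1 - p) * ((1 - p) ^ (N + 1) * ((1 - p) / p)) = (1 - p) ^ (N + 1)"
      using p by (simp add: field_simps)
    ultimately show ?thesis by (simp only:)
  qed
  let ?A = "\<Sum>g\<in>?box. \<Sum>y. \<integral>\<^sup>+\<omega>. ?a g y \<omega> \<partial>seed_space"
  let ?B = "\<Sum>i = 1..K. \<Sum>y. \<integral>\<^sup>+\<omega>. ?b i y \<omega> \<partial>seed_space"
  have total: "(\<integral>\<^sup>+\<omega>. limit_reward_bound r p K N \<omega> \<partial>seed_space) =
      (\<Sum>g\<in>?box. \<Sum>y. \<integral>\<^sup>+\<omega>. ?a g y \<omega> \<partial>seed_space) + (\<Sum>i = 1..K. \<Sum>y. \<integral>\<^sup>+\<omega>. ?b i y \<omega> \<partial>seed_space)"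
  proof -
    have 1: "(\<integral>\<^sup>+\<omega>. (\<Sum>g\<in>?box. \<Sum>y. ?a g y \<omega>) \<partial>seed_space) = (\<Sum>g\<in>?box. \<Sum>y. \<integral>\<^sup>+\<omega>. ?a g y \<omega> \<partial>seed_space)"
      by (simp only: nn_integral_sum nn_integral_suminf ma borel_measurable_suminf_order)
    have 2: "(\<integral>\<^sup>+\<omega>. (\<Sum>i = 1..K. \<Sum>y. ?b i y \<omega>) \<partial>seed_space) = (\<Sum>i = 1..K. \<Sum>y. \<integral>\<^sup>+\<omega>. ?b i y \<omega> \<partial>seed_space)"
      by (simp only: nn_integral_sum nn_integral_suminf mb borel_measurable_suminf_order)
    show ?thesis
      unfolding limit_reward_bound_def
      by (subst nn_integral_add)
        (intro borel_measurable_sum borel_measurable_suminf_order ma mb, intro borel_measurable_sum borel_measurable_suminf_order ma mb,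
          simp only: 1 2)
  qed
  have A: "ennreal (p / (1 - p)) * ?A = (\<Sum>g\<in>?box. \<Sum>y. ennreal (limit_weight r K g y *
      (p ^ K * (1 - p) ^ (\<Sum>i = 1..K. g i) * (p * ((real y + 1) * (1 - p) ^ y)))))"
    by (simp only: sum_distrib_left ennreal_suminf_cmult[symmetric] a)
  have B: "ennreal (p / (1 - p)) * ?B = ennreal (real K * (1 - p) ^ (N + 1))"
  proof -
    have "ennreal (p / (1 - p)) * ?B = (\<Sum>i = 1..K. ennreal (p / (1 - p)) * (\<Sum>y. \<integral>\<^sup>+\<omega>. ?b i y \<omega> \<partial>seed_space))"
      by (rule sum_distrib_left)
    also have "(\<Sum>i = 1..K. ennreal (p / (1 - p)) * (\<Sum>y. \<integral>\<^sup>+\<omega>. ?b i y \<omega> \<partial>seed_space)) =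
        (\<Sum>i = 1..K. ennreal ((1 - p) ^ (N + 1)))"
      by (intro sum.cong refl b)
    also have "\<dots> = ennreal (\<Sum>i = 1..K. (1 - p) ^ (N + 1))"
      using p by (intro sum_ennreal) auto
    finally show ?thesis by simp
  qed
  show ?thesis unfolding total distrib_left A B ..
qed

section \<open>Optimality of the constant\<close>

text \<open>The reward is at most its limiting bound plus the maximum of one fixed integrable walk on the event that a
  fallen walk may return. The probability of that event vanishes as the depth of the falls grows.\<close>

lemma guarantee_le_limit:
  assumes r: "stopping_rule K r" and p: "0 < p" "p < 1" and c: "0 \<le> c"
    and guarantee: "\<And>F (M :: seeds measure) X U.
      negative_mean_dist F \<Longrightarrow> randomised_walk_increments K F M X U \<Longrightarrow>
      ennreal c * expected_max M X \<le> expected_reward M X (induced_time K r X U)"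
  shows "ennreal c \<le> (\<Sum>g\<in>PiE {1..K} (\<lambda>_. {..N}). \<Sum>y. ennreal (limit_weight r K g y *
        (p ^ K * (1 - p) ^ (\<Sum>i = 1..K. g i) * (p * ((real y + 1) * (1 - p) ^ y))))) +
      ennreal (real K * (1 - p) ^ (N + 1))"
proof -
  \<comment> \<open>Any depth with negative drift will do as the reference walk that dominates all deeper ones.\<close>
  define B0 where "B0 = 1 / p"
  have B0: "0 \<le> B0" "1 < (1 + B0) * p" using p by (auto simp: B0_def field_simps)
  let ?M0 = "\<lambda>\<omega>. SUP k. ennreal (walk (coin p B0) 0 \<omega> k)"
  \<comment> \<open>Falls that are deeper by \<open>n\<close> exclude returns as long as the reference walks stay below \<open>n\<close>.\<close>
  let ?bad = "\<lambda>n. {\<omega>\<in>space seed_space. \<exists>i\<in>{..K}. \<exists>k. real n < walk (coin p B0) i \<omega> k}"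
  have bad: "?bad n \<in> sets seed_space" for n by measurable
  have M0: "?M0 \<in> borel_measurable seed_space" by measurable
  have fin: "(\<integral>\<^sup>+\<omega>. ?M0 \<omega> \<partial>seed_space) < \<infinity>"
    by (rule nn_integral_SUP_walk_coin_finite[OF p B0(2,1)])
  have "AE \<omega> in seed_space. \<forall>i. (SUP k. ennreal (walk (coin p B0) i \<omega> k)) \<noteq> \<infinity>"
    unfolding AE_all_countable
  proof
    fix i
    show "AE \<omega> in seed_space. (SUP k. ennreal (walk (coin p B0) i \<omega> k)) \<noteq> \<infinity>"
    proof (rule nn_integral_PInf_AE)
      show "(\<lambda>\<omega>. SUP k. ennreal (walk (coin p B0) i \<omega> k)) \<in> borel_measurable seed_space"
        by measurable
      show "(\<integral>\<^sup>+\<omega>. (SUP k. ennreal (walk (coin p B0) i \<omega> k)) \<partial>seed_space) \<noteq> \<infinity>"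
        using nn_integral_SUP_walk_coin_finite[OF p B0(2,1), of i] by simp
    qed
  qed
  then have ev: "AE \<omega> in seed_space. eventually (\<lambda>n. \<omega> \<notin> ?bad n) sequentially"
  proof eventually_elim
    case (elim \<omega>)
    have "\<exists>b. \<forall>k. walk (coin p B0) i \<omega> k \<le> b" for i
    proof -
      obtain b where b: "(SUP k. ennreal (walk (coin p B0) i \<omega> k)) = ennreal b" "0 \<le> b"
        using spec[OF elim, of i] by (metis ennreal_cases infinity_ennreal_def)
      have "ennreal (walk (coin p B0) i \<omega> k) \<le> ennreal b" for k
        unfolding b(1)[symmetric] by (rule SUP_upper) simp
      then show ?thesis using b(2) by (auto simp: ennreal_le_iff)
    qed
    then obtain b where b: "\<And>i k. walk (coin p B0) i \<omega> k \<le> b i" by metis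
    obtain n0 :: nat where n0: "Max (b ` {..K}) \<le> real n0" using real_arch_simple by blast
    have "\<omega> \<notin> ?bad n" if "n0 \<le> n" for n
    proof -
      have "walk (coin p B0) i \<omega> k \<le> real n" if "i \<in> {..K}" for i k
      proof -
        have "walk (coin p B0) i \<omega> k \<le> b i" by (rule b)
        also have "\<dots> \<le> Max (b ` {..K})" using that by (intro Max_ge) auto
        also have "\<dots> \<le> real n" by (rule order_trans[OF n0]) (use \<open>n0 \<le> n\<close> in simp)
        finally show ?thesis .
      qed
      then show ?thesis by (auto simp: not_less)
    qed
    then show ?case unfolding eventually_sequentially by blast
  qed
  have lim: "(\<lambda>n. \<integral>\<^sup>+\<omega>. ?M0 \<omega> * indicator (?bad n) \<omega> \<partial>seed_space) \<longlonglongrightarrow> (\<integral>\<^sup>+\<omega>. 0 \<partial>seed_space)"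
  proof (rule nn_integral_dominated_convergence[where w = ?M0])
    show "(\<lambda>\<omega>. ?M0 \<omega> * indicator (?bad n) \<omega>) \<in> borel_measurable seed_space" for n
      using M0 bad by (intro borel_measurable_times_ennreal borel_measurable_indicator)
    show "AE \<omega> in seed_space. ?M0 \<omega> * indicator (?bad n) \<omega> \<le> ?M0 \<omega>" for n
      by (intro AE_I2) (auto simp: indicator_def)
    show "AE \<omega> in seed_space. (\<lambda>n. ?M0 \<omega> * indicator (?bad n) \<omega>) \<longlonglongrightarrow> 0"
      using ev
    proof eventually_elim
      case (elim \<omega>)
      then show ?case
        by (intro tendsto_eventually, elim eventually_mono) (simp only: indicator_simps not_False_eq_True mult_zero_right)
    qed
  qed (use M0 fin in auto)
  let ?main = "\<integral>\<^sup>+\<omega>. limit_reward_bound r p K N \<omega> \<partial>seed_space"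
  have le: "ennreal c * ennreal ((1 - p) / p) \<le> ?main + (\<integral>\<^sup>+\<omega>. ?M0 \<omega> * indicator (?bad n) \<omega> \<partial>seed_space)" for n
  proof -
    let ?B = "B0 + real n"
    let ?U = "\<lambda>k \<omega>. \<omega> (Inr k) :: real"
    have B: "1 < (1 + ?B) * p"
      using B0 p by (smt (verit) mult_right_mono of_nat_0_le_iff)
    have point: "ennreal (stopped_reward (walk (coin p ?B) 0 \<omega>) (induced_time K r (coin p ?B) ?U \<omega>)) \<le>
        limit_reward_bound r p K N \<omega> + ?M0 \<omega> * indicator (?bad n) \<omega>" for \<omega>
    proof (cases "\<omega> \<in> ?bad n")
      case False
      then have good: "walk (coin p B0) i \<omega> k \<le> ?B - B0" if "i \<le> K" for i k
        using that by (auto simp: not_less)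
      have "ennreal (stopped_reward (walk (coin p ?B) 0 \<omega>) (induced_time K r (coin p ?B) ?U \<omega>)) \<le>
          limit_reward_bound r p K N \<omega>"
        by (rule reward_coin_le_limit[OF _ good]) simp_all
      then show ?thesis by (rule order_trans) simp
    next
      case True
      have "ennreal (stopped_reward (walk (coin p ?B) 0 \<omega>) t) \<le> ?M0 \<omega>" for t
      proof (cases t)
        case (enat m)
        have "ennreal (max 0 (walk (coin p ?B) 0 \<omega> m)) \<le> ennreal (walk (coin p B0) 0 \<omega> m)"
          using walk_coin_antimono[of B0 ?B p 0 \<omega> m] by (simp add: max_def ennreal_leI)
        also have "\<dots> \<le> ?M0 \<omega>" by (rule SUP_upper) simp
        finally show ?thesis by (simp add: enat)
      qed simp
      also have "?M0 \<omega> \<le> limit_reward_bound r p K N \<omega> + ?M0 \<omega> * indicator (?bad n) \<omega>"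
        using True by simp
      finally show ?thesis .
    qed
    have "ennreal c * ennreal ((1 - p) / p) \<le> ennreal c * expected_max seed_space (coin p ?B)"
      by (intro mult_left_mono expected_max_coin_ge p) auto
    also have "\<dots> \<le> expected_reward seed_space (coin p ?B) (induced_time K r (coin p ?B) ?U)"
      by (rule guarantee[OF negative_mean_coin_dist[OF p B] randomised_walk_increments_coin])
    also have "\<dots> \<le> (\<integral>\<^sup>+\<omega>. limit_reward_bound r p K N \<omega> + ?M0 \<omega> * indicator (?bad n) \<omega> \<partial>seed_space)"
      unfolding expected_reward_def by (intro nn_integral_mono point)
    also have "\<dots> = ?main + (\<integral>\<^sup>+\<omega>. ?M0 \<omega> * indicator (?bad n) \<omega> \<partial>seed_space)"
      using M0 bad
      by (intro nn_integral_add borel_measurable_times_ennreal borel_measurable_indicator measurable_limit_reward_bound)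
    finally show ?thesis .
  qed
  have "(\<lambda>n. ?main + (\<integral>\<^sup>+\<omega>. ?M0 \<omega> * indicator (?bad n) \<omega> \<partial>seed_space)) \<longlonglongrightarrow> ?main + 0"
    using lim by (intro tendsto_add tendsto_const) simp
  then have "ennreal c * ennreal ((1 - p) / p) \<le> ?main + 0"
    by (rule LIMSEQ_le_const) (use le in blast)
  then have "ennreal (p / (1 - p)) * (ennreal c * ennreal ((1 - p) / p)) \<le> ennreal (p / (1 - p)) * ?main"
    by (intro mult_left_mono) auto
  moreover have "ennreal (p / (1 - p)) * (ennreal c * ennreal ((1 - p) / p)) = ennreal c"
  proof -
    have "ennreal (p / (1 - p)) * (ennreal c * ennreal ((1 - p) / p)) = ennreal (p / (1 - p) * (c * ((1 - p) / p)))"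
    proof -
      have "0 \<le> p / (1 - p)" "0 \<le> (1 - p) / p" using p by auto
      then show ?thesis using c by (simp only: ennreal_mult mult_nonneg_nonneg)
    qed
    also have "p / (1 - p) * (c * ((1 - p) / p)) = c" using p by (simp add: field_simps)
    finally show ?thesis .
  qed
  ultimately show ?thesis
    unfolding nn_integral_limit_reward_bound[OF r p] by simp
qed

theorem guarantee_le_opt_const:
  assumes K: "K \<ge> 1" and r: "stopping_rule K r" and c: "0 \<le> c"
    and guarantee: "\<And>F (M :: seeds measure) X U.
      negative_mean_dist F \<Longrightarrow> randomised_walk_increments K F M X U \<Longrightarrow>
      ennreal c * expected_max M X \<le> expected_reward M X (induced_time K r X U)"
  shows "c \<le> opt_const K"
  using limit_weight_nonneg[OF r] suminf_limit_weight_le_1[OF r] c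
    guarantee_le_limit[OF r _ _ c guarantee]
  by (rule bayes_optimality[OF K, where v = "limit_weight r K"])

theorem theorem1:
  fixes K :: nat
  assumes "K \<ge> 1"
  shows
    "(\<forall>F (M :: 'w measure) X Y.
        negative_mean_dist F \<and> walk_increments K F M X \<and> poissonised_index K M X Y \<longrightarrow>
        expected_reward M X (poissonised_time X Y)
          \<ge> ennreal ((real K / (real K + 1)) ^ (K + 1)) * expected_max M X)
     \<and>
     (\<forall>c :: real. c > (real K / (real K + 1)) ^ (K + 1) \<longrightarrow>
        \<not> (\<exists>r. stopping_rule K r \<and>
             (\<forall>F (M :: ((nat \<times> nat) + nat \<Rightarrow> real) measure) X U.
                negative_mean_dist F \<and> randomised_walk_increments K F M X U \<longrightarrow>
                expected_reward M X (induced_time K r X U) \<ge> ennreal c * expected_max M X)))"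
proof (intro conjI allI impI)
  fix F :: "real measure" and M :: "'w measure" and X Y
  assume *: "negative_mean_dist F \<and> walk_increments K F M X \<and> poissonised_index K M X Y"
  then interpret walks K F M X by unfold_locales auto
  show "expected_reward M X (poissonised_time X Y) \<ge>
      ennreal ((real K / (real K + 1)) ^ (K + 1)) * expected_max M X"
    using poissonised_prophet_inequality[OF assms] * by blast
next
  fix c :: real
  assume c: "c > (real K / (real K + 1)) ^ (K + 1)"
  have "0 \<le> c" using c opt_const_nonneg[of K] unfolding opt_const_def by linarith
  from guarantee_le_opt_const[OF assms _ this] c
  show "\<not> (\<exists>r. stopping_rule K r \<and>
      (\<forall>F (M :: ((nat \<times> nat) + nat \<Rightarrow> real) measure) X U.
         negative_mean_dist F \<and> randomised_walk_increments K F M X U \<longrightarrow>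
         expected_reward M X (induced_time K r X U) \<ge> ennreal c * expected_max M X))"
    by (force simp: opt_const_def not_le[symmetric])
qed

end
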